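(* For any space $X$ and point $x\in X$, the following are equivalent: (1) for every map $f:(\mathbb{H},b_0)\to(X,x)$ there exists a homomorphism $g:\pi_1(\mathbb{T},x_0)\to\pi_1(X,x)$ with $f_\#=g\circ\eta_\#$; (2) $X$ is transfinitely $\pi_1$-commutative at $x$; (3) $X$ is infinitely $\pi_1$-commutative at $x$.
   Context: $I=[0,1]$; $\Omega(X,x)$ is the space of loops at $x$. Let $C_n\subset\mathbb{R}^2$ be the circle of radius $1/n$ centered at $(1/n,0)$, $\mathbb{H}=\bigcup_nC_n$ the Hawaiian earring with basepoint $b_0=(0,0)$, $\ell_n$ the counterclockwise loop around $C_n$ based at $b_0$. A sequence $\alpha_n\in\Omega(X,x)$ is a null-sequence if each neighborhood of $x$ contains $\mathrm{Im}(\alpha_n)$ for all but finitely many $n$; null-sequences correspond bijectively to maps $f:(\mathbb{H},b_0)\to(X,x)$ via $f\circ\ell_n=\alpha_n$. Let $\ell_\infty$ be the loop in $\mathbb{H}$ equal to $\ell_n$ (linearly reparametrized) on $[\frac{n-1}{n},\frac{n}{n+1}]$ with $\ell_\infty(1)=b_0$. Let $\mathcal{C}\subseteq I$ be the middle-thirds Cantor set and write $I\setminus\mathcal{C}=\bigcup_{n\geq1}\bigcup_{k=1}^{2^{n-1}}I_n^k$ where $I_n^k$ are the open intervals of length $3^{-n}$, indexed for fixed $n$ in their left-to-right order; $\ell_\tau$ is the loop with $\ell_\tau(\mathcal{C})=b_0$ that equals (a linear reparametrization of) $\ell_{2^{n-1}+k-1}$ on $\overline{I_n^k}$. For a null-sequence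 $\{\alpha_n\}$ with associated map $f$, $\prod_{n=1}^\infty\alpha_n:=f\circ\ell_\infty$ and $\prod_\tau\alpha_n:=f\circ\ell_\tau$. $X$ is infinitely (resp. transfinitely) $\pi_1$-commutative at $x$ if for every null-sequence $\alpha_n\in\Omega(X,x)$ and every bijection $\phi:\mathbb{N}\to\mathbb{N}$, $[\prod_{n=1}^\infty\alpha_n]=[\prod_{n=1}^\infty\alpha_{\phi(n)}]$ (resp. $[\prod_\tau\alpha_n]=[\prod_\tau\alpha_{\phi(n)}]$) in $\pi_1(X,x)$. $\mathbb{T}=\prod_{n\in\mathbb{N}}S^1$ with basepoint $x_0$, and $\eta:\mathbb{H}\to\mathbb{T}$ is the embedding onto $\bigvee_nS^1$ sending $C_n$ to the $n$-th circle factor; $\pi_1(\mathbb{T},x_0)\cong\mathbb{Z}^{\mathbb{N}}$. *)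

theory Defs
  imports "HOL-Analysis.Analysis" "HOL-Algebra.Group"
begin

definition loop :: "'a topology \<Rightarrow> 'a \<Rightarrow> (real \<Rightarrow> 'a) \<Rightarrow> bool" where
  "loop X x p \<longleftrightarrow> pathin X p \<and> p 0 = x \<and> p 1 = x"

definition loop_homotopic :: "'a topology \<Rightarrow> (real \<Rightarrow> 'a) \<Rightarrow> (real \<Rightarrow> 'a) \<Rightarrow> bool" where
  "loop_homotopic X p q \<longleftrightarrow>
     homotopic_with (\<lambda>h. h 0 = p 0 \<and> h 1 = p 1) (top_of_set {0..1}) X p q"

definition loop_class :: "'a topology \<Rightarrow> (real \<Rightarrow> 'a) \<Rightarrow> (real \<Rightarrow> 'a) set" where
  "loop_class X p = {q. loop_homotopic X p q}"

text \<open>Concatenation of paths (same formula as the library's \<open>+++\<close>, for arbitrary types).\<close>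
definition path_concat :: "(real \<Rightarrow> 'a) \<Rightarrow> (real \<Rightarrow> 'a) \<Rightarrow> real \<Rightarrow> 'a" where
  "path_concat p q = (\<lambda>t. if t \<le> 1/2 then p (2 * t) else q (2 * t - 1))"

definition fundamental_group :: "'a topology \<Rightarrow> 'a \<Rightarrow> (real \<Rightarrow> 'a) set monoid" where
  "fundamental_group X x =
     \<lparr>carrier = loop_class X ` {p. loop X x p},
      monoid.mult = (\<lambda>A B. loop_class X (path_concat (SOME p. p \<in> A) (SOME q. q \<in> B))),
      one = loop_class X (\<lambda>t. x)\<rparr>"

definition induced :: "'b topology \<Rightarrow> ('a \<Rightarrow> 'b) \<Rightarrow> (real \<Rightarrow> 'a) set \<Rightarrow> (real \<Rightarrow> 'b) set" where
  "induced Y f A = loop_class Y (f \<circ> (SOME p. p \<in> A))"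

definition hcircle :: "nat \<Rightarrow> complex set" where
  "hcircle n = sphere (of_real (1 / real n)) (1 / real n)"

definition hawaiian :: "complex set" where
  "hawaiian = (\<Union>n\<in>{1..}. hcircle n)"

definition HE :: "complex topology" where
  "HE = top_of_set hawaiian"

definition b0 :: complex where "b0 = 0"

text \<open>\<open>\<Prod>_{n} S^1\<close>; factor \<open>m\<close> is the circle corresponding to \<open>C_{m+1}\<close>.\<close>
definition torus :: "(nat \<Rightarrow> complex) topology" where
  "torus = product_topology (\<lambda>n. top_of_set (sphere 0 1)) UNIV"

definition x0 :: "nat \<Rightarrow> complex" where "x0 = (\<lambda>n. 1)"

text \<open>\<open>z \<mapsto> 1 - n z\<close> is an orientation-preserving similarity \<open>C_n \<rightarrow> S^1\<close> sending \<open>b0\<close> to \<open>1\<close>.\<close>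
definition eta :: "complex \<Rightarrow> (nat \<Rightarrow> complex)" where
  "eta z = (\<lambda>m. if z \<in> hcircle (Suc m) then 1 - of_nat (Suc m) * z else 1)"

definition null_sequence :: "'a topology \<Rightarrow> 'a \<Rightarrow> (nat \<Rightarrow> real \<Rightarrow> 'a) \<Rightarrow> bool" where
  "null_sequence X x \<alpha> \<longleftrightarrow> (\<forall>n. loop X x (\<alpha> n)) \<and>
     (\<forall>U. openin X U \<and> x \<in> U \<longrightarrow> eventually (\<lambda>n. \<alpha> n ` {0..1} \<subseteq> U) sequentially)"

text \<open>Sequences are indexed from 0: \<open>\<alpha> n\<close> is the paper's \<open>\<alpha>_{n+1}\<close>, placed on
  \<open>[n/(n+1), (n+1)/(n+2)]\<close>.\<close>
definition inf_interval :: "nat \<Rightarrow> real set" where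
  "inf_interval n = {real n / real (n+1) <..< real (n+1) / real (n+2)}"

definition inf_prod :: "'a \<Rightarrow> (nat \<Rightarrow> real \<Rightarrow> 'a) \<Rightarrow> real \<Rightarrow> 'a" where
  "inf_prod x \<alpha> t =
     (if \<exists>n. t \<in> inf_interval n
      then (let n = (THE n. t \<in> inf_interval n);
                c = real n / real (n+1); d = real (n+1) / real (n+2)
            in \<alpha> n ((t - c) / (d - c)))
      else x)"

text \<open>Middle-third interval \<open>I_{m+1}^{j+1}\<close> (level \<open>m\<close>, position \<open>j < 2^m\<close> from the left):
  its left endpoint is \<open>a + 3^{-(m+1)}\<close> where \<open>a = \<Sum>_{i<m} 2 b_i 3^{-(i+1)}\<close> and
  \<open>b_0 \<dots> b_{m-1}\<close> are the binary digits of \<open>j\<close>, most significant first.\<close>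
definition cantor_left :: "nat \<Rightarrow> nat \<Rightarrow> real" where
  "cantor_left m j = (\<Sum>i<m. 2 * real ((j div 2 ^ (m - 1 - i)) mod 2) / 3 ^ (i + 1))"

definition cantor_gap :: "nat \<Rightarrow> nat \<Rightarrow> real set" where
  "cantor_gap m j = {cantor_left m j + 1 / 3 ^ (m+1) <..< cantor_left m j + 2 / 3 ^ (m+1)}"

definition tau_prod :: "'a \<Rightarrow> (nat \<Rightarrow> real \<Rightarrow> 'a) \<Rightarrow> real \<Rightarrow> 'a" where
  "tau_prod x \<alpha> t =
     (if \<exists>m j. j < 2 ^ m \<and> t \<in> cantor_gap m j
      then (let (m, j) = (THE (m, j). j < 2 ^ m \<and> t \<in> cantor_gap m j);
                c = cantor_left m j + 1 / 3 ^ (m+1)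
            in \<alpha> (2 ^ m + j - 1) ((t - c) * 3 ^ (m+1)))
      else x)"

definition infinitely_pi1_commutative :: "'a topology \<Rightarrow> 'a \<Rightarrow> bool" where
  "infinitely_pi1_commutative X x \<longleftrightarrow>
     (\<forall>\<alpha> \<phi>. null_sequence X x \<alpha> \<and> bij (\<phi> :: nat \<Rightarrow> nat) \<longrightarrow>
        loop_homotopic X (inf_prod x \<alpha>) (inf_prod x (\<alpha> \<circ> \<phi>)))"

definition transfinitely_pi1_commutative :: "'a topology \<Rightarrow> 'a \<Rightarrow> bool" where
  "transfinitely_pi1_commutative X x \<longleftrightarrow>
     (\<forall>\<alpha> \<phi>. null_sequence X x \<alpha> \<and> bij (\<phi> :: nat \<Rightarrow> nat) \<longrightarrow>
        loop_homotopic X (tau_prod x \<alpha>) (tau_prod x (\<alpha> \<circ> \<phi>)))"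

definition factors_through_eta :: "'a topology \<Rightarrow> 'a \<Rightarrow> bool" where
  "factors_through_eta X x \<longleftrightarrow>
     (\<forall>f. continuous_map HE X f \<and> f b0 = x \<longrightarrow>
        (\<exists>g. g \<in> hom (fundamental_group torus x0) (fundamental_group X x) \<and>
             (\<forall>A \<in> carrier (fundamental_group HE b0).
                 induced X f A = g (induced torus eta A))))"

end

theory Submission
  imports Defs
begin

text \<open>
  A loop is tiled by a null family of loops if these are placed on disjoint subintervals and the
  rest of the interval goes to the basepoint; two tilings with the same order and tilewise
  homotopic tiles are homotopic. If the factorization through \<open>\<eta>\<close> exists, transfinite products may
  be permuted because in the torus tiles can be moved past each other, one coordinate at a time.
  Infinite products are those transfinite products whose nontrivial factors sit on the rightmost
  gaps of the Cantor set. Finally, if infinite products may be permuted, then \<open>f \<circ> p\<close> is homotopic to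
  the infinite product of the images under \<open>f\<close> of the projections of \<open>p\<close> to the single circles: cut
  the first circle off \<open>p\<close>, then the second one, and so on, insert cancelling pairs, and regroup
  the resulting sequence of pieces. Hence the class of \<open>f \<circ> p\<close> depends on that of
  \<open>\<eta> \<circ> p\<close> only, and \<open>\<eta>\<close> is surjective on fundamental groups.
\<close>

section \<open>Tilings of the unit interval\<close>

text \<open>Continuity can fail only at the basepoint: infinitely many homotopies run at once, so
  each one is confined to a set \<open>S k\<close>, and these sets have to shrink to
  \<open>x\<close>. This is why homotopies are so often carried out in subspaces. The second
  obstacle is that a loop in the earring may switch between the first circle and the others
  infinitely often, so it need not be a finite product of loops of the two kinds. The angle of its
  projection to the first circle is uniformly continuous, however, and rounding it on a fine grid
  leaves finitely many pieces. This finiteness keeps every factor a finite product, so that the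
  whole product has order type omega, the order type that the hypothesis can permute. Cutting off
  circle after circle never finishes, and it leaves the remainders interleaved with the parts cut
  off. The cancelling pairs are a swindle in the style of Eilenberg and Mazur: one bracketing
  collapses to the given loop, and the other, after a permutation inside the brackets, to the
  product of the projections.\<close>

definition null_family :: "'a topology \<Rightarrow> 'a \<Rightarrow> 'k set \<Rightarrow> ('k \<Rightarrow> 'a set) \<Rightarrow> bool" where
  "null_family X x K S \<longleftrightarrow> (\<forall>U. openin X U \<and> x \<in> U \<longrightarrow> finite {k \<in> K. \<not> S k \<subseteq> U})"

lemma null_familyD: "null_family X x K S \<Longrightarrow> openin X U \<Longrightarrow> x \<in> U \<Longrightarrow> finite {k \<in> K. \<not> S k \<subseteq> U}"
  by (simp add: null_family_def)

lemma null_family_finite: "finite K \<Longrightarrow> null_family X x K S"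
  by (simp add: null_family_def)

lemma null_family_reindex:
  assumes "null_family X x K S" "inj_on \<phi> L" "\<phi> ` L \<subseteq> K"
  shows "null_family X x L (S \<circ> \<phi>)"
  unfolding null_family_def
proof (intro allI impI)
  fix U assume "openin X U \<and> x \<in> U"
  then have "finite {k \<in> K. \<not> S k \<subseteq> U}"
    using assms(1) by (simp add: null_family_def)
  moreover have "\<phi> ` {k \<in> L. \<not> (S \<circ> \<phi>) k \<subseteq> U} \<subseteq> {k \<in> K. \<not> S k \<subseteq> U}"
    using assms(3) by auto
  moreover have "inj_on \<phi> {k \<in> L. \<not> (S \<circ> \<phi>) k \<subseteq> U}"
    using assms(2) by (auto simp: inj_on_def)
  ultimately show "finite {k \<in> L. \<not> (S \<circ> \<phi>) k \<subseteq> U}"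
    by (meson finite_subset finite_imageD)
qed

text \<open>For an open \<open>U\<close> without \<open>x\<close> the preimage is the union of the
  preimages under all \<open>G k\<close>. If \<open>x\<close> lies in \<open>U\<close>, it is their
  intersection, and all but finitely many \<open>G k\<close> map entirely into \<open>U\<close>, so
  the intersection is finite.\<close>

lemma continuous_map_glue_null_family:
  assumes x: "x \<in> topspace X"
    and cont: "\<And>k. k \<in> K \<Longrightarrow> continuous_map Z X (G k)"
    and null: "null_family X x K (\<lambda>k. G k ` topspace Z)"
    and H: "\<And>z. z \<in> topspace Z \<Longrightarrow>
      (\<exists>k\<in>K. H z = G k z \<and> (\<forall>j\<in>K. j \<noteq> k \<longrightarrow> G j z = x)) \<or> (H z = x \<and> (\<forall>j\<in>K. G j z = x))"
  shows "continuous_map Z X H"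
  unfolding continuous_map
proof (intro conjI allI impI)
  have mem: "G k z \<in> topspace X" if "k \<in> K" "z \<in> topspace Z" for k z
    using cont[OF that(1)] that(2) by (auto simp: continuous_map_def Pi_iff)
  show "H ` topspace Z \<subseteq> topspace X"
    using H mem x by fastforce
  fix U assume U: "openin X U"
  show "openin Z {z \<in> topspace Z. H z \<in> U}"
  proof (cases "x \<in> U")
    case False
    have "{z \<in> topspace Z. H z \<in> U} = (\<Union>k\<in>K. {z \<in> topspace Z. G k z \<in> U})"
    proof (intro equalityI subsetI)
      fix z assume "z \<in> {z \<in> topspace Z. H z \<in> U}"
      then show "z \<in> (\<Union>k\<in>K. {z \<in> topspace Z. G k z \<in> U})"
        using H[of z] False by auto
    next
      fix z assume "z \<in> (\<Union>k\<in>K. {z \<in> topspace Z. G k z \<in> U})"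
      then show "z \<in> {z \<in> topspace Z. H z \<in> U}"
        using H[of z] False by auto
    qed
    then show ?thesis
      using cont U by (auto simp: continuous_map_def)
  next
    case True
    let ?B = "{k \<in> K. \<not> G k ` topspace Z \<subseteq> U}"
    have "{z \<in> topspace Z. H z \<in> U} = (\<Inter>k\<in>?B. {z \<in> topspace Z. G k z \<in> U}) \<inter> topspace Z"
    proof (intro equalityI subsetI)
      fix z assume z: "z \<in> {z \<in> topspace Z. H z \<in> U}"
      have "G k z \<in> U" if "k \<in> K" for k
        using H[of z] z True that by auto
      then show "z \<in> (\<Inter>k\<in>?B. {z \<in> topspace Z. G k z \<in> U}) \<inter> topspace Z"
        using z by auto
    next
      fix z assume z: "z \<in> (\<Inter>k\<in>?B. {z \<in> topspace Z. G k z \<in> U}) \<inter> topspace Z"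
      have "G k z \<in> U" if "k \<in> K" for k
        using z that by (cases "k \<in> ?B") auto
      then show "z \<in> {z \<in> topspace Z. H z \<in> U}"
        using H[of z] z True by auto
    qed
    moreover have "finite ?B"
      using null_familyD[OF null U True] .
    moreover have "openin Z {z \<in> topspace Z. G k z \<in> U}" if "k \<in> K" for k
      using cont[OF that] U by (auto simp: continuous_map_def)
    ultimately show ?thesis
      by (metis (no_types, lifting) mem_Collect_eq openin_INT)
  qed
qed

text \<open>There may be infinitely many tiles, of any order type and with accumulating endpoints.
  Tiles are read at interior parameters, which lets binary, infinite and transfinite products fit
  one scheme.\<close>

definition tiles_as ::
    "'a \<Rightarrow> 'k set \<Rightarrow> ('k \<Rightarrow> real) \<Rightarrow> ('k \<Rightarrow> real) \<Rightarrow> ('k \<Rightarrow> real \<Rightarrow> 'a) \<Rightarrow> (real \<Rightarrow> 'a) \<Rightarrow> bool" where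
  "tiles_as x K c d g F \<longleftrightarrow>
     (\<forall>k\<in>K. 0 \<le> c k \<and> c k < d k \<and> d k \<le> 1) \<and>
     (\<forall>j\<in>K. \<forall>k\<in>K. j \<noteq> k \<longrightarrow> d j \<le> c k \<or> d k \<le> c j) \<and>
     (\<forall>k\<in>K. \<forall>t. c k < t \<and> t < d k \<longrightarrow> F t = g k ((t - c k) / (d k - c k))) \<and>
     (\<forall>t\<in>{0..1}. (\<forall>k\<in>K. t \<le> c k \<or> d k \<le> t) \<longrightarrow> F t = x)"

lemma tiles_asI:
  assumes "\<And>k. k \<in> K \<Longrightarrow> 0 \<le> c k" "\<And>k. k \<in> K \<Longrightarrow> c k < d k" "\<And>k. k \<in> K \<Longrightarrow> d k \<le> 1"
    and "\<And>j k. j \<in> K \<Longrightarrow> k \<in> K \<Longrightarrow> j \<noteq> k \<Longrightarrow> d j \<le> c k \<or> d k \<le> c j"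
    and "\<And>k t. k \<in> K \<Longrightarrow> c k < t \<Longrightarrow> t < d k \<Longrightarrow> F t = g k ((t - c k) / (d k - c k))"
    and "\<And>t. 0 \<le> t \<Longrightarrow> t \<le> 1 \<Longrightarrow> (\<And>k. k \<in> K \<Longrightarrow> t \<le> c k \<or> d k \<le> t) \<Longrightarrow> F t = x"
  shows "tiles_as x K c d g F"
  using assms unfolding tiles_as_def by auto

lemma tiles_asD:
  assumes "tiles_as x K c d g F"
  shows "\<And>k. k \<in> K \<Longrightarrow> 0 \<le> c k" "\<And>k. k \<in> K \<Longrightarrow> c k < d k" "\<And>k. k \<in> K \<Longrightarrow> d k \<le> 1"
    and "\<And>j k. j \<in> K \<Longrightarrow> k \<in> K \<Longrightarrow> j \<noteq> k \<Longrightarrow> d j \<le> c k \<or> d k \<le> c j"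
    and "\<And>k t. k \<in> K \<Longrightarrow> c k < t \<Longrightarrow> t < d k \<Longrightarrow> F t = g k ((t - c k) / (d k - c k))"
    and "\<And>t. 0 \<le> t \<Longrightarrow> t \<le> 1 \<Longrightarrow> (\<And>k. k \<in> K \<Longrightarrow> t \<le> c k \<or> d k \<le> t) \<Longrightarrow> F t = x"
  using assms unfolding tiles_as_def by auto

lemma tiles_as_endpoints:
  assumes "tiles_as x K c d g F"
  shows "F 0 = x" "F 1 = x"
proof -
  note D = tiles_asD[OF assms]
  show "F 0 = x" "F 1 = x"
    using D(1,3) by (force intro!: D(6))+
qed

lemma loop_homotopic_iff:
  "loop_homotopic X p q \<longleftrightarrow>
     (\<exists>h. continuous_map (prod_topology (top_of_set {0..1::real}) (top_of_set {0..1})) X h \<and>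
          (\<forall>t\<in>{0..1}. h (0, t) = p t) \<and> (\<forall>t\<in>{0..1}. h (1, t) = q t) \<and>
          (\<forall>s\<in>{0..1}. h (s, 0) = p 0 \<and> h (s, 1) = p 1))"
  unfolding loop_homotopic_def by (subst homotopic_with) (simp_all del: prod_topology_subtopology_eu)

text \<open>The intervals of the first tiling are moved affinely onto those of the second while
  the homotopies run; the order hypothesis keeps the moving intervals disjoint.\<close>

theorem tile_homotopy:
  assumes x: "x \<in> topspace X"
    and F: "tiles_as x K c d g F" and F': "tiles_as x K c' d' g' F'"
    and order: "\<And>j k. j \<in> K \<Longrightarrow> k \<in> K \<Longrightarrow> c j < c k \<Longrightarrow> c' j < c' k"
    and hom: "\<And>k. k \<in> K \<Longrightarrow> loop_homotopic (subtopology X (S k)) (g k) (g' k)"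
    and ends: "\<And>k. k \<in> K \<Longrightarrow> g k 0 = x" "\<And>k. k \<in> K \<Longrightarrow> g k 1 = x"
    and null: "null_family X x K S"
  shows "loop_homotopic X F F'"
proof -
  note D = tiles_asD[OF F] and D' = tiles_asD[OF F']
  let ?I = "top_of_set {0..1::real}"
  have "\<forall>k\<in>K. \<exists>h. continuous_map (prod_topology ?I ?I) (subtopology X (S k)) h \<and>
          (\<forall>t\<in>{0..1}. h (0, t) = g k t) \<and> (\<forall>t\<in>{0..1}. h (1, t) = g' k t) \<and>
          (\<forall>s\<in>{0..1}. h (s, 0) = x \<and> h (s, 1) = x)"
    using hom ends by (simp add: loop_homotopic_iff)
  then obtain h where
      hc: "\<And>k. k \<in> K \<Longrightarrow> continuous_map (prod_topology ?I ?I) (subtopology X (S k)) (h k)"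
    and h0: "\<And>k t. k \<in> K \<Longrightarrow> t \<in> {0..1} \<Longrightarrow> h k (0, t) = g k t"
    and h1: "\<And>k t. k \<in> K \<Longrightarrow> t \<in> {0..1} \<Longrightarrow> h k (1, t) = g' k t"
    and he: "\<And>k s. k \<in> K \<Longrightarrow> s \<in> {0..1} \<Longrightarrow> h k (s, 0) = x \<and> h k (s, 1) = x"
    by metis
  define lo where "lo s k = (1 - s) * c k + s * c' k" for s k
  define hi where "hi s k = (1 - s) * d k + s * d' k" for s k
  have lohi: "lo s k < hi s k" if "k \<in> K" "s \<in> {0..1}" for s k
  proof -
    have "0 \<le> (1 - s) * (d k - c k)" "0 \<le> s * (d' k - c' k)"
      using D(2)[OF that(1)] D'(2)[OF that(1)] that(2) by auto
    moreover have "0 < (1 - s) * (d k - c k) \<or> 0 < s * (d' k - c' k)"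
      using D(2)[OF that(1)] D'(2)[OF that(1)] that(2) by (cases "s = 0") auto
    ultimately show ?thesis
      unfolding lo_def hi_def by (auto simp: algebra_simps)
  qed
  have disj: "hi s j \<le> lo s k \<or> hi s k \<le> lo s j"
    if "j \<in> K" "k \<in> K" "j \<noteq> k" and s: "s \<in> {0..1}" for s j k
  proof -
    \<comment> \<open>Being to the left of another tile persists: it holds for the first tiling by
      assumption, for the second one by the order hypothesis together with disjointness, and convex
      combinations preserve it.\<close>
    have *: "hi s j \<le> lo s k" if j: "j \<in> K" and k: "k \<in> K" and "j \<noteq> k" and "d j \<le> c k" for j k
    proof -
      have "c' j < c' k"
        using order[OF j k] D(2)[OF j] that(4) by linarith
      then have "d' j \<le> c' k"
        using D'(4)[OF j k that(3)] D'(2)[OF k] by linarith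
      then show ?thesis
        unfolding lo_def hi_def using s that(4) by (intro add_mono mult_left_mono) auto
    qed
    show ?thesis
      using D(4)[OF that(1-3)] *[OF that(1-3)] *[OF that(2,1)] that(3) by auto
  qed
  \<comment> \<open>Clamping to the unit interval lets each \<open>G k\<close> be defined on the
    whole square, with value \<open>x\<close> on both sides of the moving tile.\<close>
  define cl where "cl r = max 0 (min 1 (r::real))" for r
  define G where "G k z = h k (fst z, cl ((snd z - lo (fst z) k) / (hi (fst z) k - lo (fst z) k)))"
    for k z
  have Gc: "continuous_map (prod_topology ?I ?I) (subtopology X (S k)) (G k)" if k: "k \<in> K" for k
  proof -
    have "continuous_on ({0..1} \<times> {0..1})
        (\<lambda>z. (fst z, cl ((snd z - lo (fst z) k) / (hi (fst z) k - lo (fst z) k))))"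
      unfolding cl_def lo_def hi_def
      by (intro continuous_intros) (use lohi[OF k] in \<open>fastforce simp: lo_def hi_def\<close>)
    then have "continuous_map (prod_topology ?I ?I) (prod_topology ?I ?I)
        (\<lambda>z. (fst z, cl ((snd z - lo (fst z) k) / (hi (fst z) k - lo (fst z) k))))"
      by (auto simp: cl_def)
    from continuous_map_compose[OF this hc[OF k]] show ?thesis
      unfolding o_def G_def[abs_def] .
  qed
  have Gx: "G k (s, t) = x" if "k \<in> K" "s \<in> {0..1}" "t \<le> lo s k \<or> hi s k \<le> t" for k s t
  proof -
    have "cl ((t - lo s k) / (hi s k - lo s k)) \<in> {0, 1}"
      using lohi[OF that(1,2)] that(3) by (auto simp: cl_def field_simps)
    then show ?thesis
      using he[OF that(1,2)] by (auto simp: G_def)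
  qed
  define H where "H z = (if \<exists>k\<in>K. lo (fst z) k < snd z \<and> snd z < hi (fst z) k
      then G (SOME k. k \<in> K \<and> lo (fst z) k < snd z \<and> snd z < hi (fst z) k) z else x)" for z
  have Hin: "H (s, t) = G k (s, t) \<and> (\<forall>j\<in>K. j \<noteq> k \<longrightarrow> G j (s, t) = x)"
    if k: "k \<in> K" and s: "s \<in> {0..1}" and t: "lo s k < t" "t < hi s k" for k s t
  proof
    have u: "j = k" if "j \<in> K \<and> lo s j < t \<and> t < hi s j" for j
    proof (rule ccontr)
      assume "j \<noteq> k"
      then have "hi s j \<le> lo s k \<or> hi s k \<le> lo s j"
        using disj that k s by simp
      then show False
        using that t by linarith
    qed
    have "(SOME k. k \<in> K \<and> lo s k < t \<and> t < hi s k) = k"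
    proof (rule some_equality)
      show "k \<in> K \<and> lo s k < t \<and> t < hi s k"
        using k t by simp
    qed (rule u)
    then show "H (s, t) = G k (s, t)"
      using k t by (auto simp: H_def)
    show "\<forall>j\<in>K. j \<noteq> k \<longrightarrow> G j (s, t) = x"
    proof (intro ballI impI)
      fix j assume "j \<in> K" "j \<noteq> k"
      then show "G j (s, t) = x"
        using u[of j] Gx[of j s t] s by linarith
    qed
  qed
  have Hout: "H (s, t) = x" if "\<And>k. k \<in> K \<Longrightarrow> t \<le> lo s k \<or> hi s k \<le> t" for s t
  proof -
    have "\<not> (\<exists>k\<in>K. lo s k < t \<and> t < hi s k)"
      using that by (meson not_le)
    then show ?thesis
      unfolding H_def fst_conv snd_conv by (rule if_not_P)
  qed
  have "continuous_map (prod_topology ?I ?I) X H"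
  proof (rule continuous_map_glue_null_family[OF x])
    show "continuous_map (prod_topology ?I ?I) X (G k)" if "k \<in> K" for k
      using Gc[OF that] continuous_map_in_subtopology by blast
    \<comment> \<open>The homotopy of tile \<open>k\<close> never leaves \<open>S k\<close>, so
      smallness of the sets \<open>S k\<close> gives smallness of the images of the whole
      square.\<close>
    have sub: "G k ` topspace (prod_topology ?I ?I) \<subseteq> S k" if "k \<in> K" for k
      using continuous_map_image_subset_topspace[OF Gc[OF that]] by auto
    show "null_family X x K (\<lambda>k. G k ` topspace (prod_topology ?I ?I))"
      unfolding null_family_def
    proof (intro allI impI)
      fix U assume "openin X U \<and> x \<in> U"
      then have "finite {k \<in> K. \<not> S k \<subseteq> U}"
        using null by (simp add: null_family_def)
      then show "finite {k \<in> K. \<not> G k ` topspace (prod_topology ?I ?I) \<subseteq> U}"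
        by (rule rev_finite_subset) (use sub in blast)
    qed
    fix z assume "z \<in> topspace (prod_topology ?I ?I)"
    then obtain s t where z: "z = (s, t)" and s: "s \<in> {0..1}"
      by auto
    show "(\<exists>k\<in>K. H z = G k z \<and> (\<forall>j\<in>K. j \<noteq> k \<longrightarrow> G j z = x)) \<or> (H z = x \<and> (\<forall>j\<in>K. G j z = x))"
    proof (cases "\<exists>k\<in>K. lo s k < t \<and> t < hi s k")
      case True
      then show ?thesis
        unfolding z using Hin[OF _ s] by blast
    next
      case False
      then have "\<And>k. k \<in> K \<Longrightarrow> t \<le> lo s k \<or> hi s k \<le> t"
        by (meson not_le)
      then show ?thesis
        unfolding z using Hout Gx s by blast
    qed
  qed
  moreover have "H (0, t) = F t" if t: "t \<in> {0..1}" for t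
  proof (cases "\<exists>k\<in>K. c k < t \<and> t < d k")
    case True
    then obtain k where k: "k \<in> K" "c k < t" "t < d k"
      by blast
    moreover have "cl ((t - c k) / (d k - c k)) = (t - c k) / (d k - c k)"
      "(t - c k) / (d k - c k) \<in> {0..1}"
      using k by (auto simp: cl_def field_simps)
    ultimately show ?thesis
      using Hin[of k 0 t] D(5)[OF k] h0[OF k(1)] by (simp add: lo_def hi_def G_def)
  next
    case False
    then have *: "\<And>k. k \<in> K \<Longrightarrow> t \<le> c k \<or> d k \<le> t"
      by (meson not_le)
    then have "F t = x"
      using D(6) t by simp
    then show ?thesis
      using Hout[of t 0] * by (simp add: lo_def hi_def)
  qed
  moreover have "H (1, t) = F' t" if t: "t \<in> {0..1}" for t
  proof (cases "\<exists>k\<in>K. c' k < t \<and> t < d' k")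
    case True
    then obtain k where k: "k \<in> K" "c' k < t" "t < d' k"
      by blast
    moreover have "cl ((t - c' k) / (d' k - c' k)) = (t - c' k) / (d' k - c' k)"
      "(t - c' k) / (d' k - c' k) \<in> {0..1}"
      using k by (auto simp: cl_def field_simps)
    ultimately show ?thesis
      using Hin[of k 1 t] D'(5)[OF k] h1[OF k(1)] by (simp add: lo_def hi_def G_def)
  next
    case False
    then have *: "\<And>k. k \<in> K \<Longrightarrow> t \<le> c' k \<or> d' k \<le> t"
      by (meson not_le)
    then have "F' t = x"
      using D'(6) t by simp
    then show ?thesis
      using Hout[of t 1] * by (simp add: lo_def hi_def)
  qed
  moreover have "H (s, 0) = F 0 \<and> H (s, 1) = F 1" if s: "s \<in> {0..1}" for s
  proof -
    have "0 \<le> lo s k \<and> hi s k \<le> 1" if k: "k \<in> K" for k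
    proof
      show "0 \<le> lo s k"
        using D(1)[OF k] D'(1)[OF k] s by (simp add: lo_def)
      have "(1 - s) * d k \<le> (1 - s) * 1" "s * d' k \<le> s * 1"
        using D(3)[OF k] D'(3)[OF k] s by (auto intro!: mult_left_mono simp del: mult_1_right)
      then show "hi s k \<le> 1"
        by (simp add: hi_def)
    qed
    then show ?thesis
      using tiles_as_endpoints[OF F] Hout by simp
  qed
  ultimately show ?thesis
    unfolding loop_homotopic_iff by blast
qed

section \<open>Calculus of loop homotopies\<close>

lemma loop_homotopic_refl: "loop X x p \<Longrightarrow> loop_homotopic X p p"
  by (simp add: loop_homotopic_def loop_def pathin_def)

lemma loop_homotopic_ends:
  assumes "loop_homotopic X p q"
  shows "q 0 = p 0" "q 1 = p 1"
  using homotopic_with_imp_property assms unfolding loop_homotopic_def by blast+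

lemma loop_homotopic_sym: "loop_homotopic X p q \<Longrightarrow> loop_homotopic X q p"
  using loop_homotopic_ends[of X p q] unfolding loop_homotopic_def
  by (simp add: homotopic_with_sym)

lemma loop_homotopic_trans:
  "loop_homotopic X p q \<Longrightarrow> loop_homotopic X q r \<Longrightarrow> loop_homotopic X p r"
  using loop_homotopic_ends[of X p q] unfolding loop_homotopic_def
  by (auto intro: homotopic_with_trans)

lemma loop_homotopic_loop:
  assumes "loop_homotopic X p q" "p 0 = x" "p 1 = x"
  shows "loop X x p" "loop X x q"
  using homotopic_with_imp_continuous_maps[of _ _ X p q] loop_homotopic_ends[OF assms(1)] assms
  unfolding loop_homotopic_def loop_def pathin_def by auto

lemma loop_homotopic_compose:
  assumes "loop_homotopic X p q" "continuous_map X Y f"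
  shows "loop_homotopic Y (f \<circ> p) (f \<circ> q)"
  using assms unfolding loop_homotopic_def
  by (rule homotopic_with_compose_continuous_map_left) auto

lemma loop_homotopic_mono:
  assumes "loop_homotopic (subtopology X S) p q" "S \<subseteq> T"
  shows "loop_homotopic (subtopology X T) p q"
proof -
  have "continuous_map (subtopology X S) (subtopology X T) id"
    using assms(2) by (auto simp: continuous_map_in_subtopology continuous_map_from_subtopology)
  from loop_homotopic_compose[OF assms(1) this] show ?thesis
    by simp
qed

lemma loop_homotopic_subtopology:
  "loop_homotopic (subtopology X S) p q \<Longrightarrow> loop_homotopic X p q"
  using loop_homotopic_mono[of X S p q UNIV] by simp

lemma loop_homotopic_cong:
  assumes "\<And>t. t \<in> {0..1} \<Longrightarrow> p t = p' t" "\<And>t. t \<in> {0..1} \<Longrightarrow> q t = q' t"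
  shows "loop_homotopic X p q \<longleftrightarrow> loop_homotopic X p' q'"
  unfolding loop_homotopic_iff using assms by simp

lemma loop_compose:
  "loop X x p \<Longrightarrow> continuous_map X Y f \<Longrightarrow> loop Y (f x) (f \<circ> p)"
  by (auto simp: loop_def pathin_def intro: continuous_map_compose)

lemma loop_subtopology_image: "loop X x p \<Longrightarrow> loop (subtopology X (p ` {0..1})) x p"
  by (auto simp: loop_def pathin_def continuous_map_in_subtopology)

lemma loop_subtopologyD:
  assumes "loop (subtopology X S) x p"
  shows "loop X x p" "p ` {0..1} \<subseteq> S"
  using assms by (auto simp: loop_def pathin_def continuous_map_in_subtopology)

section \<open>Operations on tilings and the standard tilings\<close>

lemma tiles_as_reindex:
  assumes "tiles_as x K c d g F" "bij_betw \<phi> L K"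
  shows "tiles_as x L (c \<circ> \<phi>) (d \<circ> \<phi>) (g \<circ> \<phi>) F"
proof -
  note D = tiles_asD[OF assms(1)]
  have L: "\<phi> l \<in> K" if "l \<in> L" for l
    using assms(2) that by (auto simp: bij_betw_def)
  show ?thesis
  proof (rule tiles_asI, goal_cases)
    case (4 j k)
    then show ?case
      using D(4)[of "\<phi> j" "\<phi> k"] L assms(2) by (auto simp: bij_betw_def inj_on_def)
  next
    case (6 t)
    show ?case
    proof (rule D(6)[OF 6(1,2)])
      fix k assume "k \<in> K"
      then obtain l where "l \<in> L" "k = \<phi> l"
        using assms(2) by (auto simp: bij_betw_def)
      then show "t \<le> c k \<or> d k \<le> t"
        using 6(3)[of l] by simp
    qed
  qed (use D L in auto)
qed

text \<open>Constant tiles merge with the background. This removes the trivial gaps of a transfinite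
  product and, in a single coordinate of the torus, the tiles of all other circles.\<close>

lemma tiles_as_restrict:
  assumes "tiles_as x K c d g F" "L \<subseteq> K"
    and const: "\<And>k t. k \<in> K - L \<Longrightarrow> 0 < t \<Longrightarrow> t < 1 \<Longrightarrow> g k t = x"
  shows "tiles_as x L c d g F"
proof -
  note D = tiles_asD[OF assms(1)]
  show ?thesis
  proof (rule tiles_asI, goal_cases)
    case (6 t)
    show ?case
    proof (cases "\<exists>k\<in>K. c k < t \<and> t < d k")
      case True
      then obtain k where k: "k \<in> K" "c k < t" "t < d k"
        by blast
      then have "k \<notin> L"
        using 6(3)[of k] by auto
      then show ?thesis
        using D(5)[OF k] const[of k] k by (simp add: field_simps)
    next
      case False
      then show ?thesis
        using 6 D(6)[of t] by (meson not_le)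
    qed
  next
    case (4 j k)
    then show ?case
      using D(4)[of j k] assms(2) by blast
  qed (use D(1-3,5) assms(2) in auto)
qed

lemma tiles_as_compose:
  assumes "tiles_as x K c d g F"
  shows "tiles_as (f x) K c d (\<lambda>k. f \<circ> g k) (f \<circ> F)"
  using assms unfolding tiles_as_def by auto

lemma tiles_as_cong:
  assumes "tiles_as x K c d g F" "\<And>k t. k \<in> K \<Longrightarrow> 0 < t \<Longrightarrow> t < 1 \<Longrightarrow> g k t = g' k t"
  shows "tiles_as x K c d g' F"
proof -
  note D = tiles_asD[OF assms(1)]
  show ?thesis
  proof (rule tiles_asI, goal_cases)
    case (5 k t)
    then show ?case
      using D(5)[OF 5] assms(2)[OF 5(1), of "(t - c k) / (d k - c k)"] by simp
  qed (use D in auto)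
qed

lemma tiles_as_whole:
  assumes "p 0 = x" "p 1 = x"
  shows "tiles_as x {k} (\<lambda>_. 0) (\<lambda>_. 1) (\<lambda>_. p) p"
  by (rule tiles_asI) (use assms in \<open>force+\<close>)

lemma tiles_as_path_concat:
  assumes "p 0 = x" "p 1 = x" "q 1 = x"
  shows "tiles_as x UNIV (\<lambda>b. if b then 1/2 else 0) (\<lambda>b. if b then 1 else 1/2)
           (\<lambda>b. if b then q else p) (path_concat p q)"
proof (rule tiles_asI, goal_cases)
  case (5 k t)
  show ?case
  proof (cases k)
    case True
    then have "(t - 1/2) / (1 - 1/2) = 2 * t - 1" "\<not> t \<le> 1/2"
      using 5 by (simp_all add: field_simps)
    then show ?thesis
      using True by (simp only: path_concat_def if_True if_False)
  next
    case False
    then have "(t - 0) / (1/2 - 0) = 2 * t" "t \<le> 1/2"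
      using 5 by simp_all
    then show ?thesis
      using False by (simp only: path_concat_def if_True if_False)
  qed
next
  case (6 t)
  then have "t = 0 \<or> t = 1/2 \<or> t = 1"
    using 6(3)[of True] 6(3)[of False] by auto
  then show ?case
  proof (elim disjE)
    assume "t = 1/2"
    then have "2 * t = 1" "t \<le> 1/2"
      by simp_all
    then show ?thesis
      using assms by (simp only: path_concat_def if_True)
  qed (use assms in \<open>simp_all add: path_concat_def\<close>)
qed auto

lemma inf_interval_disjoint:
  assumes "m \<noteq> n"
  shows "real (m+1) / real (m+2) \<le> real n / real (n+1) \<or> real (n+1) / real (n+2) \<le> real m / real (m+1)"
proof -
  have *: "real (m+1) / real (m+2) \<le> real n / real (n+1)" if "m < n" for m n
  proof -
    have "real m + 1 \<le> real n"
      using that by simp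
    then show ?thesis
      by (simp add: field_simps)
  qed
  then show ?thesis
    using assms by (meson linorder_neqE_nat)
qed

lemma inf_interval_less: "real m / real (m+1) < real n / real (n+1) \<longleftrightarrow> m < n"
  by (simp add: field_simps)

lemma tiles_as_inf_prod:
  "tiles_as x UNIV (\<lambda>n. real n / real (n+1)) (\<lambda>n. real (n+1) / real (n+2)) \<alpha> (inf_prod x \<alpha>)"
proof (rule tiles_asI, goal_cases)
  case (5 n t)
  then have n: "t \<in> inf_interval n"
    by (simp add: inf_interval_def)
  moreover have "(THE n. t \<in> inf_interval n) = n"
  proof (rule the_equality[where P="\<lambda>n. t \<in> inf_interval n", OF n])
    fix m assume "t \<in> inf_interval m"
    then show "m = n"
      using n inf_interval_disjoint[of m n] unfolding inf_interval_def greaterThanLessThan_iff by linarith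
  qed
  ultimately show ?case
    unfolding inf_prod_def Let_def by auto
next
  case (6 t)
  then have "\<not> (\<exists>n. t \<in> inf_interval n)"
    unfolding inf_interval_def using 6(3) by (meson UNIV_I greaterThanLessThan_iff not_le)
  then show ?case
    by (simp add: inf_prod_def)
qed (use inf_interval_disjoint in \<open>auto simp: field_simps\<close>)

text \<open>Forgets the positions of the tiles and hence their order; what remains is the collection
  of pieces, and this is what two rearrangements of each other share.\<close>

definition has_tiles :: "'a \<Rightarrow> 'k set \<Rightarrow> ('k \<Rightarrow> real \<Rightarrow> 'a) \<Rightarrow> (real \<Rightarrow> 'a) \<Rightarrow> bool" where
  "has_tiles x K g F \<longleftrightarrow> (\<exists>c d. tiles_as x K c d g F)"

lemma has_tilesI: "tiles_as x K c d g F \<Longrightarrow> has_tiles x K g F"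
  by (auto simp: has_tiles_def)

lemma has_tiles_endpoints:
  assumes "has_tiles x K g F"
  shows "F 0 = x" "F 1 = x"
proof -
  obtain c d where "tiles_as x K c d g F"
    using assms by (auto simp: has_tiles_def)
  from tiles_as_endpoints[OF this] show "F 0 = x" "F 1 = x" .
qed

text \<open>Tilings of the single tiles are transplanted by the affine maps of the outer intervals;
  \<open>\<pi> k\<close> names the outer tile containing \<open>k\<close>. The bound on left
  endpoints later keeps the tiles from accumulating before 1.\<close>

lemma tiles_as_nested:
  fixes \<pi> :: "'k \<Rightarrow> 'n"
  assumes F: "tiles_as x N c d g F"
    and \<pi>: "\<And>k. k \<in> K \<Longrightarrow> \<pi> k \<in> N"
    and G: "\<And>n. n \<in> N \<Longrightarrow> has_tiles x {k \<in> K. \<pi> k = n} g' (g n)"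
  shows "\<exists>c' d'. tiles_as x K c' d' g' F \<and> (\<forall>k\<in>K. c (\<pi> k) \<le> c' k)"
proof -
  have "\<exists>c' d'. \<forall>n\<in>N. tiles_as x {k \<in> K. \<pi> k = n} (c' n) (d' n) g' (g n)"
    using G unfolding has_tiles_def by metis
  then obtain c0 d0 where
    G0: "\<And>n. n \<in> N \<Longrightarrow> tiles_as x {k \<in> K. \<pi> k = n} (c0 n) (d0 n) g' (g n)"
    by blast
  define c' where "c' k = c0 (\<pi> k) k" for k
  define d' where "d' k = d0 (\<pi> k) k" for k
  note D = tiles_asD[OF F]
  have D': "0 \<le> c' k" "c' k < d' k" "d' k \<le> 1" if "k \<in> K" for k
    using tiles_asD(1-3)[OF G0[OF \<pi>[OF that]], of k] that by (auto simp: c'_def d'_def)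
  have disj': "d' j \<le> c' k \<or> d' k \<le> c' j" if "j \<in> K" "k \<in> K" "\<pi> j = \<pi> k" "j \<noteq> k" for j k
    using tiles_asD(4)[OF G0[OF \<pi>[OF that(1)]], of j k] that by (auto simp: c'_def d'_def)
  have val': "g (\<pi> k) u = g' k ((u - c' k) / (d' k - c' k))"
    if "k \<in> K" "c' k < u" "u < d' k" for k u
    using tiles_asD(5)[OF G0[OF \<pi>[OF that(1)]], of k u] that by (auto simp: c'_def d'_def)
  have out': "g n u = x"
    if "n \<in> N" "0 \<le> u" "u \<le> 1" "\<And>k. k \<in> K \<Longrightarrow> \<pi> k = n \<Longrightarrow> u \<le> c' k \<or> d' k \<le> u" for n u
    using tiles_asD(6)[OF G0[OF that(1)] that(2,3)] that(4) by (auto simp: c'_def d'_def)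
  define w where "w n = d n - c n" for n
  have w: "0 < w n" if "n \<in> N" for n
    using D(2)[OF that] by (simp add: w_def)
  define cc where "cc k = c (\<pi> k) + c' k * w (\<pi> k)" for k
  define dd where "dd k = c (\<pi> k) + d' k * w (\<pi> k)" for k
  have cc: "c (\<pi> k) \<le> cc k" if "k \<in> K" for k
    using D'(1)[OF that] w[OF \<pi>[OF that]] by (simp add: cc_def)
  have dd: "dd k \<le> d (\<pi> k)" if "k \<in> K" for k
  proof -
    have "d' k * w (\<pi> k) \<le> 1 * w (\<pi> k)"
      using D'(3)[OF that] w[OF \<pi>[OF that]] by (intro mult_right_mono) auto
    then show ?thesis
      by (simp add: dd_def w_def)
  qed
  have cd: "cc k < dd k" if "k \<in> K" for k
    using D'(2)[OF that] w[OF \<pi>[OF that]] by (simp add: cc_def dd_def)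
  have "tiles_as x K cc dd g' F"
  proof (rule tiles_asI, goal_cases)
    case (1 k)
    then show ?case
      using cc[OF 1] D(1)[OF \<pi>[OF 1]] by linarith
  next
    case (2 k)
    then show ?case
      by (rule cd)
  next
    case (3 k)
    then show ?case
      using dd[OF 3] D(3)[OF \<pi>[OF 3]] by linarith
  next
    case (4 j k)
    show ?case
    proof (cases "\<pi> j = \<pi> k")
      case True
      then show ?thesis
        using disj'[OF 4(1,2) True 4(3)] w[OF \<pi>[OF 4(1)]]
        by (auto simp: cc_def dd_def)
    next
      case False
      then show ?thesis
        using D(4)[OF \<pi>[OF 4(1)] \<pi>[OF 4(2)] False] cc[OF 4(1)] cc[OF 4(2)] dd[OF 4(1)] dd[OF 4(2)]
        by linarith
    qed
  next
    case (5 k t)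
    define u where "u = (t - c (\<pi> k)) / w (\<pi> k)"
    have wk: "0 < w (\<pi> k)"
      using w[OF \<pi>[OF 5(1)]] .
    have t: "t = c (\<pi> k) + u * w (\<pi> k)"
      using wk by (simp add: u_def)
    have u: "c' k < u" "u < d' k"
      using 5(2,3) wk by (simp_all add: t cc_def dd_def)
    have "F t = g (\<pi> k) u"
      using D(5)[OF \<pi>[OF 5(1)], of t] cc[OF 5(1)] dd[OF 5(1)] 5(2,3) by (simp add: u_def w_def)
    also have "\<dots> = g' k ((u - c' k) / (d' k - c' k))"
      using val'[OF 5(1) u] .
    also have "(u - c' k) / (d' k - c' k) = (t - cc k) / (dd k - cc k)"
    proof -
      have "t - cc k = (u - c' k) * w (\<pi> k)" "dd k - cc k = (d' k - c' k) * w (\<pi> k)"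
        by (simp_all add: t cc_def dd_def algebra_simps)
      then show ?thesis
        using wk by simp
    qed
    finally show ?case .
  next
    case (6 t)
    show ?case
    proof (cases "\<exists>n\<in>N. c n < t \<and> t < d n")
      case True
      then obtain n where n: "n \<in> N" "c n < t" "t < d n"
        by blast
      define u where "u = (t - c n) / w n"
      have t: "t = c n + u * w n"
        using w[OF n(1)] by (simp add: u_def)
      have u: "0 \<le> u" "u \<le> 1"
        using n by (simp_all add: u_def w_def)
      have "g n u = x"
      proof (rule out'[OF n(1) u])
        fix k assume k: "k \<in> K" "\<pi> k = n"
        show "u \<le> c' k \<or> d' k \<le> u"
          using 6(3)[OF k(1)] w[OF n(1)] k(2) by (simp add: cc_def dd_def t)
      qed
      then show ?thesis
        using D(5)[OF n] by (simp add: u_def w_def)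
    next
      case False
      then show ?thesis
        using 6(1,2) D(6)[of t] by (meson not_le)
    qed
  qed
  then show ?thesis
    using cc by blast
qed

lemma has_tiles_nested:
  assumes "has_tiles x N g F" "\<And>k. k \<in> K \<Longrightarrow> \<pi> k \<in> N"
    and "\<And>n. n \<in> N \<Longrightarrow> has_tiles x {k \<in> K. \<pi> k = n} g' (g n)"
  shows "has_tiles x K g' F"
proof -
  obtain c d where "tiles_as x N c d g F"
    using assms(1) by (auto simp: has_tiles_def)
  from tiles_as_nested[OF this assms(2,3)] show ?thesis
    unfolding has_tiles_def by blast
qed

lemma has_tiles_path_concat:
  assumes p: "has_tiles x K g p" and q: "has_tiles x L g q" and "K \<inter> L = {}"
  shows "has_tiles x (K \<union> L) g (path_concat p q)"
proof -
  have "has_tiles x UNIV (\<lambda>b. if b then q else p) (path_concat p q)"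
    by (rule has_tilesI[OF tiles_as_path_concat])
      (use has_tiles_endpoints[OF p] has_tiles_endpoints[OF q] in simp_all)
  then show ?thesis
  proof (rule has_tiles_nested[where \<pi>="\<lambda>k. k \<in> L"])
    show "has_tiles x {k \<in> K \<union> L. (k \<in> L) = b} g (if b then q else p)" for b
    proof (cases b)
      case True
      then have "{k \<in> K \<union> L. (k \<in> L) = b} = L"
        by auto
      then show ?thesis
        using True q by simp
    next
      case False
      then have "{k \<in> K \<union> L. (k \<in> L) = b} = K"
        using assms(3) by auto
      then show ?thesis
        using False p by simp
    qed
  qed auto
qed

lemma has_tiles_reindex:
  assumes "has_tiles x K g F" "bij_betw \<phi> L K" "\<And>l. l \<in> L \<Longrightarrow> g' l = g (\<phi> l)"
  shows "has_tiles x L g' F"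
proof -
  obtain c d where "tiles_as x K c d g F"
    using assms(1) by (auto simp: has_tiles_def)
  show ?thesis
    by (rule has_tilesI[OF tiles_as_cong[OF tiles_as_reindex[OF \<open>tiles_as x K c d g F\<close> assms(2)]]])
      (use assms(3) in simp)
qed

lemma has_tiles_compose:
  "has_tiles x K g F \<Longrightarrow> has_tiles (f x) K (\<lambda>k. f \<circ> g k) (f \<circ> F)"
  unfolding has_tiles_def by (elim exE) (intro exI, rule tiles_as_compose)

lemma has_tiles_whole: "g k 0 = x \<Longrightarrow> g k 1 = x \<Longrightarrow> has_tiles x {k} g (g k)"
  by (rule has_tilesI[OF tiles_as_cong[OF tiles_as_whole]]) auto

section \<open>Rearranging tilings of order type omega\<close>

text \<open>The finiteness condition says that tiles accumulate at most at 1, so an infinite family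
  is ordered like the natural numbers.\<close>

definition omega_tiled :: "'a \<Rightarrow> 'k set \<Rightarrow> ('k \<Rightarrow> real \<Rightarrow> 'a) \<Rightarrow> (real \<Rightarrow> 'a) \<Rightarrow> bool" where
  "omega_tiled x K g F \<longleftrightarrow> (\<exists>c d. tiles_as x K c d g F \<and> (\<forall>s<1. finite {k \<in> K. c k < s}))"

text \<open>A tile inside factor \<open>n\<close> starts at \<open>n / (n+1)\<close> or later, so
  tiles starting before \<open>s\<close> belong to factors with \<open>n + 1 < 1 / (1 - s)\<close>,
  and each factor has finitely many.\<close>

lemma omega_tiled_inf_prod:
  assumes "\<And>n. finite {k \<in> K. \<pi> k = n}"
    and "\<And>n. has_tiles x {k \<in> K. \<pi> k = n} g' (g n)"
  shows "omega_tiled x K g' (inf_prod x g)"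
proof -
  obtain c d where cd: "tiles_as x K c d g' (inf_prod x g)"
    and c: "\<And>k. k \<in> K \<Longrightarrow> real (\<pi> k) / real (\<pi> k + 1) \<le> c k"
    using tiles_as_nested[OF tiles_as_inf_prod, of K \<pi> x g' g] assms(2) by auto
  have "finite {k \<in> K. c k < s}" if "s < 1" for s
  proof -
    obtain M where M: "1 / (1 - s) < real M"
      using reals_Archimedean2 by blast
    have "{k \<in> K. c k < s} \<subseteq> (\<Union>n<M. {k \<in> K. \<pi> k = n})"
    proof
      fix k assume "k \<in> {k \<in> K. c k < s}"
      then have k: "k \<in> K" "real (\<pi> k) / real (\<pi> k + 1) < s"
        using c[of k] by auto
      have "(real (\<pi> k) + 1) * (1 - s) < 1"
        using k(2) by (simp add: field_simps)
      then have "real (\<pi> k) + 1 < 1 / (1 - s)"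
        using that by (simp add: field_simps)
      then show "k \<in> (\<Union>n<M. {k \<in> K. \<pi> k = n})"
        using M k(1) by auto
    qed
    then show ?thesis
      by (rule finite_subset) (use assms(1) in auto)
  qed
  then show ?thesis
    using cd unfolding omega_tiled_def by blast
qed

text \<open>Counting the smaller keys is a bijection onto the natural numbers, since ranks are
  distinct and leave no gap; its inverse enumerates \<open>K\<close> in the order of the
  keys.\<close>

lemma enumerate_by_key:
  fixes c :: "'k \<Rightarrow> real"
  assumes inf: "infinite K" and inj: "inj_on c K" and fin: "\<And>k. k \<in> K \<Longrightarrow> finite {j \<in> K. c j < c k}"
  shows "\<exists>e. bij_betw e (UNIV :: nat set) K \<and> (\<forall>m n. c (e m) < c (e n) \<longrightarrow> m < n)"
proof -
  define rank where "rank k = card {j \<in> K. c j < c k}" for k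
  have mono: "rank j < rank k" if "j \<in> K" "k \<in> K" "c j < c k" for j k
    unfolding rank_def by (rule psubset_card_mono[OF fin[OF that(2)]]) (use that in auto)
  have iff: "rank j < rank k \<longleftrightarrow> c j < c k" if "j \<in> K" "k \<in> K" for j k
    using mono[OF that] mono[OF that(2,1)] inj_onD[OF inj _ that]
    by (metis linorder_neqE_linordered_idom not_less_iff_gr_or_eq)
  have injr: "inj_on rank K"
    by (metis iff inj inj_on_def less_irrefl linorder_neqE_linordered_idom)
  have "n \<in> rank ` K" for n
  proof -
    have "infinite (rank ` K)"
      using inf injr by (simp add: finite_image_iff)
    then obtain m where "m \<in> rank ` K" "n \<le> m"
      by (meson infinite_nat_iff_unbounded_le)
    then have ex: "\<exists>k. k \<in> K \<and> n \<le> rank k"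
      by auto
    obtain k where k: "k \<in> K" "n \<le> rank k" and min: "\<And>j. j \<in> K \<Longrightarrow> n \<le> rank j \<Longrightarrow> rank k \<le> rank j"
      using ex_has_least_nat[of "\<lambda>k. k \<in> K \<and> n \<le> rank k" _ rank] ex by blast
    \<comment> \<open>By minimality every predecessor of \<open>k\<close> has rank below
      \<open>n\<close>. Ranks being distinct, there are at most \<open>n\<close> predecessors, which
      forces \<open>rank k = n\<close>.\<close>
    have "rank ` {j \<in> K. c j < c k} \<subseteq> {..<n}"
      using min iff k(1) by force
    then have "card (rank ` {j \<in> K. c j < c k}) \<le> n"
      by (metis card_lessThan card_mono finite_lessThan)
    moreover have "card (rank ` {j \<in> K. c j < c k}) = rank k"
      unfolding rank_def by (intro card_image inj_on_subset[OF injr[unfolded rank_def]]) auto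
    ultimately show ?thesis
      using k by (metis imageI le_antisym)
  qed
  then have b: "bij_betw rank K UNIV"
    using injr by (auto simp: bij_betw_def)
  define e where "e = inv_into K rank"
  have "bij_betw e UNIV K"
    unfolding e_def by (rule bij_betw_inv_into[OF b])
  moreover have "m < n" if "c (e m) < c (e n)" for m n
  proof -
    have "e m \<in> K" "e n \<in> K"
      using calculation by (auto simp: bij_betw_def)
    moreover have "rank (e m) = m" "rank (e n) = n"
      unfolding e_def using b by (simp_all add: bij_betw_def f_inv_into_f)
    ultimately show ?thesis
      using iff that by metis
  qed
  ultimately show ?thesis
    by blast
qed

lemma tiles_as_inj_left:
  assumes "tiles_as x K c d g F" shows "inj_on c K"
proof (rule inj_onI)
  fix j k assume "j \<in> K" "k \<in> K" "c j = c k"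
  then show "j = k"
    using tiles_asD(2)[OF assms, of j] tiles_asD(2)[OF assms, of k] tiles_asD(4)[OF assms, of j k]
    by linarith
qed

text \<open>Listing the tiles by their left endpoints preserves the order, so
  \<open>tile_homotopy\<close> can slide them onto the standard intervals of an infinite
  product.\<close>

lemma omega_tiled_imp_inf_prod:
  assumes x: "x \<in> topspace X" and "infinite K" and F: "omega_tiled x K g F"
    and loops: "\<And>k. k \<in> K \<Longrightarrow> loop (subtopology X (S k)) x (g k)"
    and null: "null_family X x K S"
  shows "\<exists>e. bij_betw e (UNIV :: nat set) K \<and> loop_homotopic X F (inf_prod x (g \<circ> e))"
proof -
  obtain c d where t: "tiles_as x K c d g F" and fin: "\<And>s. s < 1 \<Longrightarrow> finite {k \<in> K. c k < s}"
    using F by (auto simp: omega_tiled_def)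
  have "c k < 1" if "k \<in> K" for k
    using tiles_asD(2,3)[OF t that] by linarith
  then obtain e where e: "bij_betw e (UNIV :: nat set) K" and mono: "\<And>m n. c (e m) < c (e n) \<Longrightarrow> m < n"
    using enumerate_by_key[OF assms(2) tiles_as_inj_left[OF t]] fin by blast
  have ek: "e n \<in> K" for n
    using e by (auto simp: bij_betw_def)
  have "loop_homotopic X F (inf_prod x (g \<circ> e))"
  proof (rule tile_homotopy[OF x tiles_as_reindex[OF t e] tiles_as_inf_prod])
    show "loop_homotopic (subtopology X ((S \<circ> e) n)) ((g \<circ> e) n) ((g \<circ> e) n)" for n
      using loop_homotopic_refl[OF loops[OF ek]] by simp
    show "(g \<circ> e) n 0 = x" "(g \<circ> e) n 1 = x" for n
      using loops[OF ek] by (auto simp: loop_def)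
    show "null_family X x UNIV (S \<circ> e)"
      using null_family_reindex[OF null] e by (auto simp: bij_betw_def)
    show "real m / real (m + 1) < real n / real (n + 1)" if "(c \<circ> e) m < (c \<circ> e) n" for m n
      using mono[of m n] that inf_interval_less by simp
  qed
  then show ?thesis
    using e by blast
qed

lemma null_sequence_iff:
  "null_sequence X x \<alpha> \<longleftrightarrow> (\<forall>n. loop X x (\<alpha> n)) \<and> null_family X x UNIV (\<lambda>n. \<alpha> n ` {0..1})"
  by (auto simp: null_sequence_def null_family_def cofinite_eq_sequentially[symmetric] eventually_cofinite)

lemma null_family_mono:
  assumes "null_family X x K S" "\<And>k. k \<in> K \<Longrightarrow> S' k \<subseteq> S k"
  shows "null_family X x K S'"
  unfolding null_family_def
proof (intro allI impI)
  fix U assume "openin X U \<and> x \<in> U"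
  then have "finite {k \<in> K. \<not> S k \<subseteq> U}"
    using assms(1) by (simp add: null_family_def)
  then show "finite {k \<in> K. \<not> S' k \<subseteq> U}"
    by (rule rev_finite_subset) (use assms(2) in blast)
qed

text \<open>Both loops are, up to homotopy, infinite products of the same pieces in two
  enumerations. Infinite commutativity is applied here once and for all: pieces may be permuted and
  regrouped as long as the order type remains omega.\<close>

theorem omega_tiled_rearrange:
  assumes comm: "infinitely_pi1_commutative X x" and x: "x \<in> topspace X" and K: "infinite K"
    and F: "omega_tiled x K g F" and F': "omega_tiled x K g F'"
    and loops: "\<And>k. k \<in> K \<Longrightarrow> loop (subtopology X (S k)) x (g k)"
    and null: "null_family X x K S"
  shows "loop_homotopic X F F'"
proof -
  obtain e where e: "bij_betw e (UNIV :: nat set) K" and Fe: "loop_homotopic X F (inf_prod x (g \<circ> e))"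
    using omega_tiled_imp_inf_prod[OF x K F loops null] by blast
  obtain e' where e': "bij_betw e' (UNIV :: nat set) K" and Fe': "loop_homotopic X F' (inf_prod x (g \<circ> e'))"
    using omega_tiled_imp_inf_prod[OF x K F' loops null] by blast
  have ek: "e n \<in> K" for n
    using e by (auto simp: bij_betw_def)
  have "null_family X x UNIV (\<lambda>n. (g \<circ> e) n ` {0..1})"
  proof (rule null_family_mono)
    show "null_family X x UNIV (S \<circ> e)"
      using null_family_reindex[OF null] e by (auto simp: bij_betw_def)
    show "(g \<circ> e) n ` {0..1} \<subseteq> (S \<circ> e) n" for n
      using loop_subtopologyD(2)[OF loops[OF ek]] by simp
  qed
  then have "null_sequence X x (g \<circ> e)"
    using loop_subtopologyD(1)[OF loops[OF ek]] by (simp add: null_sequence_iff)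
  \<comment> \<open>The two enumerations of the pieces differ by this permutation.\<close>
  moreover have "bij (inv_into UNIV e \<circ> e')"
    using bij_betw_trans[OF e' bij_betw_inv_into[OF e]] .
  ultimately have "loop_homotopic X (inf_prod x (g \<circ> e)) (inf_prod x (g \<circ> e \<circ> (inv_into UNIV e \<circ> e')))"
    using comm unfolding infinitely_pi1_commutative_def by blast
  moreover have "g \<circ> e \<circ> (inv_into UNIV e \<circ> e') = g \<circ> e'"
  proof
    fix n
    have "e' n \<in> range e"
      using e e' by (auto simp: bij_betw_def)
    then show "(g \<circ> e \<circ> (inv_into UNIV e \<circ> e')) n = (g \<circ> e') n"
      by (simp add: f_inv_into_f)
  qed
  ultimately show ?thesis
    using Fe loop_homotopic_sym[OF Fe'] by (metis loop_homotopic_trans)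
qed

section \<open>The gaps of the Cantor set\<close>

definition gap_left :: "nat \<Rightarrow> nat \<Rightarrow> real" where
  "gap_left m j = cantor_left m j + 1 / 3 ^ (m+1)"

definition gap_right :: "nat \<Rightarrow> nat \<Rightarrow> real" where
  "gap_right m j = cantor_left m j + 2 / 3 ^ (m+1)"

text \<open>Self-similarity of the Cantor set: the leading binary digit of \<open>j\<close> selects
  the left or right third, and the remaining digits give the position in that copy, scaled by
  1/3.\<close>

lemma cantor_left_Suc:
  assumes "j < 2 ^ Suc m"
  shows "cantor_left (Suc m) j = (2 * real (j div 2 ^ m) + cantor_left m (j mod 2 ^ m)) / 3"
proof -
  have "j div 2 ^ m < 2"
    using assms by (simp add: less_mult_imp_div_less)
  moreover have "(j div 2 ^ (m - Suc i)) mod 2 = ((j mod 2 ^ m) div 2 ^ (m - Suc i)) mod 2"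
    if "i < m" for i
  proof -
    \<comment> \<open>Reduction modulo \<open>2 ^ m\<close> keeps the lower \<open>m\<close> binary
      digits, and digit \<open>m - Suc i\<close> is one of them.\<close>
    have "bit (take_bit m j) (m - Suc i) \<longleftrightarrow> bit j (m - Suc i)"
      using that by (simp add: bit_take_bit_iff)
    then show ?thesis
      by (simp add: bit_iff_odd take_bit_eq_mod mod_2_eq_odd)
  qed
  ultimately show ?thesis
    unfolding cantor_left_def sum.lessThan_Suc_shift
    by (simp add: sum_divide_distrib add_divide_distrib mult_ac)
qed

lemma gap_Suc:
  assumes "j < 2 ^ Suc m"
  shows "gap_left (Suc m) j = (2 * real (j div 2 ^ m) + gap_left m (j mod 2 ^ m)) / 3"
    and "gap_right (Suc m) j = (2 * real (j div 2 ^ m) + gap_right m (j mod 2 ^ m)) / 3"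
  by (simp_all add: gap_left_def gap_right_def cantor_left_Suc[OF assms] field_simps)

lemma gap_0: "gap_left 0 j = 1/3" "gap_right 0 j = 2/3"
  by (simp_all add: gap_left_def gap_right_def cantor_left_def)

lemma gap_less: "gap_left m j < gap_right m j"
  by (simp add: gap_left_def gap_right_def divide_strict_right_mono)

lemma gap_width: "gap_right m j - gap_left m j = 1 / 3 ^ (m+1)"
  by (simp add: gap_left_def gap_right_def field_simps)

lemma gap_bounds:
  assumes "j < 2 ^ m"
  shows "0 \<le> gap_left m j \<and> gap_right m j \<le> 1"
  using assms
proof (induction m arbitrary: j)
  case (Suc m)
  have "j div 2 ^ m < 2"
    using Suc.prems by (simp add: less_mult_imp_div_less)
  then have "real (j div 2 ^ m) \<le> 1"
    by linarith
  moreover have "0 \<le> gap_left m (j mod 2 ^ m) \<and> gap_right m (j mod 2 ^ m) \<le> 1"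
    by (rule Suc.IH) simp
  ultimately show ?case
    unfolding gap_Suc[OF Suc.prems] by simp
qed (simp add: gap_0)

text \<open>Induction along the self-similarity. The central gap separates the outer thirds, gaps in
  different thirds are separated by \<open>gap_bounds\<close>, and two gaps in the same third are
  scaled copies of gaps one level earlier.\<close>

lemma gap_disjoint:
  assumes "j < 2 ^ m" "j' < 2 ^ m'" "(m, j) \<noteq> (m', j')"
  shows "gap_right m j \<le> gap_left m' j' \<or> gap_right m' j' \<le> gap_left m j"
  using assms
proof (induction m arbitrary: j m' j')
  case 0
  then obtain n where n: "m' = Suc n"
    by (cases m') auto
  have "j' div 2 ^ n < 2"
    using 0 by (simp add: n less_mult_imp_div_less)
  then have "j' div 2 ^ n = 0 \<or> j' div 2 ^ n = 1"
    by linarith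
  moreover have "0 \<le> gap_left n (j' mod 2 ^ n) \<and> gap_right n (j' mod 2 ^ n) \<le> 1"
    by (rule gap_bounds) simp
  ultimately show ?case
    using 0 by (auto simp: n gap_0 gap_Suc)
next
  case (Suc m)
  have b: "j div 2 ^ m = 0 \<or> j div 2 ^ m = 1"
    using Suc.prems(1) less_mult_imp_div_less[of j 2 "2 ^ m"] by (simp add: less_2_cases_iff)
  have bd: "0 \<le> gap_left m (j mod 2 ^ m) \<and> gap_right m (j mod 2 ^ m) \<le> 1"
    by (rule gap_bounds) simp
  show ?case
  proof (cases m')
    case 0
    then show ?thesis
      using b bd by (auto simp: gap_0 gap_Suc[OF Suc.prems(1)])
  next
    case m': (Suc n)
    note j' = Suc.prems(2)[unfolded m']
    have b': "j' div 2 ^ n = 0 \<or> j' div 2 ^ n = 1"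
      using j' less_mult_imp_div_less[of j' 2 "2 ^ n"] by (simp add: less_2_cases_iff)
    have bd': "0 \<le> gap_left n (j' mod 2 ^ n) \<and> gap_right n (j' mod 2 ^ n) \<le> 1"
      by (rule gap_bounds) simp
    show ?thesis
    proof (cases "j div 2 ^ m = j' div 2 ^ n")
      case True
      have "(m, j mod 2 ^ m) \<noteq> (n, j' mod 2 ^ n)"
      proof
        assume "(m, j mod 2 ^ m) = (n, j' mod 2 ^ n)"
        then have "m = n" "j mod 2 ^ m = j' mod 2 ^ n"
          by (metis prod.inject)+
        moreover from this have "j = j'"
          using True div_mult_mod_eq[of j "2 ^ m"] div_mult_mod_eq[of j' "2 ^ n"] by metis
        ultimately have "m = n" "j = j'"
          by simp_all
        then show False
          using Suc.prems(3) m' by simp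
      qed
      then have "gap_right m (j mod 2 ^ m) \<le> gap_left n (j' mod 2 ^ n) \<or>
          gap_right n (j' mod 2 ^ n) \<le> gap_left m (j mod 2 ^ m)"
        by (intro Suc.IH) auto
      then show ?thesis
        unfolding m' gap_Suc[OF Suc.prems(1)] gap_Suc[OF j'] True by auto
    next
      case False
      then show ?thesis
        unfolding m' gap_Suc[OF Suc.prems(1)] gap_Suc[OF j'] using b b' bd bd' by auto
    qed
  qed
qed

lemma tiles_as_tau_prod:
  "tiles_as x {(m, j). j < 2 ^ m} (\<lambda>(m, j). gap_left m j) (\<lambda>(m, j). gap_right m j)
     (\<lambda>(m, j). \<alpha> (2 ^ m + j - 1)) (tau_prod x \<alpha>)"
proof (rule tiles_asI, goal_cases)
  case (1 k)
  then show ?case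
    using gap_bounds by (auto split: prod.splits)
next
  case (2 k)
  then show ?case
    using gap_less by (auto split: prod.splits)
next
  case (3 k)
  then show ?case
    using gap_bounds by (auto split: prod.splits)
next
  case (4 k l)
  obtain m j m' j' where kl: "k = (m, j)" "l = (m', j')"
    by (metis surj_pair)
  then show ?case
    using gap_disjoint[of j m j' m'] 4 by simp
next
  case (5 k t)
  obtain m j where k: "k = (m, j)"
    by (metis surj_pair)
  have mj: "j < 2 ^ m" "gap_left m j < t" "t < gap_right m j"
    using 5 k by auto
  then have t: "t \<in> cantor_gap m j"
    by (simp add: cantor_gap_def gap_left_def gap_right_def)
  have "(THE (m, j). j < 2 ^ m \<and> t \<in> cantor_gap m j) = (m, j)"
  proof (rule the_equality)
    show "case (m, j) of (m, j) \<Rightarrow> j < 2 ^ m \<and> t \<in> cantor_gap m j"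
      using mj t by simp
    fix l assume l: "case l of (m, j) \<Rightarrow> j < 2 ^ m \<and> t \<in> cantor_gap m j"
    obtain m' j' where l': "l = (m', j')"
      by (metis surj_pair)
    show "l = (m, j)"
    proof (rule ccontr)
      assume "l \<noteq> (m, j)"
      then have "gap_right m' j' \<le> gap_left m j \<or> gap_right m j \<le> gap_left m' j'"
        using gap_disjoint[of j' m' j m] l l' mj by simp
      then show False
        using l l' mj by (simp add: cantor_gap_def gap_left_def gap_right_def)
    qed
  qed
  then have "tau_prod x \<alpha> t = \<alpha> (2 ^ m + j - 1) ((t - gap_left m j) * 3 ^ (m+1))"
    using mj t by (auto simp: tau_prod_def gap_left_def)
  then show ?case
    using gap_width[of m j] by (simp add: k)
next
  case (6 t)
  have "\<not> (\<exists>m j. j < 2 ^ m \<and> t \<in> cantor_gap m j)"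
  proof (intro notI, elim exE)
    fix m j assume "j < 2 ^ m \<and> t \<in> cantor_gap m j"
    then show False
      using 6(3)[of "(m, j)"] by (simp add: cantor_gap_def gap_left_def gap_right_def)
  qed
  then show ?case
    unfolding tau_prod_def by (rule if_not_P)
qed

text \<open>\<open>2 ^ m\<close> is the leading binary digit of \<open>2 ^ m + j\<close>, so the sum
  determines both numbers. Hence different gaps carry different members of a sequence.\<close>

lemma level_position_unique:
  fixes j j' :: nat
  assumes "j < 2 ^ m" "j' < 2 ^ m'" "2 ^ m + j = 2 ^ m' + j'"
  shows "m = m'" "j = j'"
proof -
  have *: False if "m < m'" "j < 2 ^ m" "2 ^ m + j = 2 ^ m' + j'" for m j m' j' :: nat
  proof -
    have "(2::nat) ^ Suc m \<le> 2 ^ m'"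
      using that(1) by (intro power_increasing) auto
    then show False
      using that(2,3) by simp
  qed
  show "m = m'"
    using *[of m m' j j'] *[of m' m j' j] assms by (metis linorder_neqE_nat)
  then show "j = j'"
    using assms(3) by simp
qed

lemma gap_left_rightmost: "gap_left m (2 ^ m - 1) = 1 - 2 / 3 ^ (m+1)"
proof (induction m)
  case (Suc m)
  \<comment> \<open>All binary digits of the rightmost position are 1; removing the leading one
    leaves the rightmost position of the level below.\<close>
  have split: "(2 ^ Suc m - 1 :: nat) = (2 ^ m - 1) + 1 * 2 ^ m"
    by simp
  have "(2 ^ Suc m - 1) div 2 ^ m = (1::nat)" "(2 ^ Suc m - 1) mod 2 ^ m = (2 ^ m - 1 :: nat)"
    unfolding split by (subst div_mult_self1 mod_mult_self1; simp del: One_nat_def)+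
  moreover have "gap_left (Suc m) (2 ^ Suc m - 1) =
      (2 * real ((2 ^ Suc m - 1) div 2 ^ m) + gap_left m ((2 ^ Suc m - 1) mod 2 ^ m)) / 3"
    by (rule gap_Suc) simp
  ultimately have "gap_left (Suc m) (2 ^ Suc m - 1) = (2 + (1 - 2 / 3 ^ (m+1))) / 3"
    using Suc by simp
  then show ?case
    by (simp add: field_simps)
qed (simp add: gap_0)

text \<open>Only the rightmost gaps of the levels carry nontrivial loops, and they are ordered like the
  natural numbers.\<close>

lemma tau_prod_rightmost:
  assumes x: "x \<in> topspace X" and null: "null_sequence X x \<beta>"
    and const: "\<And>m j t. j < 2 ^ m - 1 \<Longrightarrow> 0 < t \<Longrightarrow> t < 1 \<Longrightarrow> \<beta> (2 ^ m + j - 1) t = x"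
  shows "loop_homotopic X (tau_prod x \<beta>) (inf_prod x (\<lambda>m. \<beta> (2 ^ Suc m - 2)))"
proof -
  let ?L = "(\<lambda>m::nat. (m, 2 ^ m - 1 :: nat)) ` UNIV"
  have "tiles_as x ?L (\<lambda>(m, j). gap_left m j) (\<lambda>(m, j). gap_right m j)
     (\<lambda>(m, j). \<beta> (2 ^ m + j - 1)) (tau_prod x \<beta>)"
  proof (rule tiles_as_restrict[OF tiles_as_tau_prod])
    fix k t assume k: "k \<in> {(m, j). j < 2 ^ m} - ?L" and t: "0 < (t::real)" "t < 1"
    obtain m j where mj: "k = (m, j)"
      by (metis surj_pair)
    then have "j < 2 ^ m" "j \<noteq> 2 ^ m - 1"
      using k by auto
    then have "j < 2 ^ m - 1"
      by linarith
    then show "(case k of (m, j) \<Rightarrow> \<beta> (2 ^ m + j - 1)) t = x"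
      using const t mj by simp
  qed auto
  from tiles_as_reindex[OF this, of "\<lambda>m. (m, 2 ^ m - 1)" UNIV]
  have t: "tiles_as x UNIV (\<lambda>m. gap_left m (2 ^ m - 1)) (\<lambda>m. gap_right m (2 ^ m - 1))
      (\<lambda>m. \<beta> (2 ^ m + (2 ^ m - 1) - 1)) (tau_prod x \<beta>)"
    unfolding o_def prod.case by (simp only: bij_betw_def inj_on_def) auto
  \<comment> \<open>The loop on the rightmost gap of level \<open>m\<close> has index
    \<open>2 ^ m + j - 1\<close> with \<open>j = 2 ^ m - 1\<close>.\<close>
  have idx: "2 ^ m + (2 ^ m - 1) - 1 = (2 ^ Suc m - 2 :: nat)" for m
    by simp
  have inj: "inj (\<lambda>m. 2 ^ Suc m - 2 :: nat)"
  proof (rule injI)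
    fix m n assume eq: "(2 ^ Suc m - 2 :: nat) = 2 ^ Suc n - 2"
    have "(2::nat) \<le> 2 ^ Suc m" "(2::nat) \<le> 2 ^ Suc n"
      using one_le_power[of "2::nat" m] one_le_power[of "2::nat" n] by simp_all
    then have "(2::nat) ^ Suc m = 2 ^ Suc n"
      using eq by linarith
    then show "m = n"
      by simp
  qed
  have nf: "null_family X x UNIV ((\<lambda>n. \<beta> n ` {0..1}) \<circ> (\<lambda>m. 2 ^ Suc m - 2))"
    by (rule null_family_reindex[OF _ inj]) (use null in \<open>auto simp: null_sequence_iff\<close>)
  have lp: "loop X x (\<beta> n)" for n
    using null by (simp add: null_sequence_iff)
  show ?thesis
  proof (rule tile_homotopy[OF x t[unfolded idx] tiles_as_inf_prod _ _ _ _ nf])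
    fix m n :: nat
    assume "gap_left m (2 ^ m - 1) < gap_left n (2 ^ n - 1)"
    \<comment> \<open>The left endpoints \<open>1 - 2 / 3 ^ (m+1)\<close> increase with the level,
      which gives the order hypothesis.\<close>
    then have "(3::real) ^ (m+1) < 3 ^ (n+1)"
      unfolding gap_left_rightmost by (simp add: field_simps)
    then show "real m / real (m + 1) < real n / real (n + 1)"
      by (simp only: inf_interval_less) simp
  next
    fix n
    show "\<beta> (2 ^ Suc n - 2) 0 = x" "\<beta> (2 ^ Suc n - 2) 1 = x"
      using lp by (auto simp: loop_def)
    show "loop_homotopic (subtopology X (((\<lambda>n. \<beta> n ` {0..1}) \<circ> (\<lambda>m. 2 ^ Suc m - 2)) n))
        (\<beta> (2 ^ Suc n - 2)) (\<beta> (2 ^ Suc n - 2))"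
      using loop_homotopic_refl[OF loop_subtopology_image[OF lp]] by simp
  qed
qed

text \<open>The sequence is placed on the rightmost gaps and constant loops on all others, which
  turns both infinite products into transfinite ones. The permutation is transported to the indices
  of the rightmost gaps and fixes the rest.\<close>

theorem transfinitely_imp_infinitely:
  assumes x: "x \<in> topspace X" and comm: "transfinitely_pi1_commutative X x"
  shows "infinitely_pi1_commutative X x"
  unfolding infinitely_pi1_commutative_def
proof (intro allI impI)
  fix \<alpha> and \<phi> :: "nat \<Rightarrow> nat"
  assume "null_sequence X x \<alpha> \<and> bij \<phi>"
  then have \<alpha>: "null_sequence X x \<alpha>" and \<phi>: "bij \<phi>"
    by auto
  define idx where "idx m = 2 ^ m + (2 ^ m - 1) - (1::nat)" for m
  have idx': "idx m = 2 ^ Suc m - 2" for m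
    by (simp add: idx_def)
  have pos: "(1::nat) \<le> 2 ^ m" for m
    by simp
  have nidx: "2 ^ m + j - 1 \<noteq> idx n" if "j < 2 ^ m - 1" for m j n
  proof
    assume eq: "2 ^ m + j - 1 = idx n"
    have "2 ^ m + j = 2 ^ n + (2 ^ n - 1)"
      using eq pos[of m] pos[of n] unfolding idx_def by linarith
    then have "m = n" "j = 2 ^ n - 1"
      using level_position_unique[of j m "2 ^ n - 1" n] that by auto
    then show False
      using that by simp
  qed
  have inj: "inj idx"
  proof (rule injI)
    fix m n assume eq: "idx m = idx n"
    have "2 ^ m + (2 ^ m - 1) = 2 ^ n + (2 ^ n - (1::nat))"
      using eq pos[of m] pos[of n] unfolding idx_def by linarith
    then show "m = n"
      using level_position_unique(1)[of "2 ^ m - 1" m "2 ^ n - 1" n] by simp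
  qed
  define \<alpha>' where "\<alpha>' n = (if n \<in> range idx then \<alpha> (inv_into UNIV idx n) else (\<lambda>t. x))" for n
  have \<alpha>'idx: "\<alpha>' (idx m) = \<alpha> m" for m
    using inj by (simp add: \<alpha>'_def)
  have cl: "loop X x (\<lambda>t. x)"
    using x by (simp add: loop_def pathin_def)
  have \<alpha>': "null_sequence X x \<alpha>'"
    unfolding null_sequence_iff
  proof
    show "\<forall>n. loop X x (\<alpha>' n)"
      using \<alpha> cl by (auto simp: \<alpha>'_def null_sequence_iff)
    show "null_family X x UNIV (\<lambda>n. \<alpha>' n ` {0..1})"
      unfolding null_family_def
    proof (intro allI impI)
      fix U assume U: "openin X U \<and> x \<in> U"
      have "{n \<in> UNIV. \<not> \<alpha>' n ` {0..1} \<subseteq> U} \<subseteq> idx ` {n \<in> UNIV. \<not> \<alpha> n ` {0..1} \<subseteq> U}"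
      proof
        fix n assume n: "n \<in> {n \<in> UNIV. \<not> \<alpha>' n ` {0..1} \<subseteq> U}"
        then have "n \<in> range idx"
          using U by (auto simp: \<alpha>'_def split: if_splits)
        then obtain m where "n = idx m"
          by blast
        then show "n \<in> idx ` {n \<in> UNIV. \<not> \<alpha> n ` {0..1} \<subseteq> U}"
          using n \<alpha>'idx by auto
      qed
      moreover have "finite {n \<in> UNIV. \<not> \<alpha> n ` {0..1} \<subseteq> U}"
        by (rule null_familyD) (use \<alpha> U in \<open>auto simp: null_sequence_iff\<close>)
      ultimately show "finite {n \<in> UNIV. \<not> \<alpha>' n ` {0..1} \<subseteq> U}"
        by (meson finite_imageI finite_subset)
    qed
  qed
  define ext where "ext \<psi> n = (if n \<in> range idx then idx (\<psi> (inv_into UNIV idx n)) else n)" for \<psi> :: "nat \<Rightarrow> nat" and n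
  have ext_idx: "ext \<psi> (idx m) = idx (\<psi> m)" for \<psi> m
    using inj by (simp add: ext_def)
  have ext_out: "ext \<psi> n = n" if "n \<notin> range idx" for \<psi> n
    using that by (simp add: ext_def)
  \<comment> \<open>Extension is compatible with composition to the identity, so extending the
    inverse of \<open>\<phi>\<close> yields the inverse of \<open>ext \<phi>\<close>.\<close>
  have ext_comp: "ext \<psi> \<circ> ext \<psi>' = id" if "\<psi> \<circ> \<psi>' = id" for \<psi> \<psi>'
  proof
    fix n
    have "\<psi> (\<psi>' m) = m" for m
      using that by (metis comp_apply id_apply)
    then show "(ext \<psi> \<circ> ext \<psi>') n = id n"
      by (cases "n \<in> range idx") (auto simp: ext_idx ext_out)
  qed
  have "bij (ext \<phi>)"
    by (rule o_bij[of "ext (inv_into UNIV \<phi>)"]) (use \<phi> in \<open>auto intro!: ext_comp simp: bij_is_inj bij_is_surj surj_iff[symmetric]\<close>)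
  then have main: "loop_homotopic X (tau_prod x \<alpha>') (tau_prod x (\<alpha>' \<circ> ext \<phi>))"
    using comm \<alpha>' unfolding transfinitely_pi1_commutative_def by blast
  have null2: "null_sequence X x (\<alpha>' \<circ> ext \<phi>)"
    unfolding null_sequence_iff
  proof
    show "\<forall>n. loop X x ((\<alpha>' \<circ> ext \<phi>) n)"
      using \<alpha>' by (simp add: null_sequence_iff)
    have "null_family X x UNIV ((\<lambda>n. \<alpha>' n ` {0..1}) \<circ> ext \<phi>)"
      by (rule null_family_reindex[of _ _ UNIV]) (use \<alpha>' \<open>bij (ext \<phi>)\<close> in \<open>auto simp: null_sequence_iff bij_def\<close>)
    then show "null_family X x UNIV (\<lambda>n. (\<alpha>' \<circ> ext \<phi>) n ` {0..1})"
      by (simp add: o_def)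
  qed
  have out: "2 ^ m + j - 1 \<notin> range idx" if "j < 2 ^ m - 1" for m j
    using nidx[OF that] by blast
  have 1: "loop_homotopic X (tau_prod x \<alpha>') (inf_prod x \<alpha>)"
  proof -
    have "\<alpha>' (2 ^ m + j - 1) t = x" if "j < 2 ^ m - 1" for m j t
      using out[OF that] by (simp add: \<alpha>'_def)
    moreover have "(\<lambda>m. \<alpha>' (2 ^ Suc m - 2)) = \<alpha>"
      unfolding idx'[symmetric] \<alpha>'idx ..
    ultimately show ?thesis
      using tau_prod_rightmost[OF x \<alpha>'] by metis
  qed
  have 2: "loop_homotopic X (tau_prod x (\<alpha>' \<circ> ext \<phi>)) (inf_prod x (\<alpha> \<circ> \<phi>))"
  proof -
    have "(\<alpha>' \<circ> ext \<phi>) (2 ^ m + j - 1) t = x" if "j < 2 ^ m - 1" for m j t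
      using out[OF that] by (simp add: ext_out \<alpha>'_def)
    moreover have "(\<lambda>m. (\<alpha>' \<circ> ext \<phi>) (2 ^ Suc m - 2)) = \<alpha> \<circ> \<phi>"
      unfolding idx'[symmetric] by (simp add: ext_idx \<alpha>'idx o_def)
    ultimately show ?thesis
      using tau_prod_rightmost[OF x null2] by metis
  qed
  show "loop_homotopic X (inf_prod x \<alpha>) (inf_prod x (\<alpha> \<circ> \<phi>))"
    using loop_homotopic_trans[OF loop_homotopic_sym[OF 1] loop_homotopic_trans[OF main 2]] .
qed

section \<open>Fundamental groups\<close>

lemma loop_basepoint: "loop X x p \<Longrightarrow> x \<in> topspace X"
  by (auto simp: loop_def pathin_def continuous_map_def Pi_iff)

lemma loop_class_eq_iff:
  assumes "loop X x p"
  shows "loop_class X p = loop_class X q \<longleftrightarrow> loop_homotopic X p q"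
proof
  assume "loop_class X p = loop_class X q"
  then have "p \<in> loop_class X q"
    using loop_homotopic_refl[OF assms] by (auto simp: loop_class_def)
  then show "loop_homotopic X p q"
    by (simp add: loop_class_def loop_homotopic_sym)
next
  assume pq: "loop_homotopic X p q"
  show "loop_class X p = loop_class X q"
    unfolding loop_class_def
    using loop_homotopic_trans[OF pq] loop_homotopic_trans[OF loop_homotopic_sym[OF pq]]
    by (intro Collect_cong iffI)
qed

lemma some_loop_class:
  assumes "loop X x p"
  shows "loop_homotopic X p (SOME q. q \<in> loop_class X p)"
proof -
  have "(SOME q. q \<in> loop_class X p) \<in> loop_class X p"
    by (rule someI[of _ p]) (simp add: loop_class_def loop_homotopic_refl[OF assms])
  then show ?thesis
    by (simp add: loop_class_def)
qed

lemma induced_loop_class: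
  assumes "loop X x p" "continuous_map X Y f"
  shows "induced Y f (loop_class X p) = loop_class Y (f \<circ> p)"
  unfolding induced_def
  using loop_class_eq_iff[OF loop_compose[OF assms]]
    loop_homotopic_compose[OF some_loop_class[OF assms(1)] assms(2)] by metis

lemma path_concat_homotopic:
  assumes p: "loop X x p" and q: "loop X x q"
    and "loop_homotopic X p p'" "loop_homotopic X q q'"
  shows "loop_homotopic X (path_concat p q) (path_concat p' q')"
proof -
  have e: "p 0 = x" "p 1 = x" "q 0 = x" "q 1 = x"
    using p q by (auto simp: loop_def)
  then have e': "p' 0 = x" "p' 1 = x" "q' 0 = x" "q' 1 = x"
    using loop_homotopic_ends assms(3,4) by metis+
  show ?thesis
    by (rule tile_homotopy[OF loop_basepoint[OF p] tiles_as_path_concat[of p x q, OF e(1,2,4)]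
          tiles_as_path_concat[of p' x q', OF e'(1,2,4)], where S="\<lambda>_. UNIV"])
      (use assms(3,4) e in \<open>auto intro: null_family_finite\<close>)
qed

lemma loop_path_concat:
  assumes p: "loop X x p" and q: "loop X x q"
  shows "loop X x (path_concat p q)"
  by (rule loop_homotopic_loop(1)[OF path_concat_homotopic[OF p q loop_homotopic_refl[OF p]
          loop_homotopic_refl[OF q]]])
    (use p q in \<open>auto simp: loop_def path_concat_def\<close>)

lemma fundamental_group_mult:
  assumes p: "loop X x p" and q: "loop X x q"
  shows "loop_class X p \<otimes>\<^bsub>fundamental_group X x\<^esub> loop_class X q = loop_class X (path_concat p q)"
proof -
  have "loop_homotopic X (path_concat p q)
      (path_concat (SOME p'. p' \<in> loop_class X p) (SOME q'. q' \<in> loop_class X q))"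
    by (rule path_concat_homotopic[OF p q some_loop_class[OF p] some_loop_class[OF q]])
  then have "loop_class X (path_concat p q) = loop_class X
      (path_concat (SOME p'. p' \<in> loop_class X p) (SOME q'. q' \<in> loop_class X q))"
    by (simp only: loop_class_eq_iff[OF loop_path_concat[OF p q]])
  then show ?thesis
    by (simp add: fundamental_group_def)
qed

lemma carrier_fundamental_group: "carrier (fundamental_group X x) = loop_class X ` {p. loop X x p}"
  by (simp add: fundamental_group_def)

lemma compose_path_concat: "f \<circ> path_concat p q = path_concat (f \<circ> p) (f \<circ> q)"
  by (auto simp: path_concat_def)

text \<open>Continuity is read off from \<open>tile_homotopy\<close>, applied to the tiling and
  itself with the stationary homotopies on the tiles.\<close>

lemma tiles_as_loop:
  assumes x: "x \<in> topspace X" and t: "tiles_as x K c d g F"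
    and loops: "\<And>k. k \<in> K \<Longrightarrow> loop (subtopology X (S k)) x (g k)"
    and null: "null_family X x K S"
  shows "loop X x F"
proof -
  have "loop_homotopic X F F"
    by (rule tile_homotopy[OF x t t _ _ _ _ null])
      (use loops in \<open>auto intro: loop_homotopic_refl simp: loop_def\<close>)
  then show ?thesis
    using loop_homotopic_loop tiles_as_endpoints[OF t] by metis
qed

lemma tiles_as_unique:
  assumes F: "tiles_as x K c d g F" and F': "tiles_as x K c d g' F'"
    and eq: "\<And>k t. k \<in> K \<Longrightarrow> 0 < t \<Longrightarrow> t < 1 \<Longrightarrow> g k t = g' k t" and t: "t \<in> {0..1}"
  shows "F t = F' t"
proof (cases "\<exists>k\<in>K. c k < t \<and> t < d k")
  case True
  then obtain k where k: "k \<in> K" "c k < t" "t < d k"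
    by blast
  have "0 < (t - c k) / (d k - c k)" "(t - c k) / (d k - c k) < 1"
    using k by auto
  then show ?thesis
    using tiles_asD(5)[OF F k] tiles_asD(5)[OF F' k] eq[OF k(1)] by simp
next
  case False
  then have *: "t \<le> c k \<or> d k \<le> t" if "k \<in> K" for k
    using that by (meson not_le)
  have "F t = x" "F' t = x"
    by (rule tiles_asD(6)[OF F] tiles_asD(6)[OF F']; use t * in simp)+
  then show ?thesis
    by simp
qed

text \<open>\<open>tile_homotopy\<close> stretches the lone tile over the whole interval.\<close>

lemma tiles_as_single:
  assumes t: "tiles_as x {k} c d g F" and p: "loop X x (g k)"
  shows "loop_homotopic X F (g k)"
proof (rule tile_homotopy[OF loop_basepoint[OF p] t tiles_as_whole, where S="\<lambda>_. UNIV"])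
  show "loop_homotopic (subtopology X UNIV) (g j) (g k)" if "j \<in> {k}" for j
    using that loop_homotopic_refl[OF p] by simp
qed (use p in \<open>auto simp: loop_def null_family_finite\<close>)

section \<open>The Hawaiian earring\<close>

text \<open>Circles are indexed from 0, like the factors of the torus.\<close>

definition hsub :: "nat set \<Rightarrow> complex set" where
  "hsub M = insert 0 (\<Union>n\<in>M. hcircle (Suc n))"

definition collapse :: "nat set \<Rightarrow> complex \<Rightarrow> complex" where
  "collapse M z = (if z \<in> hsub M then z else 0)"

text \<open>Inverse of the similarity from circle \<open>n\<close> to the unit circle that is used
  in \<open>eta\<close>; it sends 1 to the wedge point.\<close>

definition circle_in :: "nat \<Rightarrow> complex \<Rightarrow> complex" where
  "circle_in n w = (1 - w) / of_nat (Suc n)"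

text \<open>Square the equation of the circle and clear denominators. In this form a nonzero point
  determines its circle, as \<open>Suc n\<close> equals
  \<open>2 * Re z / (cmod z)\<^sup>2\<close>.\<close>

lemma hcircle_iff: "z \<in> hcircle (Suc n) \<longleftrightarrow> real (Suc n) * (cmod z)\<^sup>2 = 2 * Re z"
proof -
  define r where "r = 1 / real (Suc n)"
  have r: "r > 0" "real (Suc n) * r = 1"
    by (simp_all add: r_def)
  have "z \<in> hcircle (Suc n) \<longleftrightarrow> cmod (of_real r - z) = r"
    by (simp add: hcircle_def r_def dist_norm)
  also have "\<dots> \<longleftrightarrow> (cmod (of_real r - z))\<^sup>2 = r\<^sup>2"
    using r(1) by (simp add: power2_eq_iff_nonneg)
  also have "\<dots> \<longleftrightarrow> (cmod z)\<^sup>2 = 2 * r * Re z"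
    unfolding cmod_power2 by (simp add: power2_eq_square algebra_simps)
  also have "\<dots> \<longleftrightarrow> real (Suc n) * (cmod z)\<^sup>2 = real (Suc n) * (2 * r * Re z)"
    by (metis mult_cancel_left of_nat_eq_0_iff nat.distinct(1))
  also have "real (Suc n) * (2 * r * Re z) = 2 * Re z"
    using r(2) by (metis mult.assoc mult.commute mult_1)
  finally show ?thesis .
qed

lemma hcircle_zero [simp]: "0 \<in> hcircle (Suc n)"
  by (simp add: hcircle_iff)

lemma hcircle_unique:
  assumes "z \<in> hcircle (Suc m)" "z \<in> hcircle (Suc n)" "z \<noteq> 0"
  shows "m = n"
proof -
  have "real (Suc m) * (cmod z)\<^sup>2 = real (Suc n) * (cmod z)\<^sup>2"
    using assms(1,2) by (simp only: hcircle_iff)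
  then show ?thesis
    using assms(3) by simp
qed

lemma hawaiian_eq: "hawaiian = hsub UNIV"
proof -
  have "n \<in> range Suc" if "n \<in> {1..}" for n
    using that by (cases n) auto
  then have "{1..} = range Suc"
    by auto
  then show ?thesis
    by (auto simp: hawaiian_def hsub_def)
qed

lemma zero_in_hsub [simp]: "0 \<in> hsub M"
  by (simp add: hsub_def)

lemma hsub_mono: "M \<subseteq> N \<Longrightarrow> hsub M \<subseteq> hsub N"
  by (auto simp: hsub_def)

lemma hsub_subset_hawaiian: "hsub M \<subseteq> hawaiian"
  by (simp add: hawaiian_eq hsub_mono)

lemma hsub_Int: "hsub M \<inter> hsub N = hsub (M \<inter> N)"
proof (intro equalityI subsetI)
  fix z assume z: "z \<in> hsub M \<inter> hsub N"
  show "z \<in> hsub (M \<inter> N)"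
  proof (cases "z = 0")
    case False
    then obtain m n where mn: "m \<in> M" "n \<in> N" "z \<in> hcircle (Suc m)" "z \<in> hcircle (Suc n)"
      using z by (auto simp: hsub_def)
    then have "m = n"
      using hcircle_unique[of z m n] False by simp
    then show ?thesis
      using mn by (auto simp: hsub_def)
  qed simp
qed (auto simp: hsub_def)

lemma hsub_Un: "hsub M \<union> hsub N = hsub (M \<union> N)"
  by (auto simp: hsub_def)

lemma hsub_single: "hsub {n} = hcircle (Suc n)"
  by (auto simp: hsub_def)

lemma hsub_empty [simp]: "hsub {} = {0}"
  by (simp add: hsub_def)

lemma collapse_in: "collapse M z \<in> hsub M"
  by (simp add: collapse_def)

lemma norm_hcircle_le:
  assumes "z \<in> hcircle (Suc n)"
  shows "cmod z \<le> 2 / real (Suc n)"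
proof (cases "z = 0")
  case False
  have "real (Suc n) * cmod z * cmod z \<le> 2 * cmod z"
    using assms complex_Re_le_cmod[of z] unfolding hcircle_iff by (simp add: power2_eq_square)
  then have "real (Suc n) * cmod z \<le> 2"
    using False by simp
  then show ?thesis
    by (simp add: field_simps)
qed simp

text \<open>At 0 it suffices that norms do not increase. Elsewhere
  \<open>2 * Re w / (cmod w)\<^sup>2\<close> is continuous and takes integer values on the earring
  that tell the circles apart, so nearby points lie on the same circle and are kept or collapsed
  together.\<close>

lemma continuous_on_collapse: "continuous_on hawaiian (collapse M)"
  unfolding continuous_on_iff
proof (intro ballI allI impI)
  fix z and e :: real assume z: "z \<in> hawaiian" and e: "0 < e"
  show "\<exists>d>0. \<forall>w\<in>hawaiian. dist w z < d \<longrightarrow> dist (collapse M w) (collapse M z) < e"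
  proof (cases "z = 0")
    case True
    have "cmod (collapse M w) \<le> cmod w" for w
      by (simp add: collapse_def)
    then show ?thesis
      using True e by (intro exI[of _ e]) (auto simp: collapse_def intro: le_less_trans)
  next
    case False
    then obtain n where n: "z \<in> hcircle (Suc n)"
      using z by (auto simp: hawaiian_eq hsub_def)
    define N where "N w = 2 * Re w / (cmod w)\<^sup>2" for w
    have Nw: "N w = real (Suc k)" if "w \<in> hcircle (Suc k)" "w \<noteq> 0" for w k
      using that unfolding hcircle_iff N_def by (simp add: field_simps)
    have "isCont N z"
      unfolding N_def using False by (intro continuous_intros) auto
    then obtain d where d: "d > 0" "\<And>w. dist w z < d \<Longrightarrow> dist (N w) (N z) < 1"
      unfolding continuous_at_eps_delta by (metis zero_less_one)
    show ?thesis
    proof (intro exI[of _ "min (min d e) (cmod z)"] conjI ballI impI)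
      show "0 < min (min d e) (cmod z)"
        using d e False by simp
      fix w assume w: "w \<in> hawaiian" "dist w z < min (min d e) (cmod z)"
      then have w0: "w \<noteq> 0"
        by auto
      then obtain k where k: "w \<in> hcircle (Suc k)"
        using w by (auto simp: hawaiian_eq hsub_def)
      have "\<bar>real (Suc k) - real (Suc n)\<bar> < 1"
        using d(2)[of w] w(2) Nw[OF k w0] Nw[OF n False] by (simp add: dist_real_def)
      then have kn: "k = n"
        by linarith
      have "u \<in> hsub M \<longleftrightarrow> n \<in> M" if "u \<in> hcircle (Suc n)" "u \<noteq> 0" for u
        using that hcircle_unique[of u] by (auto simp: hsub_def)
      then have "w \<in> hsub M \<longleftrightarrow> z \<in> hsub M"
        using k n w0 False kn by metis
      then show "dist (collapse M w) (collapse M z) < e"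
        using w(2) e by (simp add: collapse_def)
    qed
  qed
qed

lemma continuous_map_collapse: "continuous_map HE (top_of_set (hsub M)) (collapse M)"
  using continuous_on_collapse collapse_in by (auto simp: HE_def)

section \<open>The embedding into the torus and null families in the earring\<close>

lemma eta_eq: "eta z m = 1 - of_nat (Suc m) * collapse {m} z"
  by (simp add: eta_def collapse_def hsub_single)

lemma norm_eta: "cmod (eta z m) = 1"
proof (cases "z \<in> hcircle (Suc m)")
  case True
  have "eta z m = of_nat (Suc m) * (of_real (1 / real (Suc m)) - z)"
    using True by (simp add: eta_def right_diff_distrib del: of_nat_Suc)
  then have "cmod (eta z m) = real (Suc m) * cmod (of_real (1 / real (Suc m)) - z)"
    by (simp only: norm_mult norm_of_nat)
  moreover have "cmod (of_real (1 / real (Suc m)) - z) = 1 / real (Suc m)"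
    using True unfolding hcircle_def mem_sphere dist_norm .
  ultimately show ?thesis
    by simp
qed (simp add: eta_def)

lemma continuous_map_eta_component:
  "continuous_map HE (top_of_set (sphere 0 1)) (\<lambda>z. eta z m)"
proof -
  have "continuous_on hawaiian (\<lambda>z. eta z m)"
    unfolding eta_eq by (intro continuous_intros continuous_on_collapse)
  then show ?thesis
    using norm_eta by (auto simp: HE_def)
qed

lemma continuous_map_eta: "continuous_map HE torus eta"
  using continuous_map_eta_component by (simp add: torus_def continuous_map_componentwise_UNIV)

lemma circle_in_hcircle:
  assumes "cmod w = 1" shows "circle_in n w \<in> hcircle (Suc n)"
proof -
  have "of_real (1 / real (Suc n)) - circle_in n w = w / of_nat (Suc n)"
    by (simp add: circle_in_def diff_divide_distrib del: of_nat_Suc)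
  then have "cmod (of_real (1 / real (Suc n)) - circle_in n w) = 1 / real (Suc n)"
    using assms by (simp only: norm_divide norm_of_nat)
  then show ?thesis
    unfolding hcircle_def mem_sphere dist_norm .
qed

lemma eta_circle_in:
  assumes "cmod w = 1"
  shows "eta (circle_in n w) m = (if m = n then w else 1)"
proof (cases "m = n")
  case True
  then show ?thesis
    using circle_in_hcircle[OF assms, of n] by (simp add: eta_def circle_in_def del: of_nat_Suc)
next
  case False
  then have "circle_in n w = 0" if "circle_in n w \<in> hcircle (Suc m)"
    using that circle_in_hcircle[OF assms, of n] hcircle_unique by blast
  then show ?thesis
    using False by (auto simp: eta_def)
qed

lemma circle_in_eta:
  assumes "z \<in> hcircle (Suc n)" shows "circle_in n (eta z n) = z"
  using assms by (simp add: circle_in_def eta_def del: of_nat_Suc)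

lemma subtopology_HE: "subtopology HE (hsub M) = top_of_set (hsub M)"
proof -
  have "hawaiian \<inter> hsub M = hsub M"
    using hsub_subset_hawaiian by blast
  then show ?thesis
    by (simp only: HE_def subtopology_subtopology)
qed

lemma continuous_map_circle_in:
  "continuous_map (top_of_set (sphere 0 1)) (subtopology HE (hsub {n})) (circle_in n)"
proof -
  have "continuous_on (sphere 0 1) (circle_in n)"
    unfolding circle_in_def by (intro continuous_intros) (simp del: of_nat_Suc)
  then show ?thesis
    using circle_in_hcircle[of _ n] unfolding subtopology_HE unfolding hsub_single by simp
qed

text \<open>Circle \<open>k\<close> has diameter \<open>2 / Suc k\<close>, so late tails lie in any
  given ball around 0. Whole tails are considered because the pieces produced at stage
  \<open>n\<close> may run through all circles from \<open>n\<close> on.\<close>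

lemma null_family_tails: "null_family HE b0 UNIV (\<lambda>n. hsub {n..})"
  unfolding null_family_def
proof (intro allI impI)
  fix U assume "openin HE U \<and> b0 \<in> U"
  then obtain V where V: "open V" "U = hawaiian \<inter> V" "0 \<in> V"
    by (auto simp: HE_def b0_def openin_open)
  then obtain e where e: "e > 0" "ball 0 e \<subseteq> V"
    by (meson openE)
  obtain M where M: "2 / e < real M"
    using reals_Archimedean2 by blast
  have "hsub {n..} \<subseteq> U" if "M \<le> n" for n
  proof
    fix z assume z: "z \<in> hsub {n..}"
    have "z \<in> V"
    proof (cases "z = 0")
      case False
      then obtain k where k: "n \<le> k" "z \<in> hcircle (Suc k)"
        using z by (auto simp: hsub_def)
      have "2 / e < real (Suc k)"
        using M that k(1) by linarith
      then have "2 / real (Suc k) < e"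
        using e(1) by (simp add: field_simps)
      then show ?thesis
        using norm_hcircle_le[OF k(2)] e(2) by auto
    qed (use V in simp)
    then show "z \<in> U"
      using z V(2) hsub_subset_hawaiian by blast
  qed
  then have "{n \<in> UNIV. \<not> hsub {n..} \<subseteq> U} \<subseteq> {..<M}"
    by (metis (no_types, lifting) lessThan_iff mem_Collect_eq not_le subsetI)
  then show "finite {n \<in> UNIV. \<not> hsub {n..} \<subseteq> U}"
    using finite_subset by blast
qed

lemma null_family_circles: "null_family HE b0 UNIV (\<lambda>n. hsub {n})"
  by (rule null_family_mono[OF null_family_tails]) (simp add: hsub_mono)

lemma b0_in_HE: "b0 \<in> topspace HE"
  by (simp add: HE_def b0_def hawaiian_eq)

text \<open>In a product topology the coordinate homotopies run simultaneously, with no smallness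
  condition tying them together. This is why the order of factors on different circles is lost in
  the torus.\<close>

lemma loop_homotopic_torus:
  assumes "\<And>m. loop_homotopic (top_of_set (sphere 0 1)) (\<lambda>t. p t m) (\<lambda>t. q t m)"
  shows "loop_homotopic torus p q"
proof -
  let ?I = "prod_topology (top_of_set {0..1::real}) (top_of_set {0..1::real})"
  have "\<forall>m. \<exists>h. continuous_map ?I (top_of_set (sphere 0 1)) h \<and>
          (\<forall>t\<in>{0..1}. h (0, t) = p t m) \<and> (\<forall>t\<in>{0..1}. h (1, t) = q t m) \<and>
          (\<forall>s\<in>{0..1}. h (s, 0) = p 0 m \<and> h (s, 1) = p 1 m)"
    using assms unfolding loop_homotopic_iff by simp
  then obtain h where h: "\<And>m. continuous_map ?I (top_of_set (sphere 0 1)) (h m)"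
      "\<And>m. \<forall>t\<in>{0..1}. h m (0, t) = p t m" "\<And>m. \<forall>t\<in>{0..1}. h m (1, t) = q t m"
      "\<And>m. \<forall>s\<in>{0..1}. h m (s, 0) = p 0 m \<and> h m (s, 1) = p 1 m"
    by metis
  have "continuous_map ?I torus (\<lambda>z m. h m z)"
    unfolding torus_def continuous_map_componentwise_UNIV using h(1) by simp
  then show ?thesis
    unfolding loop_homotopic_iff using h(2-) by (intro exI[of _ "\<lambda>z m. h m z"]) auto
qed

lemma loop_homotopic_torus_component:
  assumes "loop_homotopic torus p q"
  shows "loop_homotopic (top_of_set (sphere 0 1)) (\<lambda>t. p t m) (\<lambda>t. q t m)"
proof -
  have "continuous_map torus (top_of_set (sphere 0 1)) (\<lambda>w. w m)"
    unfolding torus_def by (rule continuous_map_product_projection) simp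
  from loop_homotopic_compose[OF assms this] show ?thesis
    by (simp add: o_def)
qed

lemma eta_tiles_homotopic:
  assumes F: "tiles_as b0 K c d g F" and k: "k \<in> K"
    and triv: "\<And>j t. j \<in> K \<Longrightarrow> j \<noteq> k \<Longrightarrow> 0 < t \<Longrightarrow> t < 1 \<Longrightarrow> eta (g j t) m = 1"
    and lp: "loop (top_of_set (sphere 0 1)) 1 (\<lambda>t. eta (g k t) m)"
  shows "loop_homotopic (top_of_set (sphere 0 1)) (\<lambda>t. eta (F t) m) (\<lambda>t. eta (g k t) m)"
proof -
  have b: "eta b0 m = 1"
    by (simp add: eta_def b0_def)
  have "tiles_as (eta b0 m) K c d (\<lambda>k. (\<lambda>z. eta z m) \<circ> g k) ((\<lambda>z. eta z m) \<circ> F)"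
    by (rule tiles_as_compose[OF F])
  then have "tiles_as 1 K c d (\<lambda>k t. eta (g k t) m) (\<lambda>t. eta (F t) m)"
    by (simp only: b o_def)
  then have "tiles_as 1 {k} c d (\<lambda>k t. eta (g k t) m) (\<lambda>t. eta (F t) m)"
    by (rule tiles_as_restrict) (use k triv in auto)
  from tiles_as_single[OF this lp] show ?thesis .
qed

text \<open>The coordinate loops of \<open>q\<close>, drawn on the corresponding circles, form a
  null family, so their infinite product is a loop. In coordinate \<open>m\<close> of its image only
  tile \<open>m\<close> survives.\<close>

theorem eta_surjective:
  assumes q: "loop torus x0 q"
  shows "\<exists>p. loop HE b0 p \<and> loop_homotopic torus (eta \<circ> p) q"
proof -
  have "continuous_map torus (top_of_set (sphere 0 1)) (\<lambda>w. w m)" for m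
    unfolding torus_def by (rule continuous_map_product_projection) simp
  from loop_compose[OF q this]
  have qm: "loop (top_of_set (sphere 0 1)) 1 (\<lambda>t. q t m)" for m
    by (simp add: o_def x0_def)
  then have nq: "cmod (q t m) = 1" if "t \<in> {0..1}" for t m
    using that by (auto simp: loop_def pathin_def image_subset_iff Pi_iff)
  define g where "g n = circle_in n \<circ> (\<lambda>t. q t n)" for n
  have lg: "loop (subtopology HE (hsub {n})) b0 (g n)" for n
    using loop_compose[OF qm[of n] continuous_map_circle_in] by (simp add: g_def circle_in_def b0_def)
  have p: "loop HE b0 (inf_prod b0 g)"
    by (rule tiles_as_loop[OF b0_in_HE tiles_as_inf_prod lg null_family_circles])
  have "loop_homotopic torus (eta \<circ> inf_prod b0 g) q"
  proof (rule loop_homotopic_torus)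
    fix m
    have e: "eta (g n t) m = (if m = n then q t n else 1)" if "t \<in> {0..1}" for n t
      using eta_circle_in[OF nq[OF that]] by (simp add: g_def)
    have "loop_homotopic (top_of_set (sphere 0 1)) (\<lambda>t. eta (g m t) m) (\<lambda>t. q t m)"
      using loop_homotopic_refl[OF qm] by (rule loop_homotopic_cong[THEN iffD1, rotated 2]) (simp_all add: e)
    moreover from this have "loop (top_of_set (sphere 0 1)) 1 (\<lambda>t. eta (g m t) m)"
      by (rule loop_homotopic_loop(1)) (use qm[of m] in \<open>simp_all add: e loop_def\<close>)
    then have "loop_homotopic (top_of_set (sphere 0 1)) (\<lambda>t. eta (inf_prod b0 g t) m) (\<lambda>t. eta (g m t) m)"
      by (intro eta_tiles_homotopic[OF tiles_as_inf_prod]) (auto simp: e)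
    ultimately show "loop_homotopic (top_of_set (sphere 0 1)) (\<lambda>t. (eta \<circ> inf_prod b0 g) t m) (\<lambda>t. q t m)"
      using loop_homotopic_trans unfolding o_def by blast
  qed
  then show ?thesis
    using p by blast
qed

text \<open>The exponential is a continuous surjection from a compact space to a Hausdorff space,
  hence a quotient map, and it identifies only the endpoints, where \<open>\<alpha>\<close> agrees.
  The equality of images transfers smallness of \<open>\<alpha>\<close> to \<open>A\<close>.\<close>

lemma loop_factors_through_circle:
  assumes \<alpha>: "loop X x \<alpha>"
  shows "\<exists>A. continuous_map (top_of_set (sphere 0 1)) X A \<and>
     (\<forall>t\<in>{0..1}. A (cis (2 * pi * t)) = \<alpha> t) \<and> A ` sphere 0 1 = \<alpha> ` {0..1}"
proof -
  let ?e = "\<lambda>t::real. cis (2 * pi * t)"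
  have surj: "?e ` {0..1} = sphere 0 1"
  proof
    show "sphere 0 1 \<subseteq> ?e ` {0..1}"
    proof
      fix w :: complex assume "w \<in> sphere 0 1"
      then have w: "w = cis (Arg2pi w)"
        using Arg2pi_eq[of w] by (simp add: cis_conv_exp)
      show "w \<in> ?e ` {0..1}"
      proof (rule image_eqI)
        show "w = ?e (Arg2pi w / (2 * pi))"
          using w by simp
        show "Arg2pi w / (2 * pi) \<in> {0..1}"
          using Arg2pi_ge_0[of w] Arg2pi_lt_2pi[of w] by simp
      qed
    qed
  qed auto
  have q: "quotient_map (top_of_set {0..1}) (top_of_set (sphere 0 1)) ?e"
  proof (rule T1_Spaces.continuous_imp_quotient_map)
    show "continuous_map (top_of_set {0..1}) (top_of_set (sphere 0 1)) ?e"
      by (auto intro!: continuous_intros)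
    show "compact_space (top_of_set {0..1::real})"
      by (simp add: compact_space_subtopology)
    show "Hausdorff_space (top_of_set (sphere (0::complex) 1))"
      by (simp add: Hausdorff_space_subtopology)
  qed (use surj in simp)
  have c: "continuous_map (top_of_set {0..1}) X \<alpha>"
    using \<alpha> by (simp add: loop_def pathin_def)
  have eq: "\<alpha> s = \<alpha> t"
    if st: "s \<in> topspace (top_of_set {0..1})" "t \<in> topspace (top_of_set {0..1})" "?e s = ?e t" for s t
  proof -
    have "\<exists>n::int. 2 * pi * s = 2 * pi * t + 2 * pi * n"
      using that(3) by (subst sin_cos_eq_iff[symmetric]) (simp add: complex_eq_iff)
    then obtain n :: int where "2 * pi * s = 2 * pi * (t + n)"
      by (auto simp: algebra_simps)
    then have n: "s = t + n"
      by simp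
    then have "\<bar>real_of_int n\<bar> \<le> 1"
      using st(1,2) by auto
    then have "n = 0 \<or> n = 1 \<or> n = -1"
      by linarith
    then have "s = t \<or> (s = 1 \<and> t = 0) \<or> (s = 0 \<and> t = 1)"
      using n st(1,2) by auto
    then show ?thesis
      using \<alpha> by (auto simp: loop_def)
  qed
  obtain A where "continuous_map (top_of_set (sphere 0 1)) X A"
      "A ` topspace (top_of_set (sphere 0 1)) = \<alpha> ` topspace (top_of_set {0..1})"
      "\<And>t. t \<in> topspace (top_of_set {0..1}) \<Longrightarrow> A (?e t) = \<alpha> t"
    by (rule quotient_map_lift_exists[OF q c eq]) blast+
  then show ?thesis
    by (intro exI[of _ A]) simp
qed

lemma circle_loop: "loop (top_of_set (sphere 0 1)) 1 (\<lambda>t. cis (2 * pi * t))"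
  by (auto simp: loop_def pathin_def intro!: continuous_intros)

text \<open>The map \<open>f\<close> associated with a null-sequence. Each circle is mapped through
  the factorization of its loop, and the null condition gives continuity at the wedge point by
  \<open>continuous_map_glue_null_family\<close>.\<close>

lemma null_sequence_map:
  assumes x: "x \<in> topspace X" and \<alpha>: "null_sequence X x \<alpha>"
  shows "\<exists>f. continuous_map HE X f \<and> f b0 = x \<and>
     (\<forall>n. \<forall>t\<in>{0..1}. f (circle_in n (cis (2 * pi * t))) = \<alpha> n t)"
proof -
  have lp: "loop X x (\<alpha> n)" for n
    using \<alpha> by (simp add: null_sequence_iff)
  then obtain A where
      A: "\<And>n. continuous_map (top_of_set (sphere 0 1)) X (A n)"
    and A\<alpha>: "\<And>n t. t \<in> {0..1} \<Longrightarrow> A n (cis (2 * pi * t)) = \<alpha> n t"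
    and im: "\<And>n. A n ` sphere 0 1 = \<alpha> n ` {0..1}"
    using loop_factors_through_circle[OF lp] by metis
  have A1: "A n 1 = x" for n
    using A\<alpha>[of 0 n] lp[of n] by (simp add: loop_def)
  \<comment> \<open>Off circle \<open>n\<close> the coordinate \<open>eta z n\<close> is 1, so
    \<open>G n\<close> is defined on the whole earring and equals \<open>x\<close> away from its
    circle.\<close>
  define G where "G n z = A n (eta z n)" for n z
  define f where "f z = (if \<exists>n. z \<in> hcircle (Suc n) \<and> z \<noteq> 0
      then G (SOME n. z \<in> hcircle (Suc n) \<and> z \<noteq> 0) z else x)" for z
  have f: "f z = G n z" if z: "z \<in> hcircle (Suc n)" "z \<noteq> 0" for z n
  proof -
    have "(SOME n. z \<in> hcircle (Suc n) \<and> z \<noteq> 0) = n"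
    proof (rule some_equality)
      show "z \<in> hcircle (Suc n) \<and> z \<noteq> 0"
        using z by simp
      show "m = n" if "z \<in> hcircle (Suc m) \<and> z \<noteq> 0" for m
        using that z hcircle_unique by blast
    qed
    moreover have "\<exists>n. z \<in> hcircle (Suc n) \<and> z \<noteq> 0"
      using z by blast
    ultimately show ?thesis
      by (simp add: f_def)
  qed
  have f0: "f 0 = x"
    by (simp add: f_def)
  have G1: "G j z = x" if "z \<notin> hcircle (Suc j) \<or> z = 0" for j z
    using that A1 by (auto simp: G_def eta_def)
  have "continuous_map HE X f"
  proof (rule continuous_map_glue_null_family[OF x])
    show "continuous_map HE X (G n)" for n
      using continuous_map_compose[OF continuous_map_eta_component A] by (simp add: G_def[abs_def] o_def)
    show "null_family X x UNIV (\<lambda>n. G n ` topspace HE)"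
    proof (rule null_family_mono)
      show "null_family X x UNIV (\<lambda>n. \<alpha> n ` {0..1})"
        using \<alpha> by (simp add: null_sequence_iff)
      show "G n ` topspace HE \<subseteq> \<alpha> n ` {0..1}" for n
        unfolding im[symmetric] using norm_eta by (auto simp: G_def)
    qed
    fix z assume "z \<in> topspace HE"
    then consider "z = 0" | n where "z \<in> hcircle (Suc n)" "z \<noteq> 0"
      by (auto simp: HE_def hawaiian_eq hsub_def)
    then show "(\<exists>k\<in>UNIV. f z = G k z \<and> (\<forall>j\<in>UNIV. j \<noteq> k \<longrightarrow> G j z = x)) \<or> (f z = x \<and> (\<forall>j\<in>UNIV. G j z = x))"
    proof cases
      case 1
      then show ?thesis
        using f0 G1 by simp
    next
      case (2 n)
      then show ?thesis
        using f[OF 2] G1 hcircle_unique[OF _ 2] by blast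
    qed
  qed
  moreover have "f (circle_in n (cis (2 * pi * t))) = \<alpha> n t" if t: "t \<in> {0..1}" for n t
  proof -
    have "f (circle_in n (cis (2 * pi * t))) = A n (cis (2 * pi * t))"
    proof (cases "circle_in n (cis (2 * pi * t)) = 0")
      case True
      then show ?thesis
        using f0 A1 by (simp add: circle_in_def del: of_nat_Suc)
    next
      case False
      then show ?thesis
        using f[OF circle_in_hcircle False] eta_circle_in[of "cis (2 * pi * t)" n n] by (simp add: G_def)
    qed
    then show ?thesis
      using A\<alpha>[OF t] by simp
  qed
  ultimately show ?thesis
    using f0 by (intro exI[of _ f]) (simp add: b0_def)
qed

text \<open>The level is the place of the leading binary digit of \<open>Suc n\<close>, and the
  position is the remainder.\<close>

lemma level_position_exists: "\<exists>m j. j < 2 ^ m \<and> 2 ^ m + j - 1 = (n::nat)"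
proof -
  obtain m where m: "2 ^ m \<le> Suc n" "Suc n < 2 ^ (m + 1)"
    using ex_power_ivl1[of 2 "Suc n"] by auto
  then show ?thesis
    by (intro exI[of _ m] exI[of _ "Suc n - 2 ^ m"]) auto
qed

text \<open>Whatever \<open>\<phi>\<close> is, each circle occurs on exactly one gap, so every
  coordinate is one full turn up to homotopy. Hence any two orders of the standard loops have the
  same class in the torus.\<close>

lemma eta_tau_prod_homotopic:
  assumes g: "\<And>n. g n = circle_in (\<phi> n) \<circ> (\<lambda>t. cis (2 * pi * t))" and \<phi>: "bij \<phi>"
  shows "loop_homotopic (top_of_set (sphere 0 1)) (\<lambda>t. eta (tau_prod b0 g t) m) (\<lambda>t. cis (2 * pi * t))"
proof -
  obtain n where n: "\<phi> n = m"
    using \<phi> by (metis bij_pointE)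
  obtain l j where lj: "j < 2 ^ l" "2 ^ l + j - 1 = n"
    using level_position_exists by blast
  have e: "eta (g i t) m = (if i = n then cis (2 * pi * t) else 1)" for i t
  proof -
    have "m = \<phi> i \<longleftrightarrow> i = n"
      using n \<phi> by (metis bij_pointE)
    then show ?thesis
      using eta_circle_in[of "cis (2 * pi * t)" "\<phi> i" m] by (simp add: g)
  qed
  have "loop_homotopic (top_of_set (sphere 0 1)) (\<lambda>t. eta (tau_prod b0 g t) m)
      (\<lambda>t. eta ((case (l, j) of (m, j) \<Rightarrow> g (2 ^ m + j - 1)) t) m)"
  proof (rule eta_tiles_homotopic[OF tiles_as_tau_prod])
    show "(l, j) \<in> {(m, j). j < 2 ^ m}"
      using lj by simp
    show "loop (top_of_set (sphere 0 1)) 1 (\<lambda>t. eta ((case (l, j) of (m, j) \<Rightarrow> g (2 ^ m + j - 1)) t) m)"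
      unfolding prod.case lj(2) e using circle_loop by simp
    fix k and t :: real
    assume k: "k \<in> {(m, j). j < 2 ^ m}" "k \<noteq> (l, j)"
    obtain l' j' where k': "k = (l', j')"
      by (metis surj_pair)
    have "2 ^ l' + j' - 1 \<noteq> n"
    proof
      assume "2 ^ l' + j' - 1 = n"
      moreover have "1 \<le> (2::nat) ^ l'" "1 \<le> (2::nat) ^ l"
        by simp_all
      ultimately have "2 ^ l' + j' = 2 ^ l + j"
        using lj(2) by linarith
      then show False
        using level_position_unique[of j' l' j l] k k' lj(1) by simp
    qed
    then show "eta ((case k of (m, j) \<Rightarrow> g (2 ^ m + j - 1)) t) m = 1"
      by (simp add: k' e)
  qed
  then show ?thesis
    by (simp only: prod.case lj(2) e if_True simp_thms)
qed

lemma loop_tau_prod: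
  assumes x: "x \<in> topspace X" and loops: "\<And>n. loop (subtopology X (S n)) x (g n)"
    and null: "null_family X x UNIV S"
  shows "loop X x (tau_prod x g)"
proof (rule tiles_as_loop[OF x tiles_as_tau_prod, where S="S \<circ> (\<lambda>(m, j). 2 ^ m + j - 1)"])
  show "loop (subtopology X ((S \<circ> (\<lambda>(m, j). 2 ^ m + j - 1)) k)) x (case k of (m, j) \<Rightarrow> g (2 ^ m + j - 1))" for k
    using loops by (simp split: prod.split)
  show "null_family X x {(m, j). j < 2 ^ m} (S \<circ> (\<lambda>(m, j). 2 ^ m + j - 1))"
  proof (rule null_family_reindex[OF null])
    show "inj_on (\<lambda>(m, j). 2 ^ m + j - 1) {(m::nat, j::nat). j < 2 ^ m}"
    proof (rule inj_onI, clarsimp, goal_cases)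
      case (1 m j m' j')
      moreover have "1 \<le> (2::nat) ^ m" "1 \<le> (2::nat) ^ m'"
        by simp_all
      ultimately have "2 ^ m + j = 2 ^ m' + j'"
        by linarith
      then show ?case
        using level_position_unique 1 by blast
    qed
  qed simp
qed

text \<open>Both products are images under one map \<open>f\<close> of transfinite products of the
  standard loops of the earring. These agree in the torus, and the factorization carries the
  equality of classes to \<open>X\<close>.\<close>

theorem factors_imp_transfinitely:
  assumes x: "x \<in> topspace X" and fac: "factors_through_eta X x"
  shows "transfinitely_pi1_commutative X x"
  unfolding transfinitely_pi1_commutative_def
proof (intro allI impI)
  fix \<alpha> and \<phi> :: "nat \<Rightarrow> nat"
  assume "null_sequence X x \<alpha> \<and> bij \<phi>"
  then have \<alpha>: "null_sequence X x \<alpha>" and \<phi>: "bij \<phi>"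
    by auto
  obtain f where f: "continuous_map HE X f" "f b0 = x"
    and f\<alpha>: "\<And>n t. t \<in> {0..1} \<Longrightarrow> f (circle_in n (cis (2 * pi * t))) = \<alpha> n t"
    using null_sequence_map[OF x \<alpha>] by blast
  have "\<exists>h. h \<in> hom (fundamental_group torus x0) (fundamental_group X x) \<and>
      (\<forall>A\<in>carrier (fundamental_group HE b0). induced X f A = h (induced torus eta A))"
    using fac[unfolded factors_through_eta_def, rule_format, of f] f by simp
  then obtain h where
    h: "\<And>A. A \<in> carrier (fundamental_group HE b0) \<Longrightarrow> induced X f A = h (induced torus eta A)"
    by auto
  define lp where "lp n = circle_in n \<circ> (\<lambda>t. cis (2 * pi * t))" for n
  have lp: "loop (subtopology HE (hsub {n})) b0 (lp n)" for n
    using loop_compose[OF circle_loop continuous_map_circle_in[of n]] by (simp add: lp_def circle_in_def b0_def)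
  have p1: "loop HE b0 (tau_prod b0 lp)"
    by (rule loop_tau_prod[OF b0_in_HE lp null_family_circles])
  have p2: "loop HE b0 (tau_prod b0 (lp \<circ> \<phi>))"
  proof (rule loop_tau_prod[OF b0_in_HE])
    show "loop (subtopology HE (((\<lambda>n. hsub {n}) \<circ> \<phi>) n)) b0 ((lp \<circ> \<phi>) n)" for n
      using lp by simp
    show "null_family HE b0 UNIV ((\<lambda>n. hsub {n}) \<circ> \<phi>)"
      by (rule null_family_reindex[OF null_family_circles]) (use \<phi> in \<open>auto simp: bij_def\<close>)
  qed
  have "loop_homotopic torus (eta \<circ> tau_prod b0 lp) (eta \<circ> tau_prod b0 (lp \<circ> \<phi>))"
  proof (rule loop_homotopic_torus)
    fix m
    have "loop_homotopic (top_of_set (sphere 0 1)) (\<lambda>t. eta (tau_prod b0 lp t) m) (\<lambda>t. cis (2 * pi * t))"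
      by (rule eta_tau_prod_homotopic[of _ id]) (simp_all add: lp_def)
    moreover have "loop_homotopic (top_of_set (sphere 0 1)) (\<lambda>t. eta (tau_prod b0 (lp \<circ> \<phi>) t) m) (\<lambda>t. cis (2 * pi * t))"
      by (rule eta_tau_prod_homotopic[of _ \<phi>]) (use \<phi> in \<open>simp_all add: lp_def\<close>)
    ultimately show "loop_homotopic (top_of_set (sphere 0 1)) (\<lambda>t. (eta \<circ> tau_prod b0 lp) t m) (\<lambda>t. (eta \<circ> tau_prod b0 (lp \<circ> \<phi>)) t m)"
      unfolding o_apply by (meson loop_homotopic_sym loop_homotopic_trans)
  qed
  then have "induced torus eta (loop_class HE (tau_prod b0 lp)) = induced torus eta (loop_class HE (tau_prod b0 (lp \<circ> \<phi>)))"
    using induced_loop_class[OF p1 continuous_map_eta] induced_loop_class[OF p2 continuous_map_eta]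
      loop_class_eq_iff[OF loop_compose[OF p1 continuous_map_eta]] by simp
  then have "induced X f (loop_class HE (tau_prod b0 lp)) = induced X f (loop_class HE (tau_prod b0 (lp \<circ> \<phi>)))"
    using h p1 p2 by (simp add: carrier_fundamental_group)
  then have *: "loop_homotopic X (f \<circ> tau_prod b0 lp) (f \<circ> tau_prod b0 (lp \<circ> \<phi>))"
    using induced_loop_class[OF p1 f(1)] induced_loop_class[OF p2 f(1)]
      loop_class_eq_iff[OF loop_compose[OF p1 f(1)]] by simp
  \<comment> \<open>Applying \<open>f\<close> to the tiling by standard loops gives the tiling by
    the loops of the sequence. This is used with \<open>\<psi>\<close> the identity and with
    \<open>\<phi>\<close>.\<close>
  have eq: "(f \<circ> tau_prod b0 (lp \<circ> \<psi>)) t = tau_prod x (\<alpha> \<circ> \<psi>) t" if "t \<in> {0..1}" for \<psi> :: "nat \<Rightarrow> nat" and t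
  proof (rule tiles_as_unique[OF _ tiles_as_tau_prod _ that])
    show "tiles_as x {(m, j). j < 2 ^ m} (\<lambda>(m, j). gap_left m j) (\<lambda>(m, j). gap_right m j)
        (\<lambda>k. f \<circ> (case k of (m, j) \<Rightarrow> (lp \<circ> \<psi>) (2 ^ m + j - 1))) (f \<circ> tau_prod b0 (lp \<circ> \<psi>))"
      using tiles_as_compose[OF tiles_as_tau_prod[of b0 "lp \<circ> \<psi>"], of f] unfolding f(2) .
    fix k and t :: real assume "0 < t" "t < 1"
    then show "(f \<circ> (case k of (m, j) \<Rightarrow> (lp \<circ> \<psi>) (2 ^ m + j - 1))) t
        = (case k of (m, j) \<Rightarrow> (\<alpha> \<circ> \<psi>) (2 ^ m + j - 1)) t"
      using f\<alpha>[of t] by (simp add: lp_def split: prod.split)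
  qed
  show "loop_homotopic X (tau_prod x \<alpha>) (tau_prod x (\<alpha> \<circ> \<phi>))"
    using * eq[of _ id] eq[of _ \<phi>] by (subst (asm) loop_homotopic_cong) auto
qed

section \<open>Splitting a circle off a loop\<close>

text \<open>Piecewise linear interpolation of the values \<open>v i\<close> at the nodes
  \<open>i / N\<close>, written as a sum of clamped ramps so that continuity is immediate.\<close>

definition lin_interp :: "nat \<Rightarrow> (nat \<Rightarrow> real) \<Rightarrow> real \<Rightarrow> real" where
  "lin_interp N v t = v 0 + (\<Sum>j<N. (v (Suc j) - v j) * max 0 (min 1 (real N * t - real j)))"

lemma continuous_on_lin_interp: "continuous_on S (lin_interp N v)"
  unfolding lin_interp_def by (intro continuous_intros)

text \<open>On cell \<open>i\<close> the earlier ramps are saturated at 1 and the later ones still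
  0, so the sum telescopes up to \<open>v i\<close> and leaves one partial ramp.\<close>

lemma lin_interp_grid:
  assumes "i < N" "r \<in> {0..1}"
  shows "lin_interp N v ((real i + r) / real N) = v i + (v (Suc i) - v i) * r"
proof -
  have N: "real N * ((real i + r) / real N) = real i + r"
    using assms by simp
  have "(\<Sum>j<M. (v (Suc j) - v j) * max 0 (min 1 (real i + r - real j)))
      = v i - v 0 + (v (Suc i) - v i) * r" if "Suc i \<le> M" for M
    using that
  proof (induction M rule: nat_induct_at_least)
    case base
    have "(\<Sum>j<i. (v (Suc j) - v j) * max 0 (min 1 (real i + r - real j))) = (\<Sum>j<i. v (Suc j) - v j)"
    proof (rule sum.cong[OF refl])
      fix j assume "j \<in> {..<i}"
      then have "real j + 1 \<le> real i"
        by simp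
      then have "max 0 (min 1 (real i + r - real j)) = 1"
        using assms(2) by simp
      then show "(v (Suc j) - v j) * max 0 (min 1 (real i + r - real j)) = v (Suc j) - v j"
        by simp
    qed
    also have "\<dots> = v i - v 0"
      by (rule sum_lessThan_telescope)
    finally show ?case
      using assms(2) by simp
  next
    case (Suc M)
    then have "real i + 1 \<le> real M"
      by simp
    then have "max 0 (min 1 (real i + r - real M)) = 0"
      using assms(2) by simp
    then show ?case
      using Suc by simp
  qed
  from this[of N] show ?thesis
    unfolding lin_interp_def N using assms(1) by simp
qed

lemma grid_cover:
  assumes "0 < N" "t \<in> {0..1}"
  obtains i r where "i < N" "r \<in> {0..1}" "t = (real i + r) / real N"
proof (cases "t = 1")
  case True
  \<comment> \<open>The right endpoint 1 belongs to the last cell, with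
    \<open>r = 1\<close>.\<close>
  have "real (N - 1) + 1 = real N"
    using assms(1) by simp
  then show ?thesis
    using assms(1) True by (intro that[of "N - 1" 1]) auto
next
  case False
  define y where "y = t * real N"
  have y: "0 \<le> y" "y < real N"
    using assms False by (auto simp: y_def)
  show ?thesis
  proof (rule that[of "nat \<lfloor>y\<rfloor>" "y - of_int \<lfloor>y\<rfloor>"])
    show "nat \<lfloor>y\<rfloor> < N"
      using y by linarith
    show "y - of_int \<lfloor>y\<rfloor> \<in> {0..1}"
      by simp linarith
    have "real (nat \<lfloor>y\<rfloor>) = of_int \<lfloor>y\<rfloor>"
      using y(1) by simp
    then show "t = (real (nat \<lfloor>y\<rfloor>) + (y - of_int \<lfloor>y\<rfloor>)) / real N"
      using assms(1) by (simp add: y_def)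
  qed
qed

lemma tiles_as_grid:
  assumes N: "0 < N" and nodes: "\<And>i. i \<le> N \<Longrightarrow> P (real i / real N) = x"
  shows "tiles_as x {..<N} (\<lambda>i. real i / real N) (\<lambda>i. real (Suc i) / real N)
     (\<lambda>i r. P ((real i + r) / real N)) P"
proof (rule tiles_asI, goal_cases)
  case (4 j k)
  have "Suc j \<le> k \<or> Suc k \<le> j"
    using 4 by linarith
  then show ?case
    using N by (simp only: divide_le_cancel of_nat_le_iff) simp
next
  case (5 k t)
  have w: "real (Suc k) / real N - real k / real N = 1 / real N"
    by (simp add: add_divide_distrib)
  have "(real k + (t - real k / real N) / (real (Suc k) / real N - real k / real N)) / real N = t"
    unfolding w using N by (simp add: field_simps)
  then show ?case
    by simp
next
  case (6 t)
  obtain i r where ir: "i < N" "r \<in> {0..1}" "t = (real i + r) / real N"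
    using grid_cover[OF N, of t] 6(1,2) by auto
  have "t \<le> real i / real N \<or> real (Suc i) / real N \<le> t"
    using 6(3)[of i] ir(1) by simp
  then have "r = 0 \<or> r = 1"
    using ir N by (auto simp: divide_le_cancel)
  then have "t = real i / real N \<or> t = real (Suc i) / real N"
    using ir(3) by (auto simp: add.commute)
  then show ?case
    using nodes[of i] nodes[of "Suc i"] ir(1) by auto
qed (use N in \<open>auto simp: divide_strict_right_mono field_simps\<close>)

text \<open>Distinct multiples of a full turn are at least \<open>2 * pi\<close> apart, so a
  continuous function with such values is constant on the half-open interval; continuity extends
  this to the left endpoint.\<close>

lemma integer_angle_constant:
  fixes \<theta> :: "real \<Rightarrow> real"
  assumes cont: "continuous_on {a..b} \<theta>" and ab: "a < b"
    and int: "\<And>t. a < t \<Longrightarrow> t \<le> b \<Longrightarrow> \<exists>k::int. \<theta> t = 2 * pi * of_int k"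
    and t: "t \<in> {a..b}"
  shows "\<theta> t = \<theta> b"
proof -
  have "\<theta> constant_on {a<..b}"
  proof (rule continuous_discrete_range_constant)
    show "continuous_on {a<..b} \<theta>"
      by (rule continuous_on_subset[OF cont]) auto
    fix s assume s: "s \<in> {a<..b}"
    show "\<exists>e>0. \<forall>t. t \<in> {a<..b} \<and> \<theta> t \<noteq> \<theta> s \<longrightarrow> e \<le> norm (\<theta> t - \<theta> s)"
    proof (intro exI[of _ "2 * pi"] conjI allI impI)
      fix t assume t: "t \<in> {a<..b} \<and> \<theta> t \<noteq> \<theta> s"
      obtain k l :: int where kl: "\<theta> t = 2 * pi * of_int k" "\<theta> s = 2 * pi * of_int l"
        using int[of t] int[of s] s t by auto
      then have "k \<noteq> l"
        using t by auto
      then have "1 \<le> \<bar>real_of_int (k - l)\<bar>"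
        by linarith
      then have "2 * pi * 1 \<le> 2 * pi * \<bar>real_of_int (k - l)\<bar>"
        by (intro mult_left_mono) auto
      also have "\<dots> = \<bar>\<theta> t - \<theta> s\<bar>"
        unfolding kl by (simp add: abs_mult right_diff_distrib[symmetric])
      finally show "2 * pi \<le> norm (\<theta> t - \<theta> s)"
        by simp
    qed simp
  qed auto
  then obtain y where y: "\<And>s. s \<in> {a<..b} \<Longrightarrow> \<theta> s = y"
    by (auto simp: constant_on_def)
  have "\<theta> t = y"
    by (rule continuous_constant_on_closure[of "{a<..b}" \<theta>]) (use cont y t ab in auto)
  moreover have "\<theta> b = y"
    using y ab by simp
  ultimately show ?thesis
    by simp
qed

lemma round_angle:
  fixes l :: int
  assumes "\<bar>y - 2 * pi * of_int l\<bar> < pi"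
  shows "round (y / (2 * pi)) = l"
proof (rule round_unique')
  have "\<bar>y / (2 * pi) - of_int l\<bar> = \<bar>y - 2 * pi * of_int l\<bar> / (2 * pi)"
  proof -
    have "y / (2 * pi) - of_int l = (y - 2 * pi * of_int l) / (2 * pi)"
      by (simp add: field_simps)
    then show ?thesis
      by (simp add: abs_divide)
  qed
  also have "\<dots> < 1 / 2"
    using assms by (simp add: field_simps)
  finally show "\<bar>y / (2 * pi) - of_int l\<bar> < 1 / 2" .
qed

text \<open>On a fine grid every node is pulled back to the last zero of \<open>b\<close> before it. The angle is
  constant on the intervals skipped in this way, so it still varies little between
  consecutive pulled back nodes and can be rounded to a multiple of a full turn.\<close>

lemma pulled_back_grid:
  fixes \<theta> :: "real \<Rightarrow> real" and b :: "real \<Rightarrow> complex"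
  assumes c\<theta>: "continuous_on {0..1} \<theta>" and cb: "continuous_on {0..1} b"
    and b01: "b 0 = 0" "b 1 = 0"
    and \<theta>01: "\<theta> 0 = 2 * pi * of_int l0" "\<theta> 1 = 2 * pi * of_int l1"
    and int: "\<And>t. t \<in> {0..1} \<Longrightarrow> b t \<noteq> 0 \<Longrightarrow> \<exists>k::int. \<theta> t = 2 * pi * of_int k"
  obtains N :: nat and \<tau> :: "nat \<Rightarrow> real" and k :: "nat \<Rightarrow> int"
  where "0 < N" "\<tau> 0 = 0" "\<tau> N = 1" "\<And>i. i \<le> N \<Longrightarrow> b (\<tau> i) = 0"
    "\<And>i. i \<le> N \<Longrightarrow> \<tau> i \<in> {0..1}" "\<And>i. i < N \<Longrightarrow> \<tau> i \<le> \<tau> (Suc i)"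
    "\<theta> 0 = 2 * pi * of_int (k 0)" "\<theta> 1 = 2 * pi * of_int (k N)"
    "\<And>i t. i < N \<Longrightarrow> t \<in> {\<tau> i..\<tau> (Suc i)} \<Longrightarrow> b t \<noteq> 0 \<Longrightarrow>
       \<theta> t = 2 * pi * of_int (k i) \<and> k (Suc i) = k i"
proof -
  have "uniformly_continuous_on {0..1} \<theta>"
    by (rule compact_uniformly_continuous[OF c\<theta>]) simp
  \<comment> \<open>The bound \<open>pi / 2\<close> is chosen so that two comparisons add up to less
    than \<open>pi\<close>, the limit within which rounding finds the right multiple.\<close>
  then obtain \<delta> where \<delta>: "\<delta> > 0"
      "\<And>s t. s \<in> {0..1} \<Longrightarrow> t \<in> {0..1} \<Longrightarrow> dist s t < \<delta> \<Longrightarrow> dist (\<theta> s) (\<theta> t) < pi / 2"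
    unfolding uniformly_continuous_on_def by (metis pi_half_gt_zero)
  obtain N :: nat where N: "0 < N" "1 / real N < \<delta>"
    using \<delta>(1) by (metis nat_approx_posE of_nat_Suc zero_less_Suc)
  define Z where "Z i = {t \<in> {0..real i / real N}. b t = 0}" for i
  define \<tau> where "\<tau> i = Sup (Z i)" for i
  define k where "k i = round (\<theta> (\<tau> i) / (2 * pi))" for i
  have iN: "real i / real N \<le> 1" if "i \<le> N" for i
    using that N(1) by simp
  have \<tau>Z: "\<tau> i \<in> Z i" if "i \<le> N" for i
    unfolding \<tau>_def
  proof (rule closed_contains_Sup)
    show "Z i \<noteq> {}"
      using b01(1) by (auto simp: Z_def intro: exI[of _ 0])
    show "bdd_above (Z i)"
      by (rule bdd_aboveI[of _ "real i / real N"]) (auto simp: Z_def)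
    have "continuous_on {0..real i / real N} b"
      by (rule continuous_on_subset[OF cb]) (use iN[OF that] in auto)
    then show "closed (Z i)"
      unfolding Z_def by (intro continuous_closed_preimage_constant) auto
  qed
  have \<tau>max: "t \<le> \<tau> i" if "t \<in> Z i" for t i
    unfolding \<tau>_def by (rule cSup_upper[OF that]) (auto simp: Z_def intro: bdd_aboveI[of _ "real i / real N"])
  have b\<tau>: "b (\<tau> i) = 0" and \<tau>0: "0 \<le> \<tau> i" and \<tau>i: "\<tau> i \<le> real i / real N" if "i \<le> N" for i
    using \<tau>Z[OF that] by (auto simp: Z_def)
  have \<tau>01: "\<tau> i \<in> {0..1}" if "i \<le> N" for i
    using \<tau>0[OF that] \<tau>i[OF that] iN[OF that] by simp
  have first: "\<tau> 0 = 0"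
    using \<tau>0[of 0] \<tau>i[of 0] by simp
  have last: "\<tau> N = 1"
    using \<tau>max[of 1 N] \<tau>i[of N] b01(2) N(1) by (simp add: Z_def)
  have mono: "\<tau> i \<le> \<tau> (Suc i)" if "i < N" for i
  proof (rule \<tau>max)
    have "real i / real N \<le> real (Suc i) / real N"
      by (simp add: divide_right_mono)
    then show "\<tau> i \<in> Z (Suc i)"
      using \<tau>Z[of i] that by (auto simp: Z_def)
  qed
  \<comment> \<open>Up to the node \<open>i / N\<close> there is no zero of \<open>b\<close> after
    \<open>\<tau> i\<close>, so the angle is constant there. Beyond the node \<open>t\<close> is at
    most one mesh width away, because \<open>\<tau> (Suc i)\<close> does not exceed the next
    node.\<close>
  have near: "\<bar>\<theta> t - \<theta> (real i / real N)\<bar> < pi / 2" if i: "i < N" and t: "t \<in> {\<tau> i..\<tau> (Suc i)}" for i t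
  proof (cases "t \<le> real i / real N")
    case True
    have "\<theta> t = \<theta> (real i / real N)"
    proof (cases "\<tau> i = real i / real N")
      case True
      then have "t = real i / real N"
        using \<open>t \<le> real i / real N\<close> t by auto
      then show ?thesis
        by simp
    next
      case False
      show ?thesis
      proof (rule integer_angle_constant[of "\<tau> i" "real i / real N" \<theta> t])
        show "continuous_on {\<tau> i..real i / real N} \<theta>"
          by (rule continuous_on_subset[OF c\<theta>]) (use \<tau>0[of i] iN[of i] i in auto)
        show "\<tau> i < real i / real N"
          using False \<tau>i[of i] i by simp
        show "t \<in> {\<tau> i..real i / real N}"
          using t True by simp
        fix s assume s: "\<tau> i < s" "s \<le> real i / real N"
        have "0 \<le> s" "s \<le> 1"
          using s \<tau>0[of i] iN[of i] i by linarith+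
        moreover from this have "b s \<noteq> 0"
          using s \<tau>max[of s i] by (auto simp: Z_def)
        ultimately have "s \<in> {0..1}" "b s \<noteq> 0"
          by simp_all
        then show "\<exists>k::int. \<theta> s = 2 * pi * of_int k"
          by (rule int)
      qed
    qed
    then show ?thesis
      by simp
  next
    case False
    have "t \<le> real (Suc i) / real N"
      using t \<tau>i[of "Suc i"] i by auto
    then have "t - real i / real N \<le> 1 / real N"
      by (simp add: add_divide_distrib)
    then have "dist t (real i / real N) < \<delta>"
      using False N(2) by (simp add: dist_real_def)
    then have "dist (\<theta> t) (\<theta> (real i / real N)) < pi / 2"
      using \<delta>(2)[of t "real i / real N"] t \<tau>01[of i] \<tau>01[of "Suc i"] i iN[of i] by auto
    then show ?thesis
      by (simp add: dist_real_def)
  qed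
  show ?thesis
  proof (rule that[of N \<tau> k])
    show "\<theta> 0 = 2 * pi * of_int (k 0)" "\<theta> 1 = 2 * pi * of_int (k N)"
      unfolding k_def first last \<theta>01 using round_angle[of "2 * pi * of_int l0" l0]
        round_angle[of "2 * pi * of_int l1" l1] by simp_all
    fix i t assume i: "i < N" and t: "t \<in> {\<tau> i..\<tau> (Suc i)}" and bt: "b t \<noteq> 0"
    have "t \<in> {0..1}"
      using t \<tau>01[of i] \<tau>01[of "Suc i"] i by auto
    then obtain l :: int where l: "\<theta> t = 2 * pi * of_int l"
      using int bt by blast
    \<comment> \<open>The angle at \<open>t\<close> and those at both ends of the cell are all
      within \<open>pi / 2\<close> of the angle at the node, so both ends round to the multiple
      attained at \<open>t\<close>.\<close>
    have "k j = l" if "j = i \<or> j = Suc i" for j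
    proof -
      have "\<bar>\<theta> (\<tau> j) - \<theta> (real i / real N)\<bar> < pi / 2"
        by (rule near[OF i]) (use that mono[OF i] in auto)
      then have "\<bar>\<theta> (\<tau> j) - 2 * pi * of_int l\<bar> < pi"
        using near[OF i t] unfolding l by linarith
      then show ?thesis
        unfolding k_def by (rule round_angle)
    qed
    then show "\<theta> t = 2 * pi * of_int (k i) \<and> k (Suc i) = k i"
      using l by simp
  qed (use N(1) first last b\<tau> \<tau>01 mono in auto)
qed

section \<open>Angles on one circle and the decomposition of a wedge\<close>

lemma loop_homotopic_paths: "loop_homotopic (top_of_set S) p q \<longleftrightarrow> homotopic_paths S p q"
  by (simp add: loop_homotopic_def homotopic_paths_def pathstart_def pathfinish_def)

lemma loop_path:
  assumes "loop (top_of_set S) x p"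
  shows "path p" "path_image p \<subseteq> S" "pathstart p = x" "pathfinish p = x"
  using assms by (auto simp: loop_def pathin_def path_def path_image_def pathstart_def pathfinish_def)

lemma loop_homotopic_reparametrize:
  assumes p: "loop (top_of_set S) x p" and u: "continuous_on {0..1} u" "u ` {0..1} \<subseteq> {0..1}" "u 0 = 0" "u 1 = 1"
  shows "loop_homotopic (top_of_set S) p (p \<circ> u)"
  unfolding loop_homotopic_paths
  by (rule homotopic_paths_reparametrize[OF loop_path(1,2)[OF p] u(1) _ u(3,4)]) (use u(2) in auto)

lemma circle_in_one [simp]: "circle_in n 1 = 0"
  by (simp add: circle_in_def)

text \<open>Addition serves as gluing in the wedge, since one of the summands is always 0.
  Continuity of combined maps then reduces to continuity of sums.\<close>

lemma hsub_add:
  assumes "v \<in> hsub M" "w \<in> hsub N" "v = 0 \<or> w = 0"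
  shows "v + w \<in> hsub (M \<union> N)"
  using assms hsub_Un[of M N] by auto

lemma collapse_add:
  assumes "z \<in> hsub (M \<union> N)" "M \<inter> N = {}"
  shows "z = collapse M z + collapse N z" "collapse M z = 0 \<or> collapse N z = 0"
proof -
  have "z = 0" if "z \<in> hsub M" "z \<in> hsub N"
    using hsub_Int[of M N] assms(2) that by auto
  moreover have "z \<in> hsub M \<or> z \<in> hsub N"
    using assms(1) hsub_Un[of M N] by auto
  ultimately show "z = collapse M z + collapse N z" "collapse M z = 0 \<or> collapse N z = 0"
    by (auto simp: collapse_def)
qed

text \<open>On the contractible unit interval the nowhere zero function \<open>eta (a t) n\<close>
  has a continuous logarithm. Its modulus is 1, so the logarithm is purely imaginary and supplies
  the angle.\<close>

lemma circle_loop_angle: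
  assumes a: "loop (top_of_set (hsub {n})) 0 a"
  obtains \<theta> where "continuous_on {0..1} \<theta>" "\<And>t. t \<in> {0..1} \<Longrightarrow> a t = circle_in n (cis (\<theta> t))"
proof -
  have im: "a t \<in> hcircle (Suc n)" if "t \<in> {0..1}" for t
    using a that by (auto simp: loop_def pathin_def hsub_single)
  have ca: "continuous_on {0..1} a"
    using a by (simp add: loop_def pathin_def)
  have e: "eta (a t) n = 1 - of_nat (Suc n) * a t" if "t \<in> {0..1}" for t
    using im[OF that] by (simp add: eta_def)
  have "continuous_on {0..1} (\<lambda>t. 1 - of_nat (Suc n) * a t)"
    by (intro continuous_intros ca)
  then have "continuous_on {0..1} (\<lambda>t. eta (a t) n)"
    by (rule continuous_on_eq) (simp add: e)
  then obtain g where g: "continuous_on {0..1} g" "\<And>t. t \<in> {0..1} \<Longrightarrow> eta (a t) n = exp (g t)"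
  proof (rule continuous_logarithm_on_contractible)
    show "contractible {0..1::real}"
      by (simp add: convex_imp_contractible)
    show "eta (a t) n \<noteq> 0" for t
      using norm_eta[of "a t" n] by auto
  qed blast
  show ?thesis
  proof (rule that[of "\<lambda>t. Im (g t)"])
    show "continuous_on {0..1} (\<lambda>t. Im (g t))"
      by (intro continuous_intros g(1))
    fix t :: real assume t: "t \<in> {0..1}"
    have "exp (Re (g t)) = 1"
      using norm_eta[of "a t" n] g(2)[OF t] by simp
    then have "exp (g t) = cis (Im (g t))"
      by (simp add: exp_eq_polar)
    then show "a t = circle_in n (cis (Im (g t)))"
      using circle_in_eta[OF im[OF t]] g(2)[OF t] by simp
  qed
qed

lemma circle_in_cis_eq_zero:
  assumes "circle_in n (cis y) = 0"
  shows "\<exists>k::int. y = 2 * pi * of_int k"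
proof -
  have "cis y = 1"
    using assms by (simp add: circle_in_def del: of_nat_Suc)
  then have "cos y = 1"
    by (simp add: complex_eq_iff)
  then obtain k :: int where "y = of_int k * 2 * pi"
    by (auto simp: cos_one_2pi_int)
  then show ?thesis
    by (intro exI[of _ k]) simp
qed

lemma continuous_on_circle_in_cis:
  "continuous_on S h \<Longrightarrow> continuous_on S (\<lambda>t. circle_in n (cis (h t)))"
  unfolding circle_in_def by (intro continuous_intros) (simp_all del: of_nat_Suc)

lemma circle_in_cis_hsub: "circle_in n (cis y) \<in> hsub {n}"
  by (simp add: hsub_single circle_in_hcircle)

text \<open>The loop may leave circle \<open>n\<close> infinitely often. Its motion on that circle
  is therefore replaced by one following the rounded angles, which rests at the wedge point on every
  cell where a later circle is visited. Afterwards each cell runs in circle \<open>n\<close> alone,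
  for the cells in \<open>W\<close>, or in the later circles alone.\<close>

theorem wedge_decomposition:
  assumes p: "loop (top_of_set (hsub {n..})) 0 p"
  shows "\<exists>N W C P a b. has_tiles 0 {..<N::nat} C P \<and> has_tiles 0 ({..<N} \<inter> W) C a \<and>
      has_tiles 0 ({..<N} - W) C b \<and> (\<forall>i<N. loop (top_of_set (hsub {n..})) 0 (C i)) \<and>
      loop_homotopic (top_of_set (hsub {n..})) p P \<and>
      loop_homotopic (top_of_set (hsub {n})) (collapse {n} \<circ> p) a \<and>
      loop_homotopic (top_of_set (hsub {Suc n..})) (collapse {Suc n..} \<circ> p) b"
proof -
  define a0 where "a0 = collapse {n} \<circ> p"
  define b0 where "b0 = collapse {Suc n..} \<circ> p"
  have split: "{n..} = {n} \<union> {Suc n..}" "{n} \<inter> {Suc n..} = {}"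
    by auto
  have pim: "p t \<in> hsub {n..}" if "t \<in> {0..1}" for t
    using p that by (auto simp: loop_def pathin_def)
  have pH: "loop HE 0 p"
    using loop_subtopologyD(1)[of HE "hsub {n..}" 0 p] p subtopology_HE by simp
  have col0: "collapse M 0 = 0" for M
    by (simp add: collapse_def)
  have la: "loop (top_of_set (hsub {n})) 0 a0" and lb: "loop (top_of_set (hsub {Suc n..})) 0 b0"
    unfolding a0_def b0_def using loop_compose[OF pH continuous_map_collapse] col0 by metis+
  have cb: "continuous_on {0..1} b0" and b01: "b0 0 = 0" "b0 1 = 0"
    and bim: "\<And>t. t \<in> {0..1} \<Longrightarrow> b0 t \<in> hsub {Suc n..}"
    using lb by (auto simp: loop_def pathin_def)
  have sum: "p t = a0 t + b0 t" and alt: "a0 t = 0 \<or> b0 t = 0" if "t \<in> {0..1}" for t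
    using collapse_add[of "p t" "{n}" "{Suc n..}"] pim[OF that] split by (auto simp: a0_def b0_def)
  obtain \<theta> where c\<theta>: "continuous_on {0..1} \<theta>" and \<theta>: "\<And>t. t \<in> {0..1} \<Longrightarrow> a0 t = circle_in n (cis (\<theta> t))"
    using circle_loop_angle[OF la] by metis
  have int: "\<exists>k::int. \<theta> t = 2 * pi * of_int k" if "t \<in> {0..1}" "a0 t = 0" for t
    using circle_in_cis_eq_zero[of n "\<theta> t"] \<theta>[OF that(1)] that(2) by simp
  have a01: "a0 0 = 0" "a0 1 = 0"
    using la by (auto simp: loop_def)
  obtain l0 l1 :: int where l: "\<theta> 0 = 2 * pi * of_int l0" "\<theta> 1 = 2 * pi * of_int l1"
    using int[of 0] int[of 1] a01 by auto
  have intb: "\<exists>k::int. \<theta> t = 2 * pi * of_int k" if "t \<in> {0..1}" "b0 t \<noteq> 0" for t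
    using int alt that by blast
  obtain N \<tau> k where N: "0 < N" and \<tau>0: "\<tau> 0 = 0" and \<tau>N: "\<tau> N = 1"
    and b\<tau>: "\<And>i. i \<le> N \<Longrightarrow> b0 (\<tau> i) = 0" and \<tau>01: "\<And>i. i \<le> N \<Longrightarrow> \<tau> i \<in> {0..1}"
    and \<tau>mono: "\<And>i. i < N \<Longrightarrow> \<tau> i \<le> \<tau> (Suc i)"
    and k0: "\<theta> 0 = 2 * pi * of_int (k 0)" and kN: "\<theta> 1 = 2 * pi * of_int (k N)"
    and kk: "\<And>i t. i < N \<Longrightarrow> t \<in> {\<tau> i..\<tau> (Suc i)} \<Longrightarrow> b0 t \<noteq> 0 \<Longrightarrow>
       \<theta> t = 2 * pi * of_int (k i) \<and> k (Suc i) = k i"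
    using pulled_back_grid[OF c\<theta> cb b01 l intb] by blast
  \<comment> \<open>\<open>u\<close> moves from one pulled back node to the next on each cell, and
    \<open>\<rho>\<close> interpolates the rounded angles over the same cells.\<close>
  define u where "u = lin_interp N \<tau>"
  define \<rho> where "\<rho> = lin_interp N (\<lambda>i. 2 * pi * of_int (k i))"
  have u_grid: "u ((real i + r) / real N) = \<tau> i + (\<tau> (Suc i) - \<tau> i) * r" if "i < N" "r \<in> {0..1}" for i r
    unfolding u_def by (rule lin_interp_grid[OF that])
  have \<rho>_grid: "\<rho> ((real i + r) / real N)
      = 2 * pi * of_int (k i) + (2 * pi * of_int (k (Suc i)) - 2 * pi * of_int (k i)) * r"
    if "i < N" "r \<in> {0..1}" for i r
    unfolding \<rho>_def by (rule lin_interp_grid[OF that])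
  have node: "u (real i / real N) = \<tau> i \<and> \<rho> (real i / real N) = 2 * pi * of_int (k i)" if "i \<le> N" for i
  proof (cases "i = N")
    case True
    then show ?thesis
      using u_grid[of "N - 1" 1] \<rho>_grid[of "N - 1" 1] N by simp
  next
    case False
    then show ?thesis
      using u_grid[of i 0] \<rho>_grid[of i 0] that by simp
  qed
  have u_in: "u ((real i + r) / real N) \<in> {\<tau> i..\<tau> (Suc i)}" if "i < N" "r \<in> {0..1}" for i r
  proof -
    have "0 \<le> (\<tau> (Suc i) - \<tau> i) * r" "(\<tau> (Suc i) - \<tau> i) * r \<le> (\<tau> (Suc i) - \<tau> i) * 1"
      using \<tau>mono[OF that(1)] that(2) by (auto intro!: mult_left_mono simp del: mult_1_right)
    then show ?thesis
      unfolding u_grid[OF that] by simp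
  qed
  have u01: "u ` {0..1} \<subseteq> {0..1}"
  proof (rule image_subsetI)
    fix t :: real assume "t \<in> {0..1}"
    then obtain i r where ir: "i < N" "r \<in> {0..1}" "t = (real i + r) / real N"
      using grid_cover[OF N] by blast
    then show "u t \<in> {0..1}"
      using u_in[of i r] \<tau>01[of i] \<tau>01[of "Suc i"] by auto
  qed
  have cu: "continuous_on S u" and c\<rho>: "continuous_on S \<rho>" for S
    unfolding u_def \<rho>_def by (rule continuous_on_lin_interp)+
  have u0: "u 0 = 0" and u1: "u 1 = 1" and \<rho>0: "\<rho> 0 = \<theta> 0" and \<rho>1: "\<rho> 1 = \<theta> 1"
    using node[of 0] node[of N] N \<tau>0 \<tau>N k0 kN by simp_all
  define W where "W = {i. \<forall>t\<in>{\<tau> i..\<tau> (Suc i)}. b0 t = 0}"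
  have piece: "\<rho> ((real i + r) / real N) = 2 * pi * of_int (k i)" if "i < N" "i \<notin> W" "r \<in> {0..1}" for i r
  proof -
    have "k (Suc i) = k i"
      using kk[OF that(1)] that(2) by (auto simp: W_def)
    then show ?thesis
      unfolding \<rho>_grid[OF that(1,3)] by simp
  qed
  \<comment> \<open>Where the loop is on a later circle, the old and the new angle coincide and are
    full turns. Hence the angle can be deformed while the other component stands still.\<close>
  have equal: "\<theta> (u t) = \<rho> t \<and> (\<exists>l::int. \<rho> t = 2 * pi * of_int l)" if t01: "t \<in> {0..1}" and bt: "b0 (u t) \<noteq> 0" for t
  proof -
    obtain i r where ir: "i < N" "r \<in> {0..1}" "t = (real i + r) / real N"
      using grid_cover[OF N t01] by blast
    have i: "i \<notin> W"
      using u_in[OF ir(1,2)] bt ir(3) by (auto simp: W_def)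
    show ?thesis
      using kk[OF ir(1) u_in[OF ir(1,2)]] bt piece[OF ir(1) i ir(2)] ir(3) by auto
  qed
  \<comment> \<open>The straight-line homotopy of angles from \<open>\<theta> \<circ> u\<close> to
    \<open>\<rho>\<close>, wrapped onto circle \<open>n\<close>.\<close>
  define A where "A z = circle_in n (cis ((1 - fst z) * \<theta> (u (snd z)) + fst z * \<rho> (snd z)))" for z
  have cA: "continuous_on ({0..1} \<times> {0..1}) A"
    unfolding A_def
  proof (intro continuous_on_circle_in_cis continuous_on_add continuous_on_mult)
    have "continuous_on ({0..1} \<times> {0..1}) (\<lambda>z. u (snd z))"
      by (rule continuous_on_compose2[OF cu[of UNIV] continuous_on_snd[OF continuous_on_id]]) auto
    then show "continuous_on ({0..1::real} \<times> {0..1}) (\<lambda>z. \<theta> (u (snd z)))"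
      by (rule continuous_on_compose2[OF c\<theta>]) (use u01 in auto)
    show "continuous_on ({0..1::real} \<times> {0..1}) (\<lambda>z. \<rho> (snd z))"
      by (rule continuous_on_compose2[OF c\<rho>[of UNIV] continuous_on_snd[OF continuous_on_id]]) auto
  qed (intro continuous_intros)+
  have Aim: "A z \<in> hsub {n}" for z
    unfolding A_def by (rule circle_in_cis_hsub)
  have A0: "A (s, t) = 0" if t01: "t \<in> {0..1}" and bt: "b0 (u t) \<noteq> 0" for s t
  proof -
    obtain l :: int where "\<rho> t = 2 * pi * of_int l" "\<theta> (u t) = \<rho> t"
      using equal[OF t01 bt] by blast
    then have "(1 - s) * \<theta> (u t) + s * \<rho> t = 2 * pi * of_int l"
      by (simp add: algebra_simps)
    then show ?thesis
      by (simp add: A_def)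
  qed
  have Aend: "A (s, 0) = 0" "A (s, 1) = 0" for s
  proof -
    have "(1 - s) * \<theta> (u 0) + s * \<rho> 0 = 2 * pi * of_int l0" "(1 - s) * \<theta> (u 1) + s * \<rho> 1 = 2 * pi * of_int l1"
      unfolding u0 u1 \<rho>0 \<rho>1 l by (simp_all add: algebra_simps)
    then show "A (s, 0) = 0" "A (s, 1) = 0"
      by (simp_all add: A_def)
  qed
  define a where "a t = circle_in n (cis (\<rho> t))" for t
  define b where "b = b0 \<circ> u"
  define P where "P t = a t + b t" for t
  have cbu: "continuous_on {0..1} b"
    unfolding b_def o_def by (rule continuous_on_compose2[OF cb cu u01])
  have bu_im: "b t \<in> hsub {Suc n..}" if "t \<in> {0..1}" for t
    unfolding b_def o_apply by (rule bim) (use u01 that in blast)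
  have hb: "loop_homotopic (top_of_set (hsub {Suc n..})) b0 b"
    unfolding b_def by (rule loop_homotopic_reparametrize[OF lb cu u01 u0 u1])
  have ha: "loop_homotopic (top_of_set (hsub {n})) a0 a"
  proof (rule loop_homotopic_trans[OF loop_homotopic_reparametrize[OF la cu u01 u0 u1]])
    show "loop_homotopic (top_of_set (hsub {n})) (a0 \<circ> u) a"
      unfolding loop_homotopic_iff
    proof (intro exI[of _ A] conjI ballI)
      show "continuous_map (prod_topology (top_of_set {0..1}) (top_of_set {0..1})) (top_of_set (hsub {n})) A"
        using cA Aim by simp
      fix t :: real assume t: "t \<in> {0..1}"
      then have "u t \<in> {0..1}"
        using u01 by blast
      then show "A (0, t) = (a0 \<circ> u) t"
        using \<theta> by (simp add: A_def)
      show "A (1, t) = a t"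
        by (simp add: A_def a_def)
    qed (use Aend u0 u1 a01 in simp_all)
  qed
  have hP: "loop_homotopic (top_of_set (hsub {n..})) p P"
  proof (rule loop_homotopic_trans[OF loop_homotopic_reparametrize[OF p cu u01 u0 u1]])
    show "loop_homotopic (top_of_set (hsub {n..})) (p \<circ> u) P"
      unfolding loop_homotopic_iff
    \<comment> \<open>The sum stays in the wedge, because \<open>A\<close> is 0 at all times of the
      homotopy wherever \<open>b\<close> is not.\<close>
    proof (intro exI[of _ "\<lambda>z. A z + b (snd z)"] conjI ballI)
      have "continuous_on ({0..1::real} \<times> {0..1}) (\<lambda>z. b (snd z))"
        by (rule continuous_on_compose2[OF cbu continuous_on_snd[OF continuous_on_id]]) auto
      then have "continuous_on ({0..1} \<times> {0..1}) (\<lambda>z. A z + b (snd z))"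
        by (intro continuous_on_add cA)
      moreover have "A z + b (snd z) \<in> hsub {n..}" if "z \<in> {0..1} \<times> {0..1}" for z
      proof -
        have t: "snd z \<in> {0..1}"
          using that by auto
        have "A z = 0 \<or> b (snd z) = 0"
          using A0[OF t, of "fst z"] by (auto simp: b_def)
        then show ?thesis
          unfolding split(1) by (intro hsub_add Aim bu_im[OF t])
      qed
      ultimately show "continuous_map (prod_topology (top_of_set {0..1}) (top_of_set {0..1}))
          (top_of_set (hsub {n..})) (\<lambda>z. A z + b (snd z))"
        by auto
      fix t :: real assume t: "t \<in> {0..1}"
      then have ut: "u t \<in> {0..1}"
        using u01 by blast
      show "A (0, t) + b (snd (0, t)) = (p \<circ> u) t"
        using \<theta>[OF ut] sum[OF ut] by (simp add: A_def b_def)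
      show "A (1, t) + b (snd (1, t)) = P t"
        by (simp add: A_def a_def P_def)
    qed (use Aend u0 u1 b01 p in \<open>simp_all add: b_def loop_def\<close>)
  qed
  have a_node: "a (real i / real N) = 0" and b_node: "b (real i / real N) = 0" if "i \<le> N" for i
    using node[OF that] b\<tau>[OF that] by (simp_all add: a_def b_def)
  define C where "C i r = P ((real i + r) / real N)" for i r
  have aW: "a ((real i + r) / real N) = 0" if "i < N" "i \<notin> W" "r \<in> {0..1}" for i r
    using piece[OF that] by (simp add: a_def)
  have bW: "b ((real i + r) / real N) = 0" if "i < N" "i \<in> W" "r \<in> {0..1}" for i r
    using u_in[OF that(1,3)] that(2) by (auto simp: b_def W_def)
  have tP: "has_tiles 0 {..<N} C P"
    unfolding C_def[abs_def] by (rule has_tilesI[OF tiles_as_grid[of N P, OF N]]) (simp add: P_def a_node b_node)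
  have ta: "has_tiles 0 ({..<N} \<inter> W) C a"
  proof (rule has_tilesI[OF tiles_as_cong[OF tiles_as_restrict[OF tiles_as_grid[of N a, OF N a_node]]]])
    show "a ((real i + r) / real N) = C i r" if "i \<in> {..<N} \<inter> W" "0 < r" "r < 1" for i r
      using bW[of i r] that by (simp add: C_def P_def)
    show "a ((real i + r) / real N) = 0" if "i \<in> {..<N} - {..<N} \<inter> W" "0 < r" "r < 1" for i r
      using aW[of i r] that by simp
  qed auto
  have tb: "has_tiles 0 ({..<N} - W) C b"
  proof (rule has_tilesI[OF tiles_as_cong[OF tiles_as_restrict[OF tiles_as_grid[of N b, OF N b_node]]]])
    show "b ((real i + r) / real N) = C i r" if "i \<in> {..<N} - W" "0 < r" "r < 1" for i r
      using aW[of i r] that by (simp add: C_def P_def)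
    show "b ((real i + r) / real N) = 0" if "i \<in> {..<N} - ({..<N} - W)" "0 < r" "r < 1" for i r
      using bW[of i r] that by simp
  qed auto
  have lP: "loop (top_of_set (hsub {n..})) 0 P"
    using loop_homotopic_loop(2)[OF hP] p by (auto simp: loop_def)
  have lC: "loop (top_of_set (hsub {n..})) 0 (C i)" if "i < N" for i
  proof -
    have sub: "(\<lambda>r. (real i + r) / real N) ` {0..1} \<subseteq> {0..1}"
      using that by (auto simp: field_simps)
    have cP: "continuous_on {0..1} P" and imP: "P ` {0..1} \<subseteq> hsub {n..}"
      using lP by (auto simp: loop_def pathin_def)
    have "continuous_on {0..1} (C i)"
      unfolding C_def by (rule continuous_on_compose2[OF cP _ sub]) (intro continuous_intros, use N in simp)
    moreover have "C i r \<in> hsub {n..}" if "r \<in> {0..1}" for r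
    proof -
      have "(real i + r) / real N \<in> {0..1}"
        using sub that by blast
      then show ?thesis
        using imP unfolding C_def by blast
    qed
    moreover have "C i 0 = 0" "C i 1 = 0"
      using a_node[of i] b_node[of i] a_node[of "Suc i"] b_node[of "Suc i"] that
      by (simp_all add: C_def P_def add.commute)
    ultimately show ?thesis
      by (auto simp: loop_def pathin_def)
  qed
  show ?thesis
    by (intro exI conjI allI impI) (rule tP ta tb lC hP ha[unfolded a0_def] hb[unfolded b0_def]; assumption?)+
qed

section \<open>Infinite commutativity yields the factorization\<close>

lemma inf_prod_homotopic:
  assumes x: "x \<in> topspace X" and "\<And>n. loop_homotopic (subtopology X (S n)) (g n) (g' n)"
    and "\<And>n. g n 0 = x" "\<And>n. g n 1 = x" and "null_family X x UNIV S"
  shows "loop_homotopic X (inf_prod x g) (inf_prod x g')"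
  by (rule tile_homotopy[OF x tiles_as_inf_prod tiles_as_inf_prod _ assms(2-5)])

lemma continuous_map_hsub:
  assumes "continuous_map HE X f"
  shows "continuous_map (top_of_set (hsub M)) (subtopology X (f ` hsub M)) f"
proof -
  have "continuous_map (subtopology HE (hsub M)) X f"
    by (rule continuous_map_from_subtopology[OF assms])
  then show ?thesis
    unfolding subtopology_HE continuous_map_in_subtopology by auto
qed

lemma null_family_image_tails:
  assumes f: "continuous_map HE X f" "f b0 = x"
  shows "null_family X x UNIV (\<lambda>n. f ` hsub {n..})"
  unfolding null_family_def
proof (intro allI impI)
  fix U assume U: "openin X U \<and> x \<in> U"
  let ?V = "{z \<in> topspace HE. f z \<in> U}"
  have "openin HE ?V" "b0 \<in> ?V"
    using f U b0_in_HE by (auto simp: continuous_map_def)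
  then have "finite {n \<in> UNIV. \<not> hsub {n..} \<subseteq> ?V}"
    by (rule null_familyD[OF null_family_tails])
  then show "finite {n \<in> UNIV. \<not> f ` hsub {n..} \<subseteq> U}"
    by (rule rev_finite_subset) auto
qed

lemma path_concat_joinpaths: "path_concat p q = p +++ q"
  by (auto simp: path_concat_def joinpaths_def)

text \<open>Intended for the pairs \<open>path_concat (R m) (P (Suc m))\<close>, in which the second
  loop is only homotopic to the one reversed in the first.\<close>

lemma inverse_cancel_homotopic:
  fixes x :: "'a::real_normed_vector"
  assumes P: "loop_homotopic (top_of_set S) b P" and b: "loop (top_of_set S) x b"
  shows "loop_homotopic (top_of_set S) (path_concat (reversepath b) P) (\<lambda>t. x)"
proof -
  note pb = loop_path[OF b]
  have "homotopic_paths S (reversepath b +++ P) (reversepath b +++ b)"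
  proof (rule homotopic_paths_join)
    show "homotopic_paths S (reversepath b) (reversepath b)"
      using pb by simp
    show "homotopic_paths S P b"
      using loop_homotopic_sym[OF P] by (simp only: loop_homotopic_paths)
    show "pathfinish (reversepath b) = pathstart P"
      using loop_homotopic_ends[OF P] b by (simp add: pathstart_def loop_def)
  qed
  moreover have "homotopic_paths S (reversepath b +++ b) (linepath x x)"
    using homotopic_paths_linv[OF pb(1,2)] pb(4) by simp
  moreover have "linepath x x = (\<lambda>t. x)"
    by (auto simp: linepath_def algebra_simps)
  ultimately show ?thesis
    unfolding loop_homotopic_paths path_concat_joinpaths by (metis homotopic_paths_trans)
qed

lemma concat_inverse_cancel_homotopic:
  fixes x :: "'a::real_normed_vector"
  assumes a: "loop (top_of_set S) x a" and b: "loop (top_of_set S) x b"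
  shows "loop_homotopic (top_of_set S) (path_concat (path_concat a b) (reversepath b)) a"
proof -
  note pa = loop_path[OF a] and pb = loop_path[OF b]
  have "homotopic_paths S (a +++ (b +++ reversepath b)) ((a +++ b) +++ reversepath b)"
    by (rule homotopic_paths_assoc) (use pa pb in auto)
  moreover have "homotopic_paths S (a +++ (b +++ reversepath b)) (a +++ linepath x x)"
  proof (rule homotopic_paths_join)
    show "homotopic_paths S (b +++ reversepath b) (linepath x x)"
      using homotopic_paths_rinv[OF pb(1,2)] pb(3) by simp
  qed (use pa pb in auto)
  moreover have "homotopic_paths S (a +++ linepath x x) a"
    using homotopic_paths_rid[OF pa(1,2)] pa(4) by simp
  ultimately show ?thesis
    unfolding loop_homotopic_paths path_concat_joinpaths
    by (metis homotopic_paths_trans homotopic_paths_sym)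
qed

lemma loop_reversepath:
  assumes "loop (top_of_set S) x p"
  shows "loop (top_of_set S) x (reversepath p)"
proof -
  have "path (reversepath p)" "path_image (reversepath p) \<subseteq> S"
    using loop_path(1,2)[OF assms] by simp_all
  moreover have "reversepath p 0 = x" "reversepath p 1 = x"
    using assms by (simp_all add: reversepath_def loop_def)
  ultimately show ?thesis
    by (auto simp: loop_def pathin_def path_def path_image_def)
qed

lemma collapse_collapse: "M \<subseteq> N \<Longrightarrow> collapse M (collapse N z) = collapse M z"
  using hsub_mono[of M N] by (auto simp: collapse_def)

lemma loop_top_of_set_mono:
  "loop (top_of_set S) x p \<Longrightarrow> S \<subseteq> T \<Longrightarrow> loop (top_of_set T) x p"
  by (auto simp: loop_def pathin_def)

text \<open>With \<open>p\<^sub>n\<close> the image of \<open>p\<close> in the circles from \<open>n\<close> on, split \<open>p\<^sub>n \<simeq> P\<^sub>n\<close> into pieces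
  in circle \<open>n\<close>, assembling to \<open>a\<^sub>n\<close>, and pieces in the later circles, assembling to
  \<open>b\<^sub>n \<simeq> p\<^sub>n\<^sub>+\<^sub>1\<close>. Writing \<open>R\<^sub>n\<close> for the inverse of \<open>b\<^sub>n\<close>, the infinite products
  \<open>P\<^sub>0 (R\<^sub>0 P\<^sub>1) (R\<^sub>1 P\<^sub>2) \<dots>\<close> and \<open>(a\<^sub>0 b\<^sub>0 R\<^sub>0) (a\<^sub>1 b\<^sub>1 R\<^sub>1) \<dots>\<close> consist of the same pieces.\<close>

theorem homotopic_inf_prod_of_collapses:
  assumes comm: "infinitely_pi1_commutative X x" and x: "x \<in> topspace X"
    and f: "continuous_map HE X f" "f b0 = x" and p: "loop HE b0 p"
  shows "loop_homotopic X (f \<circ> p) (inf_prod x (\<lambda>n. f \<circ> (collapse {n} \<circ> p)))"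
proof -
  have f0: "f 0 = x"
    using f(2) by (simp add: b0_def)
  define pn where "pn n = collapse {n..} \<circ> p" for n
  have col0: "collapse M 0 = 0" for M
    by (simp add: collapse_def)
  have lcol: "loop (top_of_set (hsub M)) 0 (collapse M \<circ> p)" for M
    using loop_compose[OF p continuous_map_collapse[of M]] by (simp add: b0_def col0)
  have pn: "loop (top_of_set (hsub {n..})) 0 (pn n)" for n
    unfolding pn_def by (rule lcol)
  have pn1: "collapse {n} \<circ> pn n = collapse {n} \<circ> p" "collapse {Suc n..} \<circ> pn n = pn (Suc n)" for n
  proof -
    have "{n} \<subseteq> {n..}" "{Suc n..} \<subseteq> {n..}"
      by auto
    then show "collapse {n} \<circ> pn n = collapse {n} \<circ> p" "collapse {Suc n..} \<circ> pn n = pn (Suc n)"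
      unfolding pn_def by (auto simp: collapse_collapse)
  qed
  obtain N W C P a b where
        tP: "\<And>n. has_tiles 0 {..<N n :: nat} (C n) (P n)"
    and ta: "\<And>n. has_tiles 0 ({..<N n} \<inter> W n) (C n) (a n)"
    and tb: "\<And>n. has_tiles 0 ({..<N n} - W n) (C n) (b n)"
    and lC: "\<And>n i. i < N n \<Longrightarrow> loop (top_of_set (hsub {n..})) 0 (C n i)"
    and hP: "\<And>n. loop_homotopic (top_of_set (hsub {n..})) (pn n) (P n)"
    and ha: "\<And>n. loop_homotopic (top_of_set (hsub {n})) (collapse {n} \<circ> p) (a n)"
    and hb: "\<And>n. loop_homotopic (top_of_set (hsub {Suc n..})) (pn (Suc n)) (b n)"
  proof -
    have "\<forall>n. \<exists>N W C P a b. has_tiles 0 {..<N::nat} C P \<and> has_tiles 0 ({..<N} \<inter> W) C a \<and>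
      has_tiles 0 ({..<N} - W) C b \<and> (\<forall>i<N. loop (top_of_set (hsub {n..})) 0 (C i)) \<and>
      loop_homotopic (top_of_set (hsub {n..})) (pn n) P \<and>
      loop_homotopic (top_of_set (hsub {n})) (collapse {n} \<circ> p) a \<and>
      loop_homotopic (top_of_set (hsub {Suc n..})) (pn (Suc n)) b"
      using wedge_decomposition[OF pn] unfolding pn1 by simp
    then obtain N W C P a b where *: "\<forall>n. has_tiles 0 {..<N n :: nat} (C n) (P n) \<and>
      has_tiles 0 ({..<N n} \<inter> W n) (C n) (a n) \<and> has_tiles 0 ({..<N n} - W n) (C n) (b n) \<and>
      (\<forall>i<N n. loop (top_of_set (hsub {n..})) 0 (C n i)) \<and>
      loop_homotopic (top_of_set (hsub {n..})) (pn n) (P n) \<and>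
      loop_homotopic (top_of_set (hsub {n})) (collapse {n} \<circ> p) (a n) \<and>
      loop_homotopic (top_of_set (hsub {Suc n..})) (pn (Suc n)) (b n)"
      unfolding choice_iff by (elim exE) (rule that)
    show ?thesis
      by (rule that[of N C P W a b]) (use * in auto)
  qed
  define R where "R n = reversepath (b n)" for n
  have lP: "loop (top_of_set (hsub {n..})) 0 (P n)" for n
    using loop_homotopic_loop(2)[OF hP] pn[of n] by (simp add: loop_def)
  have lb: "loop (top_of_set (hsub {Suc n..})) 0 (b n)" for n
    using loop_homotopic_loop(2)[OF hb] pn[of "Suc n"] by (simp add: loop_def)
  have la: "loop (top_of_set (hsub {n})) 0 (a n)" for n
    using loop_homotopic_loop(2)[OF ha] lcol[of "{n}"] by (simp add: loop_def)
  have lR: "loop (top_of_set (hsub {Suc n..})) 0 (R n)" for n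
    unfolding R_def by (rule loop_reversepath[OF lb])
  have sub1: "hsub {Suc n..} \<subseteq> hsub {n..}" and sub2: "hsub {n} \<subseteq> hsub {n..}" for n
    by (auto intro!: hsub_mono)
  note push = loop_homotopic_compose[OF _ continuous_map_hsub[OF f(1)]]
  note pushl = loop_compose[OF _ continuous_map_hsub[OF f(1)], of _ 0, unfolded f0]
  note tails = null_family_image_tails[OF f]

  define G where "G n = (case n of 0 \<Rightarrow> P 0 | Suc m \<Rightarrow> path_concat (R m) (P (Suc m)))" for n
  define F0 where "F0 = inf_prod x (\<lambda>n. f \<circ> G n)"
  define F2 where "F2 = inf_prod x (\<lambda>n. f \<circ> path_concat (path_concat (a n) (b n)) (R n))"

  have 1: "loop_homotopic X (f \<circ> p) F0"
  proof -
    \<comment> \<open>Every factor of \<open>F0\<close> except the first is null-homotopic within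
      its own tail of circles, so all cancellations can be carried out at once.\<close>
    define e where "e n = (if n = 0 then P 0 else (\<lambda>t. 0))" for n :: nat
    have hG: "loop_homotopic (top_of_set (hsub {n..})) (G n) (e n)" for n
    proof (cases n)
      case 0
      then show ?thesis
        using loop_homotopic_refl[OF lP[of 0]] by (simp add: G_def e_def)
    next
      case (Suc m)
      have "loop_homotopic (top_of_set (hsub {Suc m..})) (b m) (P (Suc m))"
        by (rule loop_homotopic_trans[OF loop_homotopic_sym[OF hb] hP])
      from inverse_cancel_homotopic[OF this lb] show ?thesis
        by (simp add: Suc G_def e_def R_def)
    qed
    have e_ends: "e n 0 = 0" "e n 1 = 0" for n
      using lP[of 0] by (auto simp: e_def loop_def)
    have G_ends: "G n 0 = 0" "G n 1 = 0" for n
      using loop_homotopic_ends[OF hG[of n]] e_ends[of n] by simp_all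
    have "loop_homotopic X F0 (inf_prod x (\<lambda>n. f \<circ> e n))"
      unfolding F0_def
      by (rule inf_prod_homotopic[OF x push[OF hG] _ _ tails]) (simp_all add: G_ends f0)
    moreover have "loop_homotopic X (inf_prod x (\<lambda>n. f \<circ> e n)) (f \<circ> e 0)"
    proof (rule tiles_as_single[OF tiles_as_restrict[OF tiles_as_inf_prod]])
      show "(f \<circ> e n) t = x" if "n \<in> UNIV - {0}" for n t
        using that f0 by (simp add: e_def)
      show "loop X x (f \<circ> e 0)"
        using loop_subtopologyD(1)[OF pushl[OF lP[of 0]]] by (simp add: e_def)
    qed simp
    moreover have "loop_homotopic X (f \<circ> pn 0) (f \<circ> e 0)"
      using loop_homotopic_subtopology[OF push[OF hP[of 0]]] by (simp add: e_def)
    moreover have "loop_homotopic X (f \<circ> p) (f \<circ> pn 0)"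
    proof -
      have eq: "pn 0 t = p t" if "t \<in> {0..1}" for t
      proof -
        have "p t \<in> topspace HE"
          using p that by (auto simp: loop_def pathin_def continuous_map_def Pi_iff)
        then show ?thesis
          by (simp add: pn_def collapse_def HE_def hawaiian_eq atLeast_0)
      qed
      have "loop_homotopic X (f \<circ> p) (f \<circ> p)"
        by (rule loop_homotopic_refl[OF loop_compose[OF p f(1)]])
      then show ?thesis
        by (rule loop_homotopic_cong[THEN iffD1, rotated 2]) (simp_all add: eq)
    qed
    ultimately show ?thesis
      by (meson loop_homotopic_sym loop_homotopic_trans)
  qed

  have 2: "loop_homotopic X F2 (inf_prod x (\<lambda>n. f \<circ> (collapse {n} \<circ> p)))"
  proof -
    \<comment> \<open>Here \<open>b n\<close> cancels with its inverse inside tail \<open>n\<close>,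
      which leaves the projection to circle \<open>n\<close>.\<close>
    have h: "loop_homotopic (top_of_set (hsub {n..})) (path_concat (path_concat (a n) (b n)) (R n)) (collapse {n} \<circ> p)" for n
    proof (rule loop_homotopic_trans)
      show "loop_homotopic (top_of_set (hsub {n..})) (path_concat (path_concat (a n) (b n)) (R n)) (a n)"
        unfolding R_def
        by (rule concat_inverse_cancel_homotopic[OF loop_top_of_set_mono[OF la sub2] loop_top_of_set_mono[OF lb sub1]])
      show "loop_homotopic (top_of_set (hsub {n..})) (a n) (collapse {n} \<circ> p)"
        by (rule loop_homotopic_mono[OF loop_homotopic_sym[OF ha] sub2])
    qed
    have ends: "path_concat (path_concat (a n) (b n)) (R n) 0 = 0" "path_concat (path_concat (a n) (b n)) (R n) 1 = 0" for n
      using loop_homotopic_ends[OF h[of n]] lcol[of "{n}"] by (simp_all add: loop_def)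
    show ?thesis
      unfolding F2_def
      by (rule inf_prod_homotopic[OF x push[OF h] _ _ tails]) (simp_all add: ends f0)
  qed

  \<comment> \<open>\<open>(n, Some i)\<close> stands for cell \<open>i\<close> of stage
    \<open>n\<close>, and \<open>(n, None)\<close> for the reversed remainder, which is kept as a
    single piece.\<close>
  define piece where "piece = (\<lambda>(n, j). case j of None \<Rightarrow> R n | Some i \<Rightarrow> C n i)"
  define K where "K = (SIGMA n:UNIV. insert None (Some ` {..<N n}))"
  let ?Q = "\<lambda>n J. (\<lambda>i. (n, Some i)) ` J"
  have tQ: "has_tiles 0 (?Q n J) piece F" if "has_tiles 0 J (C n) F" for n J F
  proof (rule has_tiles_reindex[OF that])
    show "bij_betw (the \<circ> snd) (?Q n J) J"
      by (auto simp: bij_betw_def inj_on_def image_iff)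
    show "piece l = C n ((the \<circ> snd) l)" if "l \<in> ?Q n J" for l
      using that by (auto simp: piece_def)
  qed
  have tR: "has_tiles 0 {(n, None)} piece (R n)" for n
    using has_tiles_whole[of piece "(n, None)" 0] lR[of n] by (simp add: piece_def loop_def)
  have infK: "infinite K"
  proof
    assume "finite K"
    moreover have "fst ` K = UNIV"
      by (force simp: K_def)
    ultimately show False
      by (metis finite_imageI infinite_UNIV_nat)
  qed
  have finfib: "finite {k \<in> K. fst k = n}" for n
  proof -
    have "{k \<in> K. fst k = n} \<subseteq> {n} \<times> insert None (Some ` {..<N n})"
      by (auto simp: K_def)
    then show ?thesis
      by (rule finite_subset) simp
  qed
  have 3: "loop_homotopic X F0 F2"
  proof (rule omega_tiled_rearrange[OF comm x infK])
    show "omega_tiled x K (\<lambda>k. f \<circ> piece k) F0"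
      unfolding F0_def
    proof (rule omega_tiled_inf_prod)
      \<comment> \<open>In \<open>F0\<close> the loop \<open>R n\<close> stands in factor
        \<open>Suc n\<close>, in front of \<open>P (Suc n)\<close>, whereas in \<open>F2\<close> it
        stands in factor \<open>n\<close>. Cells always belong to the factor of their stage.\<close>
      let ?\<pi> = "\<lambda>k. case snd k of None \<Rightarrow> Suc (fst k) | Some i \<Rightarrow> fst k"
      have fib0: "{k \<in> K. ?\<pi> k = 0} = ?Q 0 {..<N 0}"
        by (auto simp: K_def split: option.splits)
      have fibS: "{k \<in> K. ?\<pi> k = Suc m} = {(m, None)} \<union> ?Q (Suc m) {..<N (Suc m)}" for m
        by (auto simp: K_def split: option.splits)
      fix n
      show "finite {k \<in> K. ?\<pi> k = n}"
        by (cases n) (simp_all only: fib0 fibS finite_Un finite_imageI finite_lessThan finite.intros simp_thms)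
      have "has_tiles 0 {k \<in> K. ?\<pi> k = n} piece (G n)"
      proof (cases n)
        case 0
        then show ?thesis
          using tQ[OF tP[of 0]] by (simp only: fib0 G_def nat.case)
      next
        case (Suc m)
        have "has_tiles 0 ({(m, None)} \<union> ?Q (Suc m) {..<N (Suc m)}) piece (path_concat (R m) (P (Suc m)))"
          by (rule has_tiles_path_concat[OF tR tQ[OF tP]]) auto
        then show ?thesis
          by (simp only: Suc fibS G_def nat.case)
      qed
      from has_tiles_compose[OF this, of f] show "has_tiles x {k \<in> K. ?\<pi> k = n} (\<lambda>k. f \<circ> piece k) (f \<circ> G n)"
        unfolding f0 .
    qed
    show "omega_tiled x K (\<lambda>k. f \<circ> piece k) F2"
      unfolding F2_def
    proof (rule omega_tiled_inf_prod[where \<pi>=fst, OF finfib])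
      fix n
      \<comment> \<open>The cells of stage \<open>n\<close> are now sorted into those on circle
        \<open>n\<close> and those on later circles; this is where the order of the pieces really
        changes.\<close>
      have fib: "{k \<in> K. fst k = n} = (?Q n ({..<N n} \<inter> W n) \<union> ?Q n ({..<N n} - W n)) \<union> {(n, None)}"
        by (auto simp: K_def)
      have "has_tiles 0 {k \<in> K. fst k = n} piece (path_concat (path_concat (a n) (b n)) (R n))"
        unfolding fib by (intro has_tiles_path_concat tQ ta tb tR) auto
      from has_tiles_compose[OF this, of f]
      show "has_tiles x {k \<in> K. fst k = n} (\<lambda>k. f \<circ> piece k) (f \<circ> path_concat (path_concat (a n) (b n)) (R n))"
        unfolding f0 .
    qed
    fix k assume k: "k \<in> K"
    obtain n j where nj: "k = (n, j)"
      by (metis surj_pair)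
    have "loop (top_of_set (hsub {fst k..})) 0 (piece k)"
      using k lC loop_top_of_set_mono[OF lR sub1] by (auto simp: nj K_def piece_def)
    from pushl[OF this] show "loop (subtopology X (f ` hsub {fst k..})) x (f \<circ> piece k)" .
  next
    show "null_family X x K (\<lambda>k. f ` hsub {fst k..})"
      unfolding null_family_def
    proof (intro allI impI)
      fix U assume U: "openin X U \<and> x \<in> U"
      have "{k \<in> K. \<not> f ` hsub {fst k..} \<subseteq> U} = (\<Union>n\<in>{n \<in> UNIV. \<not> f ` hsub {n..} \<subseteq> U}. {k \<in> K. fst k = n})"
        by auto
      moreover have "finite {n \<in> UNIV. \<not> f ` hsub {n..} \<subseteq> U}"
        by (rule null_familyD[OF tails]) (use U in auto)
      ultimately show "finite {k \<in> K. \<not> f ` hsub {fst k..} \<subseteq> U}"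
        using finfib by simp
    qed
  qed
  show ?thesis
    by (rule loop_homotopic_trans[OF 1 loop_homotopic_trans[OF 3 2]])
qed

text \<open>The projection of \<open>p\<close> to circle \<open>n\<close> is coordinate
  \<open>n\<close> of \<open>eta \<circ> p\<close> drawn on that circle. Loops homotopic in the
  torus therefore have homotopic projections, circle by circle, and the infinite products of these
  represent \<open>f \<circ> p\<close> and \<open>f \<circ> q\<close>.\<close>

lemma eta_homotopic_imp_homotopic:
  assumes comm: "infinitely_pi1_commutative X x" and x: "x \<in> topspace X"
    and f: "continuous_map HE X f" "f b0 = x" and p: "loop HE b0 p" and q: "loop HE b0 q"
    and eta: "loop_homotopic torus (eta \<circ> p) (eta \<circ> q)"
  shows "loop_homotopic X (f \<circ> p) (f \<circ> q)"
proof -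
  have col: "collapse {n} z = circle_in n (eta z n)" for n z
    by (simp add: circle_in_def eta_eq del: of_nat_Suc)
  have h: "loop_homotopic (top_of_set (hsub {n})) (collapse {n} \<circ> p) (collapse {n} \<circ> q)" for n
    using loop_homotopic_compose[OF loop_homotopic_torus_component[OF eta] continuous_map_circle_in[of n]]
    unfolding subtopology_HE by (simp add: o_def col)
  have "loop_homotopic X (inf_prod x (\<lambda>n. f \<circ> (collapse {n} \<circ> p))) (inf_prod x (\<lambda>n. f \<circ> (collapse {n} \<circ> q)))"
  proof (rule inf_prod_homotopic[OF x loop_homotopic_compose[OF h continuous_map_hsub[OF f(1)]]])
    show "null_family X x UNIV (\<lambda>n. f ` hsub {n})"
      by (rule null_family_mono[OF null_family_image_tails[OF f]]) (auto intro!: image_mono hsub_mono)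
    show "(f \<circ> (collapse {n} \<circ> p)) 0 = x" "(f \<circ> (collapse {n} \<circ> p)) 1 = x" for n
      using p f(2) by (simp_all add: loop_def collapse_def b0_def)
  qed
  then show ?thesis
    using homotopic_inf_prod_of_collapses[OF comm x f p] homotopic_inf_prod_of_collapses[OF comm x f q]
    by (meson loop_homotopic_sym loop_homotopic_trans)
qed

text \<open>\<open>eta_surjective\<close> provides a loop of the earring over every class of the
  torus, and \<open>eta_homotopic_imp_homotopic\<close> makes the class of its image in
  \<open>X\<close> independent of the choice.\<close>

theorem infinitely_imp_factors:
  assumes x: "x \<in> topspace X" and comm: "infinitely_pi1_commutative X x"
  shows "factors_through_eta X x"
  unfolding factors_through_eta_def
proof (intro allI impI)
  fix f assume "continuous_map HE X f \<and> f b0 = x"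
  then have f: "continuous_map HE X f" "f b0 = x"
    by auto
  have eb: "eta b0 = x0"
    by (auto simp: eta_def b0_def x0_def)
  define g where "g B = loop_class X (f \<circ> (SOME p. loop HE b0 p \<and> loop_class torus (eta \<circ> p) = B))" for B
  have lf: "loop X x (f \<circ> p)" if "loop HE b0 p" for p
    using loop_compose[OF that f(1)] f(2) by simp
  have le: "loop torus x0 (eta \<circ> p)" if "loop HE b0 p" for p
    using loop_compose[OF that continuous_map_eta] eb by simp
  have g: "g (loop_class torus (eta \<circ> p)) = loop_class X (f \<circ> p)" if p: "loop HE b0 p" for p
  proof -
    define q where "q = (SOME q. loop HE b0 q \<and> loop_class torus (eta \<circ> q) = loop_class torus (eta \<circ> p))"
    have q: "loop HE b0 q \<and> loop_class torus (eta \<circ> q) = loop_class torus (eta \<circ> p)"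
      unfolding q_def by (rule someI[of _ p]) (simp add: p)
    then have "loop_homotopic torus (eta \<circ> q) (eta \<circ> p)"
      using loop_class_eq_iff[OF le] by blast
    then have "loop_homotopic X (f \<circ> q) (f \<circ> p)"
      using eta_homotopic_imp_homotopic[OF comm x f _ p] q by blast
    then show ?thesis
      using loop_class_eq_iff[OF lf] q by (simp add: g_def q_def)
  qed
  have surj: "\<exists>p. loop HE b0 p \<and> B = loop_class torus (eta \<circ> p)"
    if B: "B \<in> carrier (fundamental_group torus x0)" for B
  proof -
    obtain q where q: "loop torus x0 q" "B = loop_class torus q"
      using B by (auto simp: carrier_fundamental_group)
    then obtain p where "loop HE b0 p" "loop_homotopic torus (eta \<circ> p) q"
      using eta_surjective by blast
    then show ?thesis
      using loop_class_eq_iff[OF le] q(2) by blast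
  qed
  show "\<exists>g. g \<in> hom (fundamental_group torus x0) (fundamental_group X x) \<and>
      (\<forall>A\<in>carrier (fundamental_group HE b0). induced X f A = g (induced torus eta A))"
  proof (intro exI[of _ g] conjI ballI)
    show "g \<in> hom (fundamental_group torus x0) (fundamental_group X x)"
    proof (rule homI)
      fix B assume "B \<in> carrier (fundamental_group torus x0)"
      then obtain p where "loop HE b0 p" "B = loop_class torus (eta \<circ> p)"
        using surj by blast
      then show "g B \<in> carrier (fundamental_group X x)"
        using g lf by (simp add: carrier_fundamental_group)
    next
      fix B B' assume "B \<in> carrier (fundamental_group torus x0)" "B' \<in> carrier (fundamental_group torus x0)"
      then obtain p p' where p: "loop HE b0 p" "B = loop_class torus (eta \<circ> p)"
        and p': "loop HE b0 p'" "B' = loop_class torus (eta \<circ> p')"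
        using surj by meson
      \<comment> \<open>A concatenation of loops over \<open>B\<close> and \<open>B'\<close> lies
        over their product, and \<open>g\<close> may be evaluated on any loop over a class.\<close>
      have "B \<otimes>\<^bsub>fundamental_group torus x0\<^esub> B' = loop_class torus (eta \<circ> path_concat p p')"
        unfolding p(2) p'(2) compose_path_concat by (rule fundamental_group_mult[OF le[OF p(1)] le[OF p'(1)]])
      then have "g (B \<otimes>\<^bsub>fundamental_group torus x0\<^esub> B') = loop_class X (f \<circ> path_concat p p')"
        using g[OF loop_path_concat[OF p(1) p'(1)]] by simp
      also have "\<dots> = g B \<otimes>\<^bsub>fundamental_group X x\<^esub> g B'"
        unfolding p(2) p'(2) g[OF p(1)] g[OF p'(1)] compose_path_concat
        by (rule fundamental_group_mult[OF lf[OF p(1)] lf[OF p'(1)], symmetric])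
      finally show "g (B \<otimes>\<^bsub>fundamental_group torus x0\<^esub> B') = g B \<otimes>\<^bsub>fundamental_group X x\<^esub> g B'" .
    qed
    fix A assume "A \<in> carrier (fundamental_group HE b0)"
    then obtain p where p: "loop HE b0 p" "A = loop_class HE p"
      by (auto simp: carrier_fundamental_group)
    then show "induced X f A = g (induced torus eta A)"
      using induced_loop_class[OF p(1) f(1)] induced_loop_class[OF p(1) continuous_map_eta] g[OF p(1)] by simp
  qed
qed

theorem mainTheorem3:
  fixes X :: "'a topology" and x :: 'a
  assumes "x \<in> topspace X"
  shows "(factors_through_eta X x \<longleftrightarrow> transfinitely_pi1_commutative X x) \<and>
         (transfinitely_pi1_commutative X x \<longleftrightarrow> infinitely_pi1_commutative X x)"
  using factors_imp_transfinitely[OF assms] transfinitely_imp_infinitely[OF assms]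
    infinitely_imp_factors[OF assms] by blast

end
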